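(* Let $A$ be a short local algebra of Hilbert type $(e,a)$ which is not self-injective. If there exists a reflexive $A$-module which is not projective, then $2\le a\le e-1$. Also, the left module ${}_AJ$ and the right module $J_A$ are solid.
   Context: Let $k$ be a field. All algebras $A$ are finite-dimensional local (not necessarily commutative) $k$-algebras with radical $J$ such that $A/J=k$. $A$ is short if $J^3=0$. For a module $M$, $|M|$ denotes its length. Put $e=|J/J^2|$ and $a=|J^2|$; the pair $(e,a)$ is the Hilbert type of the short local algebra $A$. Modules are left $A$-modules of finite length unless otherwise said. $A$ is self-injective if ${}_AA$ is an injective module. For a left module $M$, $M^*=\operatorname{Hom}_A(M,{}_AA)$ (a right $A$-module), and similarly for right modules; $M$ is reflexive if the canonical map $\phi_M\colon M\to M^{**}$, $\phi_M(m)(\alpha)=\alpha(m)$, is bijective. A non-zero (left or right) module $M$ of Loewy length at most $2$ is solid if every endomorphism of $M$ restricts to the socle $\operatorname{soc}M$ as multiplication by a scalar in $k$. *)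

theory Defs
  imports
    "HOL-Algebra.QuotRing"
    "HOL-Algebra.Ideal_Product"
    "Jordan_Normal_Form.Missing_VectorSpace"
begin

section \<open>Modules over a not necessarily commutative ring\<close>

text \<open>
  The locale \<^locale>\<open>module\<close> of HOL-Algebra requires a commutative ring of scalars. Its record
  type, the relation \<^const>\<open>Module.submodule\<close> and \<^const>\<open>module_hom\<close> do not, and are used below.
  The components \<open>mult\<close> and \<open>one\<close> of a module record carry no meaning for modules.

  A right \<open>R\<close>-module is a left module over the opposite ring; its \<open>smult r x\<close> is \<open>x r\<close>.
\<close>

definition opposite :: "('a, 'b) ring_scheme \<Rightarrow> ('a, 'b) ring_scheme" where
  "opposite R = R\<lparr>mult := (\<lambda>x y. y \<otimes>\<^bsub>R\<^esub> x)\<rparr>"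

locale left_module = R?: ring R + M?: abelian_group M
  for R :: "('a, 'b) ring_scheme" and M :: "('a, 'm, 'c) module_scheme" +
  assumes smult_closed:
      "\<lbrakk>r \<in> carrier R; x \<in> carrier M\<rbrakk> \<Longrightarrow> r \<odot>\<^bsub>M\<^esub> x \<in> carrier M"
    and smult_l_distr:
      "\<lbrakk>r \<in> carrier R; s \<in> carrier R; x \<in> carrier M\<rbrakk>
        \<Longrightarrow> (r \<oplus>\<^bsub>R\<^esub> s) \<odot>\<^bsub>M\<^esub> x = r \<odot>\<^bsub>M\<^esub> x \<oplus>\<^bsub>M\<^esub> s \<odot>\<^bsub>M\<^esub> x"
    and smult_r_distr:
      "\<lbrakk>r \<in> carrier R; x \<in> carrier M; y \<in> carrier M\<rbrakk>
        \<Longrightarrow> r \<odot>\<^bsub>M\<^esub> (x \<oplus>\<^bsub>M\<^esub> y) = r \<odot>\<^bsub>M\<^esub> x \<oplus>\<^bsub>M\<^esub> r \<odot>\<^bsub>M\<^esub> y"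
    and smult_assoc:
      "\<lbrakk>r \<in> carrier R; s \<in> carrier R; x \<in> carrier M\<rbrakk>
        \<Longrightarrow> (r \<otimes>\<^bsub>R\<^esub> s) \<odot>\<^bsub>M\<^esub> x = r \<odot>\<^bsub>M\<^esub> (s \<odot>\<^bsub>M\<^esub> x)"
    and smult_one:
      "x \<in> carrier M \<Longrightarrow> \<one>\<^bsub>R\<^esub> \<odot>\<^bsub>M\<^esub> x = x"

definition left_regular :: "('a, 'b) ring_scheme \<Rightarrow> ('a, 'a) module" where
  "left_regular R = \<lparr>carrier = carrier R, mult = mult R, one = \<one>\<^bsub>R\<^esub>,
     zero = \<zero>\<^bsub>R\<^esub>, add = add R, smult = mult R\<rparr>"

definition quotient_module ::
  "('a, 'm, 'c) module_scheme \<Rightarrow> 'm set \<Rightarrow> ('a, 'm set) module" where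
  "quotient_module M N = \<lparr>carrier = a_rcosets\<^bsub>M\<^esub> N, mult = undefined, one = undefined,
     zero = N, add = set_add M, smult = (\<lambda>r X. \<Union>x\<in>X. N +>\<^bsub>M\<^esub> (r \<odot>\<^bsub>M\<^esub> x))\<rparr>"


subsection \<open>Length\<close>

definition composition_series ::
  "('a, 'b) ring_scheme \<Rightarrow> ('a, 'm, 'c) module_scheme \<Rightarrow> nat \<Rightarrow> (nat \<Rightarrow> 'm set) \<Rightarrow> bool" where
  "composition_series R M n S \<longleftrightarrow>
     S 0 = {\<zero>\<^bsub>M\<^esub>} \<and> S n = carrier M \<and>
     (\<forall>i\<le>n. Module.submodule (S i) R M) \<and>
     (\<forall>i<n. S i \<subset> S (Suc i) \<and>
        (\<forall>N. Module.submodule N R M \<longrightarrow> \<not> (S i \<subset> N \<and> N \<subset> S (Suc i))))"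

definition finite_length_module ::
  "('a, 'b) ring_scheme \<Rightarrow> ('a, 'm, 'c) module_scheme \<Rightarrow> bool" where
  "finite_length_module R M \<longleftrightarrow> left_module R M \<and> (\<exists>n S. composition_series R M n S)"

text \<open>
  By the Jordan-Hoelder theorem all composition series have the same number of steps, so that
  \<open>LEAST\<close> is no actual choice.
\<close>

definition mlength :: "('a, 'b) ring_scheme \<Rightarrow> ('a, 'm, 'c) module_scheme \<Rightarrow> nat" where
  "mlength R M = (LEAST n. \<exists>S. composition_series R M n S)"


subsection \<open>Socle, radical, Loewy length\<close>

definition simple_module :: "('a, 'b) ring_scheme \<Rightarrow> ('a, 'm, 'c) module_scheme \<Rightarrow> bool" where
  "simple_module R M \<longleftrightarrow> left_module R M \<and> carrier M \<noteq> {\<zero>\<^bsub>M\<^esub>} \<and>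
     (\<forall>N. Module.submodule N R M \<longrightarrow> N = {\<zero>\<^bsub>M\<^esub>} \<or> N = carrier M)"

text \<open>The sum of all simple submodules, i.e. the smallest submodule containing them.\<close>

definition socle :: "('a, 'b) ring_scheme \<Rightarrow> ('a, 'm, 'c) module_scheme \<Rightarrow> 'm set" where
  "socle R M = \<Inter>{N. Module.submodule N R M \<and>
     (\<forall>S. Module.submodule S R M \<and> simple_module R (M\<lparr>carrier := S\<rparr>) \<longrightarrow> S \<subseteq> N)}"

definition maximal_left_ideal :: "('a, 'b) ring_scheme \<Rightarrow> 'a set \<Rightarrow> bool" where
  "maximal_left_ideal R I \<longleftrightarrow> Module.submodule I R (left_regular R) \<and> I \<noteq> carrier R \<and>
     (\<forall>N. Module.submodule N R (left_regular R) \<and> I \<subseteq> N \<longrightarrow> N = I \<or> N = carrier R)"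

definition radical :: "('a, 'b) ring_scheme \<Rightarrow> 'a set" where
  "radical R = carrier R \<inter> \<Inter>{I. maximal_left_ideal R I}"

definition local_ring :: "('a, 'b) ring_scheme \<Rightarrow> bool" where
  "local_ring R \<longleftrightarrow> ring R \<and> (\<exists>!I. maximal_left_ideal R I)"

fun rad_power :: "('a, 'b) ring_scheme \<Rightarrow> nat \<Rightarrow> 'a set" where
  "rad_power R 0 = carrier R"
| "rad_power R (Suc n) = ideal_prod R (rad_power R n) (radical R)"

text \<open>Only meaningful when some power of the radical annihilates \<open>M\<close>.\<close>

definition loewy_length :: "('a, 'b) ring_scheme \<Rightarrow> ('a, 'm, 'c) module_scheme \<Rightarrow> nat" where
  "loewy_length R M =
     (LEAST n. \<forall>r\<in>rad_power R n. \<forall>x\<in>carrier M. r \<odot>\<^bsub>M\<^esub> x = \<zero>\<^bsub>M\<^esub>)"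


subsection \<open>Duality\<close>

text \<open>
  For a left \<open>R\<close>-module \<open>M\<close> this is the right \<open>R\<close>-module \<open>Hom\<^sub>R(M, R)\<close> with
  \<open>(f r)(x) = f(x) r\<close>. Applied to \<^term>\<open>opposite R\<close> and a right \<open>R\<close>-module it is the left
  \<open>R\<close>-module with \<open>(r f)(x) = r f(x)\<close>. Homomorphisms are made extensional so that equality of
  functions is equality of homomorphisms.
\<close>

definition dual_module ::
  "('a, 'b) ring_scheme \<Rightarrow> ('a, 'm, 'c) module_scheme \<Rightarrow> ('a, 'm \<Rightarrow> 'a) module" where
  "dual_module R M = \<lparr>carrier = module_hom R M (left_regular R) \<inter> extensional (carrier M),
     mult = undefined, one = undefined,
     zero = (\<lambda>x\<in>carrier M. \<zero>\<^bsub>R\<^esub>),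
     add = (\<lambda>f g. \<lambda>x\<in>carrier M. f x \<oplus>\<^bsub>R\<^esub> g x),
     smult = (\<lambda>r f. \<lambda>x\<in>carrier M. f x \<otimes>\<^bsub>R\<^esub> r)\<rparr>"

definition bidual_module ::
  "('a, 'b) ring_scheme \<Rightarrow> ('a, 'm, 'c) module_scheme \<Rightarrow> ('a, ('m \<Rightarrow> 'a) \<Rightarrow> 'a) module" where
  "bidual_module R M = dual_module (opposite R) (dual_module R M)"

definition bidual_map ::
  "('a, 'b) ring_scheme \<Rightarrow> ('a, 'm, 'c) module_scheme \<Rightarrow> 'm \<Rightarrow> ('m \<Rightarrow> 'a) \<Rightarrow> 'a" where
  "bidual_map R M m = (\<lambda>\<alpha>\<in>carrier (dual_module R M). \<alpha> m)"

definition reflexive_module :: "('a, 'b) ring_scheme \<Rightarrow> ('a, 'm, 'c) module_scheme \<Rightarrow> bool" where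
  "reflexive_module R M \<longleftrightarrow>
     bij_betw (bidual_map R M) (carrier M) (carrier (bidual_module R M))"


section \<open>Finite-dimensional local algebras\<close>

text \<open>
  A \<open>k\<close>-algebra is a record of type \<open>('k, 'a) module\<close>, as for the (commutative) locale
  \<^locale>\<open>algebra\<close> of HOL-Algebra.
\<close>

locale fd_algebra = vectorspace k A + A: ring A
  for k :: "'k ring" and A :: "('k, 'a) module" +
  assumes smult_mult_left:
      "\<lbrakk>c \<in> carrier k; x \<in> carrier A; y \<in> carrier A\<rbrakk>
        \<Longrightarrow> (c \<odot>\<^bsub>A\<^esub> x) \<otimes>\<^bsub>A\<^esub> y = c \<odot>\<^bsub>A\<^esub> (x \<otimes>\<^bsub>A\<^esub> y)"
    and smult_mult_right:
      "\<lbrakk>c \<in> carrier k; x \<in> carrier A; y \<in> carrier A\<rbrakk>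
        \<Longrightarrow> x \<otimes>\<^bsub>A\<^esub> (c \<odot>\<^bsub>A\<^esub> y) = c \<odot>\<^bsub>A\<^esub> (x \<otimes>\<^bsub>A\<^esub> y)"
    and finite_dimensional: "fin_dim"

text \<open>The last assumption says \<open>A/J = k\<close>.\<close>

locale fd_local_algebra = fd_algebra +
  assumes local: "local_ring A"
    and residue_field:
      "bij_betw (\<lambda>c. radical A +>\<^bsub>A\<^esub> (c \<odot>\<^bsub>A\<^esub> \<one>\<^bsub>A\<^esub>)) (carrier k) (carrier (A Quot radical A))"

definition short_algebra :: "('k, 'a) module \<Rightarrow> bool" where
  "short_algebra A \<longleftrightarrow> rad_power A 3 = {\<zero>\<^bsub>A\<^esub>}"

definition rad_module :: "('k, 'a) module \<Rightarrow> ('a, 'a) module" where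
  "rad_module A = (left_regular A)\<lparr>carrier := radical A\<rparr>"

text \<open>\<open>J\<close> as a right module, i.e. as a module over \<^term>\<open>opposite A\<close>.\<close>

definition right_rad_module :: "('k, 'a) module \<Rightarrow> ('a, 'a) module" where
  "right_rad_module A = (left_regular (opposite A))\<lparr>carrier := radical A\<rparr>"

definition hilbert_type :: "('k, 'a) module \<Rightarrow> nat \<Rightarrow> nat \<Rightarrow> bool" where
  "hilbert_type A e a \<longleftrightarrow>
     e = mlength A (quotient_module (rad_module A) (rad_power A 2)) \<and>
     a = mlength A ((left_regular A)\<lparr>carrier := rad_power A 2\<rparr>)"

text \<open>
  Injectivity and projectivity are meant in the category of modules of finite length. The test
  modules \<open>X\<close>, \<open>Y\<close> have carriers in the fixed type \<open>nat \<Rightarrow> 'k\<close>, with arbitrary module structure.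
  This is no restriction: a module of finite length over a finite-dimensional \<open>k\<close>-algebra is
  finite-dimensional over \<open>k\<close>, so it is isomorphic to one carried by the coordinate vectors
  \<open>x\<close> with \<open>x i = 0\<close> for all \<open>i \<ge> n\<close>. The module tested may have any carrier type.
  As \<open>A\<close> is artinian, Baer's criterion shows that for \<open>M\<close> of finite length nothing changes
  if all modules are admitted as test modules.
\<close>

definition injective_module :: "('k, 'a) module \<Rightarrow> ('a, 'm) module \<Rightarrow> bool" where
  "injective_module A M \<longleftrightarrow> left_module A M \<and>
     (\<forall>(X :: ('a, nat \<Rightarrow> 'k) module) (Y :: ('a, nat \<Rightarrow> 'k) module) f g.
        finite_length_module A X \<and> finite_length_module A Y \<and>
        f \<in> module_hom A X Y \<and> inj_on f (carrier X) \<and> g \<in> module_hom A X M \<longrightarrow>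
        (\<exists>h \<in> module_hom A Y M. \<forall>x\<in>carrier X. h (f x) = g x))"

definition projective_module :: "('k, 'a) module \<Rightarrow> ('a, 'm) module \<Rightarrow> bool" where
  "projective_module A M \<longleftrightarrow> left_module A M \<and>
     (\<forall>(X :: ('a, nat \<Rightarrow> 'k) module) (Y :: ('a, nat \<Rightarrow> 'k) module) f g.
        finite_length_module A X \<and> finite_length_module A Y \<and>
        f \<in> module_hom A X Y \<and> f ` carrier X = carrier Y \<and> g \<in> module_hom A M Y \<longrightarrow>
        (\<exists>h \<in> module_hom A M X. \<forall>x\<in>carrier M. f (h x) = g x))"

definition self_injective :: "('k, 'a) module \<Rightarrow> bool" where
  "self_injective A \<longleftrightarrow> injective_module A (left_regular A)"

text \<open>The scalar \<open>c \<in> k\<close> acts on an \<open>A\<close>-module as \<open>c 1 \<in> A\<close>.\<close>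

definition solid_module :: "'k ring \<Rightarrow> ('k, 'a) module \<Rightarrow> ('a, 'm) module \<Rightarrow> bool" where
  "solid_module k A M \<longleftrightarrow>
     finite_length_module A M \<and> carrier M \<noteq> {\<zero>\<^bsub>M\<^esub>} \<and> loewy_length A M \<le> 2 \<and>
     (\<forall>f \<in> module_hom A M M. \<exists>c\<in>carrier k. \<forall>x\<in>socle A M. f x = (c \<odot>\<^bsub>A\<^esub> \<one>\<^bsub>A\<^esub>) \<odot>\<^bsub>M\<^esub> x)"

end

theory Submission
  imports Defs
begin

text \<open>
  Let \<open>J\<close> be the radical of \<open>A\<close>, let \<open>e\<close> and \<open>a\<close> be the dimensions of \<open>J/J\<^sup>2\<close> and \<open>J\<^sup>2\<close>, and let
  \<open>L\<close> and \<open>R\<close> be the sets of \<open>x \<in> J\<close> with \<open>J x = 0\<close> and with \<open>x J = 0\<close>. Both contain \<open>J\<^sup>2\<close>.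

  A reflexive module that is not projective leaves, after all free summands have been split off, a
  nonzero reflexive module \<open>M\<close> such that every homomorphism \<open>M \<rightarrow> A\<close> has its values in \<open>J\<close>
  (\<open>nonprojective_reflexive_dual_pair\<close>). With \<open>N = M\<^sup>*\<close>, evaluation is a pairing of \<open>N\<close> and \<open>M\<close>
  with values in \<open>J\<close> such that every left linear map \<open>M \<rightarrow> J\<close> is the evaluation of an
  element of \<open>N\<close>, and every right linear map \<open>N \<rightarrow> J\<close> is the evaluation at an element of \<open>M\<close>.
  The locale \<open>dual_pair\<close> axiomatizes this. It is invariant under passing to the opposite algebra
  and exchanging \<open>M\<close> and \<open>N\<close>, so that each of its facts has a mirror image.

  The key observation is that endomorphisms of the left module \<open>J\<close> act on \<open>N\<close>, by composition,
  and those of the right module \<open>J\<close> act on \<open>M\<close>, because they act on \<open>N\<^sup>*\<close>. Hence an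
  endomorphism \<open>\<psi>\<close> of the left and an endomorphism \<open>\<phi>\<close> of the right module \<open>J\<close> commute at
  every value \<open>f(m)\<close>. There are many \<open>\<phi>\<close>: each linear form \<open>\<mu>\<close> on \<open>J/J\<^sup>2\<close> and each \<open>z \<in> R\<close>
  give \<open>\<phi> = \<mu>(-) z\<close>, and the result is
  \<open>\<mu>(f(m)) \<psi>(z) = \<mu>(\<psi>(f(m))) z\<close> (\<open>left_endo_commutes\<close>). Three facts follow.

    \<^item> \<open>L = R = J\<^sup>2\<close>. All elements of \<open>L\<close> are values \<open>f(m)\<close>. If \<open>l \<in> L\<close> is not in \<open>J\<^sup>2\<close>, then
      the formula for \<open>\<psi> = \<mu>(-) l\<close> gives \<open>R \<subseteq> k l\<close> and \<open>J\<^sup>2 = 0\<close>, so \<open>L = J = R\<close> is a line. But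
      then a linear form that does not vanish on \<open>L\<close> identifies \<open>A\<close> with its \<open>k\<close>-dual, and \<open>A\<close>
      is self-injective (\<open>self_injective_if_left_soc_line\<close>).

    \<^item> \<open>a \<ge> 2\<close>, since otherwise \<open>L\<close> is a line again.

    \<^item> Some value \<open>f(m)\<close> is outside \<open>J\<^sup>2\<close>; otherwise \<open>M\<close> and \<open>N\<close> are semisimple, which contradicts
      \<open>a \<ge> 2\<close>. With \<open>\<mu>(f(m)) = 1\<close> the formula says that \<open>\<psi>\<close> is the scalar \<open>\<mu>(\<psi>(f(m)))\<close> on
      \<open>J\<^sup>2\<close>. As \<open>J\<^sup>2\<close> is the socle of \<open>J\<close>, this is solidity.

  The inequality \<open>a < e\<close> is a count of dimensions. Put \<open>t = dim M/JM\<close>, \<open>s = dim JM\<close>,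
  \<open>p = dim M/soc M\<close>, and let \<open>t'\<close>, \<open>s'\<close>, \<open>p'\<close> be the same numbers for \<open>N\<close>. The linear maps
  from \<open>N/NJ\<close> to \<open>J\<^sup>2\<close> are evaluations at elements of \<open>soc M\<close>, so
  \<open>a t' \<le> dim (soc M) = t + s - p\<close>; further \<open>s \<le> e p\<close> and \<open>p \<le> t\<close>. Together
  \<open>a t' \<le> e t\<close>, and by symmetry \<open>a t \<le> e t'\<close>, whence \<open>a \<le> e\<close>. If \<open>a = e\<close>, all these
  inequalities are equalities. Then \<open>M\<close> is free over \<open>A/J\<^sup>2\<close>, so that \<open>N/soc N\<close> has dimension at
  least \<open>e t\<close>, although it has dimension \<open>p' = t\<close>. This contradicts \<open>e = a \<ge> 2\<close>.
\<close>

section \<open>Dimensions of subspaces\<close>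

definition sdim :: "'k ring \<Rightarrow> ('k, 'v) module \<Rightarrow> 'v set \<Rightarrow> nat" where
  "sdim K V U = vectorspace.dim K (V\<lparr>carrier := U\<rparr>)"

context vectorspace
begin

lemma subspaceI:
  assumes "U \<subseteq> carrier V" "\<zero>\<^bsub>V\<^esub> \<in> U"
    and "\<And>x y. \<lbrakk>x \<in> U; y \<in> U\<rbrakk> \<Longrightarrow> x \<oplus>\<^bsub>V\<^esub> y \<in> U"
    and "\<And>c x. \<lbrakk>c \<in> carrier K; x \<in> U\<rbrakk> \<Longrightarrow> c \<odot>\<^bsub>V\<^esub> x \<in> U"
  shows "subspace K U V"
  using assms vectorspace_axioms module_axioms unfolding subspace_def submodule_def by auto

lemma subspaceD:
  assumes "subspace K U V"
  shows "U \<subseteq> carrier V" "\<zero>\<^bsub>V\<^esub> \<in> U"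
    and "\<And>x y. \<lbrakk>x \<in> U; y \<in> U\<rbrakk> \<Longrightarrow> x \<oplus>\<^bsub>V\<^esub> y \<in> U"
    and "\<And>c x. \<lbrakk>c \<in> carrier K; x \<in> U\<rbrakk> \<Longrightarrow> c \<odot>\<^bsub>V\<^esub> x \<in> U"
  using assms unfolding subspace_def submodule_def by auto

lemma subspace_neg:
  assumes "subspace K U V" "x \<in> U" shows "\<ominus>\<^bsub>V\<^esub> x \<in> U"
proof -
  have "\<ominus>\<^bsub>V\<^esub> x = (\<ominus>\<^bsub>K\<^esub> \<one>\<^bsub>K\<^esub>) \<odot>\<^bsub>V\<^esub> x"
    using subspaceD(1)[OF assms(1)] assms(2) by (auto simp: smult_l_minus)
  then show ?thesis using subspaceD(4)[OF assms(1) _ assms(2)] by auto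
qed

lemma subspace_minus:
  assumes "subspace K U V" "x \<in> U" "y \<in> U" shows "x \<ominus>\<^bsub>V\<^esub> y \<in> U"
  using subspaceD(3)[OF assms(1,2) subspace_neg[OF assms(1,3)]] by (simp add: a_minus_def)

lemma subspace_carrier: "subspace K (carrier V) V"
  by (rule subspaceI) auto

lemma subspace_zero: "subspace K {\<zero>\<^bsub>V\<^esub>} V"
  by (rule subspaceI) auto

lemma subspace_Int:
  "subspace K U V \<Longrightarrow> subspace K W V \<Longrightarrow> subspace K (U \<inter> W) V"
  by (rule subspaceI) (auto dest: subspaceD)

lemma subspace_mem_carrier: "subspace K U V \<Longrightarrow> x \<in> U \<Longrightarrow> x \<in> carrier V"
  using subspaceD(1) by auto

lemma in_set_add: "z \<in> U <+>\<^bsub>V\<^esub> W \<longleftrightarrow> (\<exists>x\<in>U. \<exists>y\<in>W. z = x \<oplus>\<^bsub>V\<^esub> y)"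
  by (auto simp: set_add_def set_mult_def)

lemma subspace_set_add:
  assumes U: "subspace K U V" and W: "subspace K W V"
  shows "subspace K (U <+>\<^bsub>V\<^esub> W) V"
proof (rule subspaceI)
  note [simp] = subspace_mem_carrier[OF U] subspace_mem_carrier[OF W]
  show "U <+>\<^bsub>V\<^esub> W \<subseteq> carrier V" by (auto simp: in_set_add)
  show "\<zero>\<^bsub>V\<^esub> \<in> U <+>\<^bsub>V\<^esub> W"
    unfolding in_set_add using subspaceD(2)[OF U] subspaceD(2)[OF W] M.r_zero M.zero_closed by metis
  fix x y assume "x \<in> U <+>\<^bsub>V\<^esub> W" "y \<in> U <+>\<^bsub>V\<^esub> W"
  then obtain u w u' w' where e: "u \<in> U" "w \<in> W" "u' \<in> U" "w' \<in> W"
      "x = u \<oplus>\<^bsub>V\<^esub> w" "y = u' \<oplus>\<^bsub>V\<^esub> w'" by (auto simp: in_set_add)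
  then have "x \<oplus>\<^bsub>V\<^esub> y = (u \<oplus>\<^bsub>V\<^esub> u') \<oplus>\<^bsub>V\<^esub> (w \<oplus>\<^bsub>V\<^esub> w')"
    by (simp add: M.a_ac)
  then show "x \<oplus>\<^bsub>V\<^esub> y \<in> U <+>\<^bsub>V\<^esub> W"
    unfolding in_set_add using subspaceD(3)[OF U] subspaceD(3)[OF W] e by blast
next
  note [simp] = subspace_mem_carrier[OF U] subspace_mem_carrier[OF W]
  fix c x assume c: "c \<in> carrier K" and "x \<in> U <+>\<^bsub>V\<^esub> W"
  then obtain u w where e: "u \<in> U" "w \<in> W" "x = u \<oplus>\<^bsub>V\<^esub> w" by (auto simp: in_set_add)
  then have "c \<odot>\<^bsub>V\<^esub> x = c \<odot>\<^bsub>V\<^esub> u \<oplus>\<^bsub>V\<^esub> c \<odot>\<^bsub>V\<^esub> w" using c by (simp add: smult_r_distr)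
  then show "c \<odot>\<^bsub>V\<^esub> x \<in> U <+>\<^bsub>V\<^esub> W"
    unfolding in_set_add using subspaceD(4)[OF U c] subspaceD(4)[OF W c] e by blast
qed

lemma set_add_upper:
  assumes U: "subspace K U V" and W: "subspace K W V"
  shows "U \<subseteq> U <+>\<^bsub>V\<^esub> W" "W \<subseteq> U <+>\<^bsub>V\<^esub> W"
proof -
  note [simp] = subspace_mem_carrier[OF U] subspace_mem_carrier[OF W]
  have "x = x \<oplus>\<^bsub>V\<^esub> \<zero>\<^bsub>V\<^esub>" if "x \<in> U" for x using that by simp
  then show "U \<subseteq> U <+>\<^bsub>V\<^esub> W"
    unfolding in_set_add subset_iff using subspaceD(2)[OF W] by blast
  have "x = \<zero>\<^bsub>V\<^esub> \<oplus>\<^bsub>V\<^esub> x" if "x \<in> W" for x using that by simp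
  then show "W \<subseteq> U <+>\<^bsub>V\<^esub> W"
    unfolding in_set_add subset_iff using subspaceD(2)[OF U] by blast
qed

definition line :: "'c \<Rightarrow> 'c set" where
  "line v = (\<lambda>c. c \<odot>\<^bsub>V\<^esub> v) ` carrier K"

lemma subspace_line: assumes v: "v \<in> carrier V" shows "subspace K (line v) V"
proof (rule subspaceI)
  show "line v \<subseteq> carrier V" using v by (auto simp: line_def)
  show "\<zero>\<^bsub>V\<^esub> \<in> line v" using v unfolding line_def by (intro image_eqI[of _ _ "\<zero>\<^bsub>K\<^esub>"]) auto
  fix x y assume "x \<in> line v" "y \<in> line v"
  then show "x \<oplus>\<^bsub>V\<^esub> y \<in> line v" using v by (auto simp: line_def smult_l_distr[symmetric])
next
  fix c x assume "c \<in> carrier K" "x \<in> line v"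
  then show "c \<odot>\<^bsub>V\<^esub> x \<in> line v" using v by (auto simp: line_def smult_assoc1[symmetric])
qed

lemma mem_line: "v \<in> carrier V \<Longrightarrow> v \<in> line v"
  unfolding line_def by (intro image_eqI[of _ _ "\<one>\<^bsub>K\<^esub>"]) auto

lemma smult_cancel:
  assumes "c \<in> carrier K" "c \<noteq> \<zero>\<^bsub>K\<^esub>" "v \<in> carrier V"
  shows "inv\<^bsub>K\<^esub> c \<in> carrier K" "inv\<^bsub>K\<^esub> c \<odot>\<^bsub>V\<^esub> (c \<odot>\<^bsub>V\<^esub> v) = v"
    "c \<odot>\<^bsub>V\<^esub> (inv\<^bsub>K\<^esub> c \<odot>\<^bsub>V\<^esub> v) = v"
proof -
  have u: "c \<in> Units K" using assms field_Units by auto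
  then show "inv\<^bsub>K\<^esub> c \<in> carrier K" by auto
  then show "inv\<^bsub>K\<^esub> c \<odot>\<^bsub>V\<^esub> (c \<odot>\<^bsub>V\<^esub> v) = v" "c \<odot>\<^bsub>V\<^esub> (inv\<^bsub>K\<^esub> c \<odot>\<^bsub>V\<^esub> v) = v"
    using u assms by (simp_all add: smult_assoc1[symmetric])
qed

lemma smult_zero_iff:
  "c \<in> carrier K \<Longrightarrow> v \<in> carrier V \<Longrightarrow> c \<odot>\<^bsub>V\<^esub> v = \<zero>\<^bsub>V\<^esub> \<longleftrightarrow> c = \<zero>\<^bsub>K\<^esub> \<or> v = \<zero>\<^bsub>V\<^esub>"
  by (metis lmult_0 rmult_0 smult_cancel(1,2))

lemma subspace_smult_iff:
  assumes "subspace K U V" "c \<in> carrier K" "c \<noteq> \<zero>\<^bsub>K\<^esub>" "v \<in> carrier V"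
  shows "c \<odot>\<^bsub>V\<^esub> v \<in> U \<longleftrightarrow> v \<in> U"
  using assms smult_cancel subspaceD(4) by metis

lemma span_vs: 
  assumes "subspace K U V" "S \<subseteq> U"
  shows "LinearCombinations.module.span K (V\<lparr>carrier := U\<rparr>) S = span S" "LinearCombinations.module.lin_dep K (V\<lparr>carrier := U\<rparr>) S = lin_dep S"
  using span_li_not_depend[of S U] assms by (auto simp: subspace_def)

end

locale fd_space = vectorspace K V for K :: "'k ring" and V :: "('k, 'v) module" +
  assumes fd: "fin_dim"
begin

lemma subspace_basis:
  assumes U: "subspace K U V"
  shows "\<exists>S. finite S \<and> S \<subseteq> U \<and> lin_indpt S \<and> span S = U"
proof -
  interpret U: vectorspace K "V\<lparr>carrier := U\<rparr>" by (rule subspace_is_vs[OF U])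
  let ?P = "\<lambda>S. S \<subseteq> carrier (V\<lparr>carrier := U\<rparr>) \<and> U.lin_indpt S"
  have "finite S \<and> card S \<le> dim" if "?P S" for S
    using that li_le_dim[OF fd, of S] span_vs(2)[OF U, of S] subspaceD(1)[OF U] by auto
  moreover have "?P {}" by (auto simp: U.lin_dep_def)
  ultimately obtain S where S: "finite S" "maximal S ?P"
    using maximal_exists[of ?P dim "{}"] by blast
  then have "U.basis S" by (intro U.max_li_is_basis)
  with S show ?thesis using span_vs[OF U, of S] unfolding U.basis_def by auto
qed

lemma fd_space_subspace:
  assumes U: "subspace K U V"
  shows "fd_space K (V\<lparr>carrier := U\<rparr>)"
proof -
  interpret U: vectorspace K "V\<lparr>carrier := U\<rparr>" by (rule subspace_is_vs[OF U])
  show ?thesis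
    using subspace_basis[OF U] span_vs[OF U] by unfold_locales (auto simp: U.fin_dim_def)
qed

lemma sdim_basis:
  assumes U: "subspace K U V" and "S \<subseteq> U" "finite S" "lin_indpt S" "span S = U"
  shows "sdim K V U = card S"
proof -
  interpret U: vectorspace K "V\<lparr>carrier := U\<rparr>" by (rule subspace_is_vs[OF U])
  have "U.basis S" using assms span_vs[OF U, of S] by (auto simp: U.basis_def)
  then show ?thesis using U.dim_basis assms by (auto simp: sdim_def)
qed

lemma sdim_mono:
  assumes U: "subspace K U V" and W: "subspace K W V" and "U \<subseteq> W"
  shows "sdim K V U \<le> sdim K V W" "sdim K V U = sdim K V W \<Longrightarrow> U = W"
proof -
  interpret W: fd_space K "V\<lparr>carrier := W\<rparr>" by (rule fd_space_subspace[OF W])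
  obtain S where S: "finite S" "S \<subseteq> U" "lin_indpt S" "span S = U"
    using subspace_basis[OF U] by auto
  then have li: "W.lin_indpt S" using span_vs[OF W, of S] assms(3) by auto
  show "sdim K V U \<le> sdim K V W"
    using W.li_le_dim[OF W.fd _ li] S assms sdim_basis[OF U] by (auto simp: sdim_def)
  assume eq: "sdim K V U = sdim K V W"
  have "W.basis S"
    using W.dim_li_is_basis[OF W.fd S(1) _ li] eq S assms(3) sdim_basis[OF U S(2,1,3,4)]
    by (auto simp: sdim_def)
  then show "U = W" using S span_vs[OF W, of S] assms(3) by (auto simp: W.basis_def)
qed

lemma sdim_strict_mono:
  assumes "subspace K U V" "subspace K W V" "U \<subset> W"
  shows "sdim K V U < sdim K V W"
  using sdim_mono[OF assms(1,2)] assms(3) by (metis nat_less_le psubset_eq)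

lemma sdim_zero: "sdim K V {\<zero>\<^bsub>V\<^esub>} = 0"
  using sdim_basis[OF subspace_zero, of "{}"] by (auto simp: lin_dep_def span_def lincomb_def)

lemma sdim_eq_0: "subspace K U V \<Longrightarrow> sdim K V U = 0 \<Longrightarrow> U = {\<zero>\<^bsub>V\<^esub>}"
  using sdim_mono(2)[OF subspace_zero] sdim_zero subspaceD(2) by fastforce

lemma rank_nullity_subspace:
  assumes U: "subspace K U V" and W: "vectorspace K W"
    and T: "T \<in> U \<rightarrow> carrier W"
    and add: "\<And>x y. \<lbrakk>x \<in> U; y \<in> U\<rbrakk> \<Longrightarrow> T (x \<oplus>\<^bsub>V\<^esub> y) = T x \<oplus>\<^bsub>W\<^esub> T y"
    and smult: "\<And>c x. \<lbrakk>c \<in> carrier K; x \<in> U\<rbrakk> \<Longrightarrow> T (c \<odot>\<^bsub>V\<^esub> x) = c \<odot>\<^bsub>W\<^esub> T x"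
  shows "subspace K {x \<in> U. T x = \<zero>\<^bsub>W\<^esub>} V" "subspace K (T ` U) W"
    "sdim K V U = sdim K V {x \<in> U. T x = \<zero>\<^bsub>W\<^esub>} + sdim K W (T ` U)"
proof -
  interpret U: fd_space K "V\<lparr>carrier := U\<rparr>" by (rule fd_space_subspace[OF U])
  interpret W: vectorspace K W by fact
  interpret T: linear_map K "V\<lparr>carrier := U\<rparr>" W T
    by unfold_locales (use T add smult in \<open>auto simp: module_hom_def\<close>)
  have k: "T.kerT = {x \<in> U. T x = \<zero>\<^bsub>W\<^esub>}" and i: "T.imT = T ` U"
    by (auto simp: T.ker_def T.im_def)
  show "subspace K (T ` U) W" using T.imT_is_subspace i by auto
  show "subspace K {x \<in> U. T x = \<zero>\<^bsub>W\<^esub>} V"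
    using U.subspaceD[OF T.kerT_is_subspace[unfolded k]] subspaceD[OF U]
    by (intro subspaceI) auto
  show "sdim K V U = sdim K V {x \<in> U. T x = \<zero>\<^bsub>W\<^esub>} + sdim K W (T ` U)"
    using T.rank_nullity[OF U.fd] k i by (simp add: sdim_def)
qed

lemma sdim_image:
  assumes "subspace K U V" "vectorspace K W" "T \<in> U \<rightarrow> carrier W"
    and "\<And>x y. \<lbrakk>x \<in> U; y \<in> U\<rbrakk> \<Longrightarrow> T (x \<oplus>\<^bsub>V\<^esub> y) = T x \<oplus>\<^bsub>W\<^esub> T y"
    and "\<And>c x. \<lbrakk>c \<in> carrier K; x \<in> U\<rbrakk> \<Longrightarrow> T (c \<odot>\<^bsub>V\<^esub> x) = c \<odot>\<^bsub>W\<^esub> T x"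
    and inj: "\<And>x. \<lbrakk>x \<in> U; T x = \<zero>\<^bsub>W\<^esub>\<rbrakk> \<Longrightarrow> x = \<zero>\<^bsub>V\<^esub>"
  shows "sdim K W (T ` U) = sdim K V U"
proof -
  note rn = rank_nullity_subspace[OF assms(1-5)]
  have "{x \<in> U. T x = \<zero>\<^bsub>W\<^esub>} = {\<zero>\<^bsub>V\<^esub>}" using inj subspaceD(2)[OF rn(1)] by blast
  then show ?thesis using rn(3) sdim_zero by simp
qed

text \<open>
  A subspace of maximal dimension among those that contain \<open>P\<close> and meet \<open>Q\<close> trivially is a complement
  of \<open>Q\<close>, since otherwise a vector outside \<open>C + Q\<close> could be added to it.
\<close>

lemma complement_exists:
  assumes P: "subspace K P V" and Q: "subspace K Q V" and PQ: "P \<inter> Q = {\<zero>\<^bsub>V\<^esub>}"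
  shows "\<exists>C. subspace K C V \<and> P \<subseteq> C \<and> C \<inter> Q = {\<zero>\<^bsub>V\<^esub>} \<and> C <+>\<^bsub>V\<^esub> Q = carrier V"
proof -
  let ?P = "\<lambda>C. subspace K C V \<and> P \<subseteq> C \<and> C \<inter> Q = {\<zero>\<^bsub>V\<^esub>}"
  have "\<exists>C. ?P C \<and> (\<forall>D. ?P D \<longrightarrow> sdim K V D \<le> sdim K V C)"
    by (rule ex_has_greatest_nat[of ?P P _ "Suc (sdim K V (carrier V))"])
      (use P PQ sdim_mono(1)[OF _ subspace_carrier] subspaceD(1) in \<open>auto simp: less_Suc_eq_le\<close>)
  then obtain C where C: "subspace K C V" "P \<subseteq> C" "C \<inter> Q = {\<zero>\<^bsub>V\<^esub>}"
    and max: "\<And>D. ?P D \<Longrightarrow> sdim K V D \<le> sdim K V C" by blast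
  note [simp] = subspace_mem_carrier[OF C(1)] subspace_mem_carrier[OF Q]
  have "v \<in> C <+>\<^bsub>V\<^esub> Q" if v: "v \<in> carrier V" for v
  proof (rule ccontr)
    assume nv: "v \<notin> C <+>\<^bsub>V\<^esub> Q"
    let ?D = "C <+>\<^bsub>V\<^esub> line v"
    note CQ = subspace_set_add[OF C(1) Q]
    have D: "subspace K ?D V" by (intro subspace_set_add C subspace_line v)
    have CD: "C \<subseteq> ?D" "v \<in> ?D" using set_add_upper[OF C(1) subspace_line[OF v]] mem_line[OF v] by auto
    have "x = \<zero>\<^bsub>V\<^esub>" if x: "x \<in> ?D" "x \<in> Q" for x
    proof -
      obtain c \<kappa> where c: "c \<in> C" "\<kappa> \<in> carrier K" "x = c \<oplus>\<^bsub>V\<^esub> \<kappa> \<odot>\<^bsub>V\<^esub> v"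
        using x(1) by (auto simp: in_set_add line_def)
      have "\<kappa> \<odot>\<^bsub>V\<^esub> v = \<ominus>\<^bsub>V\<^esub> c \<oplus>\<^bsub>V\<^esub> x" using c v by (simp add: M.r_neg1)
      then have "\<kappa> \<odot>\<^bsub>V\<^esub> v \<in> C <+>\<^bsub>V\<^esub> Q"
        using subspace_neg[OF C(1) c(1)] x(2) by (auto simp: in_set_add)
      then have "\<kappa> = \<zero>\<^bsub>K\<^esub>" using subspace_smult_iff[OF CQ c(2) _ v] nv by auto
      then have "x = c" using c v by simp
      then show ?thesis using C(3) c x by auto
    qed
    then have "?D \<inter> Q = {\<zero>\<^bsub>V\<^esub>}" using subspaceD(2)[OF D] subspaceD(2)[OF Q] by blast
    then have "sdim K V ?D \<le> sdim K V C" using max[of ?D] D CD C(2) by auto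
    moreover have "sdim K V C < sdim K V ?D"
      using sdim_strict_mono[OF C(1) D] CD set_add_upper(1)[OF C(1) Q] nv by auto
    ultimately show False by auto
  qed
  then have "C <+>\<^bsub>V\<^esub> Q = carrier V" using subspaceD(1)[OF subspace_set_add[OF C(1) Q]] by auto
  then show ?thesis using C by blast
qed

text \<open>
  Linear forms with prescribed values and extensions of linear maps are obtained from projections.
\<close>

lemma projection_exists:
  assumes P: "subspace K P V" and Q: "subspace K Q V" and PQ: "P \<inter> Q = {\<zero>\<^bsub>V\<^esub>}"
  obtains \<pi> where "\<pi> \<in> carrier V \<rightarrow> Q"
    "\<And>x y. x\<in>carrier V \<Longrightarrow> y\<in>carrier V \<Longrightarrow> \<pi> (x \<oplus>\<^bsub>V\<^esub> y) = \<pi> x \<oplus>\<^bsub>V\<^esub> \<pi> y"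
    "\<And>c x. c\<in>carrier K \<Longrightarrow> x\<in>carrier V \<Longrightarrow> \<pi> (c \<odot>\<^bsub>V\<^esub> x) = c \<odot>\<^bsub>V\<^esub> \<pi> x"
    "\<And>x. x\<in>P \<Longrightarrow> \<pi> x = \<zero>\<^bsub>V\<^esub>" "\<And>x. x\<in>Q \<Longrightarrow> \<pi> x = x"
proof -
  obtain C where C: "subspace K C V" "P \<subseteq> C" "C \<inter> Q = {\<zero>\<^bsub>V\<^esub>}" "C <+>\<^bsub>V\<^esub> Q = carrier V"
    using complement_exists[OF assms] by auto
  note [simp] = subspace_mem_carrier[OF C(1)] subspace_mem_carrier[OF Q]
  define \<pi> where "\<pi> x = (SOME q. q \<in> Q \<and> (\<exists>c\<in>C. x = c \<oplus>\<^bsub>V\<^esub> q))" for x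
  have uniq: "q = q'" if "q \<in> Q" "q' \<in> Q" "c \<in> C" "c' \<in> C" "c \<oplus>\<^bsub>V\<^esub> q = c' \<oplus>\<^bsub>V\<^esub> q'" for q q' c c'
  proof -
    note [simp] = that(1-4)
    have "c = c \<oplus>\<^bsub>V\<^esub> q \<ominus>\<^bsub>V\<^esub> q" by (simp add: M.a_assoc a_minus_def M.r_neg)
    then have "c = c' \<oplus>\<^bsub>V\<^esub> (q' \<ominus>\<^bsub>V\<^esub> q)" using that(5) by (simp add: M.a_assoc a_minus_def)
    then have "c \<ominus>\<^bsub>V\<^esub> c' = \<ominus>\<^bsub>V\<^esub> c' \<oplus>\<^bsub>V\<^esub> (c' \<oplus>\<^bsub>V\<^esub> (q' \<ominus>\<^bsub>V\<^esub> q))"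
      by (simp add: a_minus_def M.a_comm)
    then have "c \<ominus>\<^bsub>V\<^esub> c' = q' \<ominus>\<^bsub>V\<^esub> q" by (simp add: M.r_neg1 a_minus_def)
    then have "q' \<ominus>\<^bsub>V\<^esub> q \<in> C \<inter> Q" using subspace_minus[OF C(1) that(3,4)] subspace_minus[OF Q that(2,1)] by simp
    then show ?thesis using C(3) that by auto
  qed
  have \<pi>: "\<pi> (c \<oplus>\<^bsub>V\<^esub> q) = q" if "c \<in> C" "q \<in> Q" for c q
    unfolding \<pi>_def using that uniq by (intro some_equality) blast+
  have ex: "\<exists>c\<in>C. \<exists>q\<in>Q. x = c \<oplus>\<^bsub>V\<^esub> q" if "x \<in> carrier V" for x
    using that C(4) by (auto simp: in_set_add)
  have "\<pi> \<in> carrier V \<rightarrow> Q" using ex \<pi> by fastforce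
  moreover have "\<pi> (x \<oplus>\<^bsub>V\<^esub> y) = \<pi> x \<oplus>\<^bsub>V\<^esub> \<pi> y" if xy: "x \<in> carrier V" "y \<in> carrier V" for x y
  proof -
    obtain c q c' q' where e: "c \<in> C" "q \<in> Q" "c' \<in> C" "q' \<in> Q" "x = c \<oplus>\<^bsub>V\<^esub> q" "y = c' \<oplus>\<^bsub>V\<^esub> q'"
      using ex xy by metis
    then have "x \<oplus>\<^bsub>V\<^esub> y = (c \<oplus>\<^bsub>V\<^esub> c') \<oplus>\<^bsub>V\<^esub> (q \<oplus>\<^bsub>V\<^esub> q')" by (simp add: M.a_ac)
    then show ?thesis using \<pi> e subspaceD(3)[OF C(1)] subspaceD(3)[OF Q] by simp
  qed
  moreover have "\<pi> (a \<odot>\<^bsub>V\<^esub> x) = a \<odot>\<^bsub>V\<^esub> \<pi> x" if a: "a \<in> carrier K" "x \<in> carrier V" for a x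
  proof -
    obtain c q where e: "c \<in> C" "q \<in> Q" "x = c \<oplus>\<^bsub>V\<^esub> q" using ex a by metis
    then have "a \<odot>\<^bsub>V\<^esub> x = a \<odot>\<^bsub>V\<^esub> c \<oplus>\<^bsub>V\<^esub> a \<odot>\<^bsub>V\<^esub> q" using a by (simp add: smult_r_distr)
    then show ?thesis using \<pi> e subspaceD(4)[OF C(1)] subspaceD(4)[OF Q] a by simp
  qed
  moreover have "\<pi> x = \<zero>\<^bsub>V\<^esub>" if "x \<in> P" for x
    using \<pi>[of x "\<zero>\<^bsub>V\<^esub>"] that C(2) subspaceD(2)[OF Q] by auto
  moreover have "\<pi> x = x" if "x \<in> Q" for x
    using \<pi>[of "\<zero>\<^bsub>V\<^esub>" x] that subspaceD(2)[OF C(1)] by auto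
  ultimately show ?thesis by (rule that)
qed

definition functional :: "('v \<Rightarrow> 'k) \<Rightarrow> bool" where
  "functional \<mu> \<longleftrightarrow> \<mu> \<in> carrier V \<rightarrow> carrier K \<and>
     (\<forall>x\<in>carrier V. \<forall>y\<in>carrier V. \<mu> (x \<oplus>\<^bsub>V\<^esub> y) = \<mu> x \<oplus>\<^bsub>K\<^esub> \<mu> y) \<and>
     (\<forall>c\<in>carrier K. \<forall>x\<in>carrier V. \<mu> (c \<odot>\<^bsub>V\<^esub> x) = c \<otimes>\<^bsub>K\<^esub> \<mu> x)"

lemma subspace_functional_kernel:
  assumes "functional \<mu>" shows "subspace K {x \<in> carrier V. \<mu> x = \<zero>\<^bsub>K\<^esub>} V"
proof (rule subspaceI)
  have "\<mu> (\<zero>\<^bsub>K\<^esub> \<odot>\<^bsub>V\<^esub> \<zero>\<^bsub>V\<^esub>) = \<zero>\<^bsub>K\<^esub> \<otimes>\<^bsub>K\<^esub> \<mu> \<zero>\<^bsub>V\<^esub>" "\<mu> \<zero>\<^bsub>V\<^esub> \<in> carrier K"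
    using assms unfolding functional_def by blast+
  then show "\<zero>\<^bsub>V\<^esub> \<in> {x \<in> carrier V. \<mu> x = \<zero>\<^bsub>K\<^esub>}" by simp
qed (use assms in \<open>auto simp: functional_def\<close>)

lemma line_coeff_unique:
  assumes "v \<in> carrier V" "v \<noteq> \<zero>\<^bsub>V\<^esub>" "c \<in> carrier K" "d \<in> carrier K" "c \<odot>\<^bsub>V\<^esub> v = d \<odot>\<^bsub>V\<^esub> v"
  shows "c = d"
proof -
  have "(c \<ominus>\<^bsub>K\<^esub> d) \<odot>\<^bsub>V\<^esub> v = \<zero>\<^bsub>V\<^esub>"
    using assms by (simp add: a_minus_def smult_l_distr smult_l_minus M.r_neg)
  then show ?thesis using assms smult_zero_iff[of "c \<ominus>\<^bsub>K\<^esub> d" v] by auto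
qed

lemma functional_exists:
  assumes U: "subspace K U V" and v: "v \<in> carrier V" "v \<notin> U"
  shows "\<exists>\<mu>. functional \<mu> \<and> (\<forall>x\<in>U. \<mu> x = \<zero>\<^bsub>K\<^esub>) \<and> \<mu> v = \<one>\<^bsub>K\<^esub>"
proof -
  have v0: "v \<noteq> \<zero>\<^bsub>V\<^esub>" using v subspaceD(2)[OF U] by auto
  have "x = \<zero>\<^bsub>V\<^esub>" if x: "x \<in> U" "x \<in> line v" for x
  proof -
    obtain c where c: "c \<in> carrier K" "x = c \<odot>\<^bsub>V\<^esub> v" using x by (auto simp: line_def)
    then have "c = \<zero>\<^bsub>K\<^esub>" using subspace_smult_iff[OF U c(1) _ v(1)] x v by auto
    then show ?thesis using c v by simp
  qed
  then have disj: "U \<inter> line v = {\<zero>\<^bsub>V\<^esub>}"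
    using subspaceD(2)[OF U] subspaceD(2)[OF subspace_line[OF v(1)]] by blast
  obtain \<pi> where \<pi>:
    "\<pi> \<in> carrier V \<rightarrow> line v"
    "\<And>x y. x\<in>carrier V \<Longrightarrow> y\<in>carrier V \<Longrightarrow> \<pi> (x \<oplus>\<^bsub>V\<^esub> y) = \<pi> x \<oplus>\<^bsub>V\<^esub> \<pi> y"
    "\<And>c x. c\<in>carrier K \<Longrightarrow> x\<in>carrier V \<Longrightarrow> \<pi> (c \<odot>\<^bsub>V\<^esub> x) = c \<odot>\<^bsub>V\<^esub> \<pi> x"
    "\<And>x. x\<in>U \<Longrightarrow> \<pi> x = \<zero>\<^bsub>V\<^esub>" "\<And>x. x\<in>line v \<Longrightarrow> \<pi> x = x" by (rule projection_exists[OF U subspace_line[OF v(1)] disj]) (rule that)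
  define \<mu> where "\<mu> x = (SOME c. c \<in> carrier K \<and> \<pi> x = c \<odot>\<^bsub>V\<^esub> v)" for x
  have \<mu>I: "\<mu> x = c" if "c \<in> carrier K" "\<pi> x = c \<odot>\<^bsub>V\<^esub> v" for x c
    unfolding \<mu>_def using that line_coeff_unique[OF v(1) v0] by (intro some_equality) auto
  have \<mu>: "\<mu> x \<in> carrier K" "\<pi> x = \<mu> x \<odot>\<^bsub>V\<^esub> v" if "x \<in> carrier V" for x
  proof -
    have "\<pi> x \<in> line v" using \<pi>(1) that by (rule funcset_mem)
    then obtain c where c: "c \<in> carrier K" "\<pi> x = c \<odot>\<^bsub>V\<^esub> v" unfolding line_def by blast
    then show "\<mu> x \<in> carrier K" "\<pi> x = \<mu> x \<odot>\<^bsub>V\<^esub> v" using \<mu>I[OF c] by auto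
  qed
  have "functional \<mu>"
    unfolding functional_def
  proof (intro conjI ballI)
    show "\<mu> \<in> carrier V \<rightarrow> carrier K" using \<mu>(1) by auto
    show "\<mu> (x \<oplus>\<^bsub>V\<^esub> y) = \<mu> x \<oplus>\<^bsub>K\<^esub> \<mu> y" if "x \<in> carrier V" "y \<in> carrier V" for x y
      using that \<pi>(2)[OF that] \<mu>(1)[of x] \<mu>(1)[of y] \<mu>(2)[of x] \<mu>(2)[of y] v(1)
      by (intro \<mu>I) (simp_all add: smult_l_distr)
    show "\<mu> (c \<odot>\<^bsub>V\<^esub> x) = c \<otimes>\<^bsub>K\<^esub> \<mu> x" if "c \<in> carrier K" "x \<in> carrier V" for c x
      using that \<pi>(3)[OF that] \<mu>(1)[of x] \<mu>(2)[of x] v(1)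
      by (intro \<mu>I) (simp_all add: smult_assoc1)
  qed
  moreover have "\<forall>x\<in>U. \<mu> x = \<zero>\<^bsub>K\<^esub>" using \<pi>(4) v by (auto intro!: \<mu>I)
  moreover have "\<mu> v = \<one>\<^bsub>K\<^esub>" using \<pi>(5)[OF mem_line[OF v(1)]] v by (auto intro!: \<mu>I)
  ultimately show ?thesis by blast
qed

text \<open>
  Let \<open>Q = R \<oplus> (P \<inter> Q)\<close>. A projection onto \<open>R\<close> that kills \<open>P\<close> has kernel \<open>P\<close> on \<open>P + Q\<close> and kernel
  \<open>P \<inter> Q\<close> on \<open>Q\<close>; the formula is rank and nullity for these two restrictions.
\<close>

lemma sdim_set_add:
  assumes P: "subspace K P V" and Q: "subspace K Q V"
  shows "sdim K V (P <+>\<^bsub>V\<^esub> Q) + sdim K V (P \<inter> Q) = sdim K V P + sdim K V Q"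
proof -
  interpret Q: fd_space K "V\<lparr>carrier := Q\<rparr>" by (rule fd_space_subspace[OF Q])
  have PQ: "subspace K (P \<inter> Q) V" by (rule subspace_Int[OF P Q])
  have sQ: "subspace K R (V\<lparr>carrier := Q\<rparr>) \<longleftrightarrow> subspace K R V \<and> R \<subseteq> Q" for R
  proof
    assume "subspace K R (V\<lparr>carrier := Q\<rparr>)"
    note d = Q.subspaceD[OF this, simplified]
    then show "subspace K R V \<and> R \<subseteq> Q"
      using subspaceD(1)[OF Q] by (intro conjI subspaceI) auto
  next
    assume "subspace K R V \<and> R \<subseteq> Q"
    then show "subspace K R (V\<lparr>carrier := Q\<rparr>)"
      by (intro Q.subspaceI) (auto dest: subspaceD)
  qed
  obtain R where R0: "subspace K R (V\<lparr>carrier := Q\<rparr>)" "R \<inter> (P \<inter> Q) = {\<zero>\<^bsub>V\<^esub>}" 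
      "R <+>\<^bsub>V\<lparr>carrier := Q\<rparr>\<^esub> (P \<inter> Q) = Q"
  proof -
    have "subspace K (P \<inter> Q) (V\<lparr>carrier := Q\<rparr>)" using PQ sQ by blast
    moreover have "{\<zero>\<^bsub>V\<^esub>} \<inter> (P \<inter> Q) = {\<zero>\<^bsub>V\<^esub>}" using subspaceD(2)[OF PQ] by auto
    ultimately show ?thesis
      using Q.complement_exists[OF Q.subspace_zero, of "P \<inter> Q"] that by auto
  qed
  have R: "subspace K R V" "R \<subseteq> Q" "R \<inter> (P \<inter> Q) = {\<zero>\<^bsub>V\<^esub>}" using R0 sQ by auto
  have Q_dec: "\<exists>r\<in>R. \<exists>x\<in>P \<inter> Q. q = r \<oplus>\<^bsub>V\<^esub> x" if "q \<in> Q" for q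
    using R0(3) that Q.in_set_add[of q R "P \<inter> Q"] by auto
  note [simp] = subspace_mem_carrier[OF P] subspace_mem_carrier[OF Q] subspace_mem_carrier[OF R(1)]
  have disj: "P \<inter> R = {\<zero>\<^bsub>V\<^esub>}" using R by auto
  obtain \<pi> where \<pi>:
    "\<pi> \<in> carrier V \<rightarrow> R"
    "\<And>x y. x\<in>carrier V \<Longrightarrow> y\<in>carrier V \<Longrightarrow> \<pi> (x \<oplus>\<^bsub>V\<^esub> y) = \<pi> x \<oplus>\<^bsub>V\<^esub> \<pi> y"
    "\<And>c x. c\<in>carrier K \<Longrightarrow> x\<in>carrier V \<Longrightarrow> \<pi> (c \<odot>\<^bsub>V\<^esub> x) = c \<odot>\<^bsub>V\<^esub> \<pi> x"
    "\<And>x. x\<in>P \<Longrightarrow> \<pi> x = \<zero>\<^bsub>V\<^esub>" "\<And>x. x\<in>R \<Longrightarrow> \<pi> x = x" by (rule projection_exists[OF P R(1) disj]) (rule that)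
  have rn: "sdim K V U = sdim K V {x \<in> U. \<pi> x = \<zero>\<^bsub>V\<^esub>} + sdim K V R"
    if U: "subspace K U V" "R \<subseteq> U" for U
  proof -
    have "\<pi> ` U = R" using \<pi>(1,5) subspaceD(1)[OF U(1)] U(2) by (force simp: image_iff)
    then show ?thesis using rank_nullity_subspace(3)[OF U(1) vectorspace_axioms, of \<pi>] \<pi>
        subspaceD(1)[OF U(1)] subspaceD(1)[OF R(1)] by (simp add: Pi_iff subset_iff)
  qed
  have "{x \<in> P <+>\<^bsub>V\<^esub> Q. \<pi> x = \<zero>\<^bsub>V\<^esub>} = P"
  proof
    show "P \<subseteq> {x \<in> P <+>\<^bsub>V\<^esub> Q. \<pi> x = \<zero>\<^bsub>V\<^esub>}" using \<pi>(4) set_add_upper(1)[OF P Q] by auto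
    show "{x \<in> P <+>\<^bsub>V\<^esub> Q. \<pi> x = \<zero>\<^bsub>V\<^esub>} \<subseteq> P"
    proof clarify
      fix x assume "x \<in> P <+>\<^bsub>V\<^esub> Q" and 0: "\<pi> x = \<zero>\<^bsub>V\<^esub>"
      then obtain p q where pq: "p \<in> P" "q \<in> Q" "x = p \<oplus>\<^bsub>V\<^esub> q" by (auto simp: in_set_add)
      obtain r y where r: "r \<in> R" "y \<in> P" "y \<in> Q" "q = r \<oplus>\<^bsub>V\<^esub> y" using Q_dec[OF pq(2)] by auto
      have "\<pi> x = r" unfolding pq r using pq(1) r(1-3) by (simp add: \<pi>(2,4,5))
      then show "x \<in> P" using 0 pq r subspaceD(3)[OF P] by auto
    qed
  qed
  moreover have "{x \<in> Q. \<pi> x = \<zero>\<^bsub>V\<^esub>} = P \<inter> Q"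
  proof
    show "P \<inter> Q \<subseteq> {x \<in> Q. \<pi> x = \<zero>\<^bsub>V\<^esub>}" using \<pi>(4) by auto
    show "{x \<in> Q. \<pi> x = \<zero>\<^bsub>V\<^esub>} \<subseteq> P \<inter> Q"
    proof
      fix q assume "q \<in> {x \<in> Q. \<pi> x = \<zero>\<^bsub>V\<^esub>}"
      then have q: "q \<in> Q" and 0: "\<pi> q = \<zero>\<^bsub>V\<^esub>" by auto
      obtain r y where r: "r \<in> R" "y \<in> P" "y \<in> Q" "q = r \<oplus>\<^bsub>V\<^esub> y" using Q_dec[OF q(1)] by auto
      have "\<pi> q = r" unfolding r using r(1-3) by (simp add: \<pi>(2,4,5))
      then show "q \<in> P \<inter> Q" using 0 q r by auto
    qed
  qed
  ultimately show ?thesis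
    using rn[OF subspace_set_add[OF P Q]] rn[OF Q R(2)] set_add_upper(2)[OF P Q] R(2) by auto
qed

lemma sdim_line: assumes "v \<in> carrier V" "v \<noteq> \<zero>\<^bsub>V\<^esub>" shows "sdim K V (line v) = 1"
proof -
  have "lin_indpt {v}" using lin_dep_iff_in_span[of "{}" v] assms
    by (auto simp: lin_dep_def span_def lincomb_def)
  moreover have "span {v} = line v"
  proof -
    have "v \<in> line v" using mem_line assms by auto
    then have "span {v} \<subseteq> line v"
      using span_is_subset[of "{v}" "line v"] subspace_line[OF assms(1)] by (auto simp: subspace_def)
    moreover have "line v \<subseteq> span {v}"
      using subspaceD(4)[OF span_is_subspace[of "{v}"]] in_own_span[of "{v}"] assms
      by (auto simp: line_def)
    ultimately show ?thesis by auto
  qed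
  ultimately show ?thesis using sdim_basis[OF subspace_line[OF assms(1)], of "{v}"] assms mem_line by auto
qed

lemma sdim_add_line:
  assumes U: "subspace K U V" and v: "v \<in> carrier V" "v \<notin> U"
  shows "subspace K (U <+>\<^bsub>V\<^esub> line v) V" "sdim K V (U <+>\<^bsub>V\<^esub> line v) = Suc (sdim K V U)"
    "U \<subseteq> U <+>\<^bsub>V\<^esub> line v" "v \<in> U <+>\<^bsub>V\<^esub> line v"
proof -
  note L = subspace_line[OF v(1)]
  show "subspace K (U <+>\<^bsub>V\<^esub> line v) V" by (rule subspace_set_add[OF U L])
  show "U \<subseteq> U <+>\<^bsub>V\<^esub> line v" "v \<in> U <+>\<^bsub>V\<^esub> line v"
    using set_add_upper[OF U L] mem_line[OF v(1)] by auto
  have "c \<odot>\<^bsub>V\<^esub> v = \<zero>\<^bsub>V\<^esub>" if "c \<in> carrier K" "c \<odot>\<^bsub>V\<^esub> v \<in> U" for c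
    using subspace_smult_iff[OF U that(1) _ v(1)] that v by (cases "c = \<zero>\<^bsub>K\<^esub>") auto
  then have "U \<inter> line v = {\<zero>\<^bsub>V\<^esub>}"
    using subspaceD(2)[OF U] subspaceD(2)[OF L] unfolding line_def by blast
  moreover have "v \<noteq> \<zero>\<^bsub>V\<^esub>" using v subspaceD(2)[OF U] by auto
  ultimately show "sdim K V (U <+>\<^bsub>V\<^esub> line v) = Suc (sdim K V U)"
    using sdim_set_add[OF U L] sdim_line[OF v(1)] sdim_zero by auto
qed

text \<open>
  Induction along a flag from \<open>U0\<close> to \<open>U1\<close>. All dimension counts below are done one vector at a time
  with it, which avoids quotient spaces and spaces of linear maps.
\<close>

lemma subspace_interval_induct:
  assumes U0: "subspace K U0 V" and U1: "subspace K U1 V" and "U0 \<subseteq> U1" and "P U0"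
    and step: "\<And>U v. \<lbrakk>subspace K U V; U0 \<subseteq> U; U \<subseteq> U1; v \<in> U1; v \<notin> U; P U\<rbrakk> \<Longrightarrow> P (U <+>\<^bsub>V\<^esub> line v)"
  shows "P U1"
proof -
  let ?P = "\<lambda>U. subspace K U V \<and> U0 \<subseteq> U \<and> U \<subseteq> U1 \<and> P U"
  have "\<exists>C. ?P C \<and> (\<forall>D. ?P D \<longrightarrow> sdim K V D \<le> sdim K V C)"
    by (rule ex_has_greatest_nat[of ?P U0 _ "Suc (sdim K V (carrier V))"])
      (use assms sdim_mono(1)[OF _ subspace_carrier] subspaceD(1) in \<open>auto simp: less_Suc_eq_le\<close>)
  then obtain C where C: "?P C" and max: "\<And>D. ?P D \<Longrightarrow> sdim K V D \<le> sdim K V C" by blast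
  have "C = U1"
  proof (rule ccontr)
    assume "C \<noteq> U1"
    then obtain v where v: "v \<in> U1" "v \<notin> C" "v \<in> carrier V" using C subspaceD(1)[OF U1] by blast
    have C': "subspace K C V" "U0 \<subseteq> C" "C \<subseteq> U1" "P C" using C by auto
    note D = sdim_add_line[OF C'(1) v(3,2)]
    have "C <+>\<^bsub>V\<^esub> line v \<subseteq> U1"
    proof
      fix x assume "x \<in> C <+>\<^bsub>V\<^esub> line v"
      then obtain c d where "c \<in> C" "d \<in> carrier K" "x = c \<oplus>\<^bsub>V\<^esub> d \<odot>\<^bsub>V\<^esub> v"
        by (auto simp: in_set_add line_def)
      then show "x \<in> U1" using C'(3) v(1) by (auto intro!: subspaceD(3,4)[OF U1])
    qed
    then have "?P (C <+>\<^bsub>V\<^esub> line v)" using step[OF C'(1-3) v(1,2) C'(4)] D(1,3) C'(2) by blast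
    then show False using max D(2) by fastforce
  qed
  then show ?thesis using C by auto
qed

end

lemma (in vectorspace) fin_dimI_bounded:
  assumes "\<And>S. finite S \<Longrightarrow> S \<subseteq> carrier V \<Longrightarrow> lin_indpt S \<Longrightarrow> card S \<le> n"
  shows fin_dim
proof -
  let ?P = "\<lambda>S. S \<subseteq> carrier V \<and> lin_indpt S"
  have "finite S \<and> card S \<le> n" if S: "?P S" for S
  proof (cases "finite S")
    case False
    then obtain B where B: "B \<subseteq> S" "finite B" "card B = Suc n"
      by (metis infinite_arbitrarily_large)
    then have "lin_indpt B" using S subset_li_is_li by blast
    then show ?thesis using assms[of B] B S by auto
  qed (use assms S in auto)
  moreover have "?P {}" by (auto simp: lin_dep_def)
  ultimately obtain S where "finite S" "maximal S ?P"
    using maximal_exists[of ?P n "{}"] by blast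
  then show ?thesis using max_li_is_gen unfolding fin_dim_def maximal_def by blast
qed

section \<open>Bilinear pairings\<close>

locale bilinear_pairing = V: fd_space K V + W: vectorspace K W + Z: fd_space K Z
  for K :: "'k ring" and V :: "('k, 'v) module" and W :: "('k, 'w) module" and Z :: "('k, 'z) module" +
  fixes \<beta> :: "'v \<Rightarrow> 'w \<Rightarrow> 'z"
  assumes closed: "\<lbrakk>v \<in> carrier V; w \<in> carrier W\<rbrakk> \<Longrightarrow> \<beta> v w \<in> carrier Z"
    and add_left: "\<lbrakk>v \<in> carrier V; v' \<in> carrier V; w \<in> carrier W\<rbrakk> \<Longrightarrow> \<beta> (v \<oplus>\<^bsub>V\<^esub> v') w = \<beta> v w \<oplus>\<^bsub>Z\<^esub> \<beta> v' w"
    and add_right: "\<lbrakk>v \<in> carrier V; w \<in> carrier W; w' \<in> carrier W\<rbrakk> \<Longrightarrow> \<beta> v (w \<oplus>\<^bsub>W\<^esub> w') = \<beta> v w \<oplus>\<^bsub>Z\<^esub> \<beta> v w'"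
    and smult_left: "\<lbrakk>c \<in> carrier K; v \<in> carrier V; w \<in> carrier W\<rbrakk> \<Longrightarrow> \<beta> (c \<odot>\<^bsub>V\<^esub> v) w = c \<odot>\<^bsub>Z\<^esub> \<beta> v w"
    and smult_right: "\<lbrakk>c \<in> carrier K; v \<in> carrier V; w \<in> carrier W\<rbrakk> \<Longrightarrow> \<beta> v (c \<odot>\<^bsub>W\<^esub> w) = c \<odot>\<^bsub>Z\<^esub> \<beta> v w"
begin

definition annihilator :: "'v set \<Rightarrow> 'w set" where
  "annihilator U = {w \<in> carrier W. \<forall>v\<in>U. \<beta> v w = \<zero>\<^bsub>Z\<^esub>}"

lemma zero_left [simp]: "w \<in> carrier W \<Longrightarrow> \<beta> \<zero>\<^bsub>V\<^esub> w = \<zero>\<^bsub>Z\<^esub>"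
  using smult_left[of "\<zero>\<^bsub>K\<^esub>" "\<zero>\<^bsub>V\<^esub>" w] closed by simp

lemma zero_right [simp]: "v \<in> carrier V \<Longrightarrow> \<beta> v \<zero>\<^bsub>W\<^esub> = \<zero>\<^bsub>Z\<^esub>"
  using smult_right[of "\<zero>\<^bsub>K\<^esub>" v "\<zero>\<^bsub>W\<^esub>"] closed by simp

lemma subspace_annihilator:
  "U \<subseteq> carrier V \<Longrightarrow> subspace K (annihilator U) W"
  by (rule W.subspaceI) (auto simp: annihilator_def add_right smult_right subset_iff)

lemma annihilator_add_line:
  assumes U: "subspace K U V" and v: "v \<in> carrier V"
  shows "annihilator (U <+>\<^bsub>V\<^esub> V.line v) = {w \<in> annihilator U. \<beta> v w = \<zero>\<^bsub>Z\<^esub>}"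
proof
  show "annihilator (U <+>\<^bsub>V\<^esub> V.line v) \<subseteq> {w \<in> annihilator U. \<beta> v w = \<zero>\<^bsub>Z\<^esub>}"
    using V.set_add_upper[OF U V.subspace_line[OF v]] V.mem_line[OF v]
    by (auto simp: annihilator_def)
  show "{w \<in> annihilator U. \<beta> v w = \<zero>\<^bsub>Z\<^esub>} \<subseteq> annihilator (U <+>\<^bsub>V\<^esub> V.line v)"
    using V.subspaceD(1)[OF U] v
    by (auto simp: annihilator_def V.in_set_add V.line_def add_left smult_left subset_iff)
qed

text \<open>
  Each further vector imposes at most \<open>dim Z\<close> linear conditions.
\<close>

lemma sdim_annihilator_mono:
  assumes "W.fin_dim" and U0: "subspace K U0 V" and U1: "subspace K U1 V" and "U0 \<subseteq> U1"
  shows "sdim K W (annihilator U0) + sdim K V U0 * sdim K Z (carrier Z)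
    \<le> sdim K W (annihilator U1) + sdim K V U1 * sdim K Z (carrier Z)"
proof -
  interpret W: fd_space K W by unfold_locales fact
  show ?thesis
  proof (rule V.subspace_interval_induct[OF U0 U1 \<open>U0 \<subseteq> U1\<close> order_refl])
    fix S v assume S: "subspace K S V" "S \<subseteq> U1" and v: "v \<in> U1" "v \<notin> S"
      and IH: "sdim K W (annihilator U0) + sdim K V U0 * sdim K Z (carrier Z)
        \<le> sdim K W (annihilator S) + sdim K V S * sdim K Z (carrier Z)"
    have vc: "v \<in> carrier V" using v V.subspaceD(1)[OF U1] by auto
    have "sdim K W (annihilator S) = sdim K W {w \<in> annihilator S. \<beta> v w = \<zero>\<^bsub>Z\<^esub>} + sdim K Z (\<beta> v ` annihilator S)"
      and "subspace K (\<beta> v ` annihilator S) Z"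
      using W.rank_nullity_subspace[OF subspace_annihilator[OF V.subspaceD(1)[OF S(1)]] Z.vectorspace_axioms, of "\<beta> v"]
        vc by (auto simp: annihilator_def closed add_right smult_right)
    then have "sdim K W (annihilator S) \<le> sdim K W (annihilator (S <+>\<^bsub>V\<^esub> V.line v)) + sdim K Z (carrier Z)"
      using Z.sdim_mono(1)[OF _ Z.subspace_carrier] Z.subspaceD(1)
      by (auto simp: annihilator_add_line[OF S(1) vc])
    then show "sdim K W (annihilator U0) + sdim K V U0 * sdim K Z (carrier Z)
        \<le> sdim K W (annihilator (S <+>\<^bsub>V\<^esub> V.line v)) + sdim K V (S <+>\<^bsub>V\<^esub> V.line v) * sdim K Z (carrier Z)"
      using IH V.sdim_add_line(2)[OF S(1) vc v(2)] by simp
  qed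
qed

text \<open>
  The annihilator bound limits the size of linearly independent sets in \<open>W\<close>. It is used to see that the
  dual of a module is finite-dimensional.
\<close>

lemma fin_dim_right:
  assumes nd: "annihilator (carrier V) \<subseteq> {\<zero>\<^bsub>W\<^esub>}"
  shows "W.fin_dim"
proof (rule W.fin_dimI_bounded)
  fix S assume S: "finite S" "S \<subseteq> carrier W" "W.lin_indpt S"
  let ?U = "W\<lparr>carrier := W.span S\<rparr>"
  note sub = W.span_is_subspace[OF S(2)]
  note SU = W.in_own_span[OF S(2)]
  interpret U: vectorspace K ?U by (rule W.subspace_is_vs[OF sub])
  have b: "U.basis S" using S SU W.span_vs[OF sub, of S] by (auto simp: U.basis_def)
  then have fd: "U.fin_dim" using S(1) by (auto simp: U.fin_dim_def U.basis_def)
  interpret UB: bilinear_pairing K V ?U Z \<beta>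
    using W.subspaceD(1)[OF sub]
    by unfold_locales (auto simp: closed add_left add_right smult_left smult_right subset_iff)
  have "UB.annihilator (carrier V) = {\<zero>\<^bsub>W\<^esub>}"
    using nd W.subspaceD[OF sub] by (auto simp: UB.annihilator_def annihilator_def)
  moreover have UB0: "UB.annihilator {\<zero>\<^bsub>V\<^esub>} = carrier ?U" by (auto simp: UB.annihilator_def)
  moreover interpret U: fd_space K ?U by unfold_locales fact
  have "sdim K ?U {\<zero>\<^bsub>W\<^esub>} = 0" using U.sdim_zero by simp
  moreover have "sdim K ?U (carrier ?U) = card S" using U.dim_basis[OF S(1) b] by (simp add: sdim_def)
  ultimately show "card S \<le> sdim K V (carrier V) * sdim K Z (carrier Z)"
    using UB.sdim_annihilator_mono[OF fd V.subspace_zero V.subspace_carrier]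
      V.subspaceD(2)[OF V.subspace_carrier] V.sdim_zero UB0 by simp
qed

end

section \<open>Short local algebras\<close>

lemma opposite_simps [simp]:
  "carrier (opposite R) = carrier R" "\<zero>\<^bsub>opposite R\<^esub> = \<zero>\<^bsub>R\<^esub>" "\<one>\<^bsub>opposite R\<^esub> = \<one>\<^bsub>R\<^esub>"
  "add (opposite R) = add R" "x \<otimes>\<^bsub>opposite R\<^esub> y = y \<otimes>\<^bsub>R\<^esub> x"
  by (simp_all add: opposite_def)

lemma smult_opposite [simp]: "smult (opposite (A :: ('k, 'a) module)) = smult A"
  by (simp add: opposite_def)

lemma opposite_opposite [simp]: "opposite (opposite A) = (A :: ('k, 'a) module)"
  by (simp add: opposite_def)

lemma left_regular_simps [simp]:
  "carrier (left_regular R) = carrier R" "\<zero>\<^bsub>left_regular R\<^esub> = \<zero>\<^bsub>R\<^esub>"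
  "add (left_regular R) = add R" "smult (left_regular R) = mult R"
  by (simp_all add: left_regular_def)

lemma submodule_iff:
  assumes "left_module R M"
  shows "Module.submodule N R M \<longleftrightarrow> N \<subseteq> carrier M \<and> \<zero>\<^bsub>M\<^esub> \<in> N \<and>
    (\<forall>x\<in>N. \<forall>y\<in>N. x \<oplus>\<^bsub>M\<^esub> y \<in> N) \<and> (\<forall>r\<in>carrier R. \<forall>x\<in>N. r \<odot>\<^bsub>M\<^esub> x \<in> N)"
proof -
  interpret left_module R M by fact
  have neg: "\<ominus>\<^bsub>M\<^esub> x = (\<ominus>\<^bsub>R\<^esub> \<one>\<^bsub>R\<^esub>) \<odot>\<^bsub>M\<^esub> x" if x: "x \<in> carrier M" for x
  proof -
    have 0: "\<zero>\<^bsub>R\<^esub> \<odot>\<^bsub>M\<^esub> x = \<zero>\<^bsub>M\<^esub>"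
      using smult_l_distr[of "\<zero>\<^bsub>R\<^esub>" "\<zero>\<^bsub>R\<^esub>" x] x smult_closed[of "\<zero>\<^bsub>R\<^esub>" x] by simp
    have "(\<ominus>\<^bsub>R\<^esub> \<one>\<^bsub>R\<^esub>) \<odot>\<^bsub>M\<^esub> x \<oplus>\<^bsub>M\<^esub> x = \<zero>\<^bsub>M\<^esub>"
      using smult_l_distr[of "\<ominus>\<^bsub>R\<^esub> \<one>\<^bsub>R\<^esub>" "\<one>\<^bsub>R\<^esub>" x] x 0 by (simp add: smult_one R.l_neg)
    then show ?thesis using x smult_closed[of "\<ominus>\<^bsub>R\<^esub> \<one>\<^bsub>R\<^esub>" x] M.minus_equality by auto
  qed
  show ?thesis (is "_ \<longleftrightarrow> ?r")
  proof
    assume N: "Module.submodule N R M"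
    interpret N: Module.submodule N R M by fact
    show ?r using N.subset N.m_closed N.one_closed N.smult_closed by auto
  next
    assume r: ?r
    then have "subgroup N (add_monoid M)"
      using neg M.a_group by (intro group.subgroupI) (auto simp: a_inv_def[symmetric] subset_iff)
    then show "Module.submodule N R M" using r
      by (simp add: Module.submodule_def Module.submodule_axioms_def)
  qed
qed

lemma (in ring) left_module_left_regular: "left_module R (left_regular R)"
proof -
  have "abelian_group (left_regular R)"
    by (rule abelian_groupI) (auto simp: a_ac intro: l_neg exI[of _ "\<ominus> _"] bexI[of _ "\<ominus> _"])
  then show ?thesis
    by (simp add: left_module_def left_module_axioms_def ring_axioms l_distr r_distr m_assoc)
qed

text \<open>
  The algebras of the theorem, described by \<open>A = k 1 \<oplus> J\<close> for a two-sided ideal \<open>J\<close> with \<open>J\<^sup>3 = 0\<close>.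
  This description is visibly symmetric, whereas the radical is defined by left ideals.
\<close>

locale short_local_algebra = fd_algebra k A
  for k :: "'k ring" and A :: "('k, 'a) module" and J :: "'a set" +
  assumes J_subset: "J \<subseteq> carrier A"
    and J_zero: "\<zero>\<^bsub>A\<^esub> \<in> J"
    and J_add: "\<lbrakk>x \<in> J; y \<in> J\<rbrakk> \<Longrightarrow> x \<oplus>\<^bsub>A\<^esub> y \<in> J"
    and J_left: "\<lbrakk>r \<in> carrier A; x \<in> J\<rbrakk> \<Longrightarrow> r \<otimes>\<^bsub>A\<^esub> x \<in> J"
    and J_right: "\<lbrakk>r \<in> carrier A; x \<in> J\<rbrakk> \<Longrightarrow> x \<otimes>\<^bsub>A\<^esub> r \<in> J"
    and one_notin_J: "\<one>\<^bsub>A\<^esub> \<notin> J"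
    and scalar_plus_J: "r \<in> carrier A \<Longrightarrow> \<exists>c\<in>carrier k. \<exists>x\<in>J. r = c \<odot>\<^bsub>A\<^esub> \<one>\<^bsub>A\<^esub> \<oplus>\<^bsub>A\<^esub> x"
    and J_cubed: "\<lbrakk>x \<in> J; y \<in> J; z \<in> J\<rbrakk> \<Longrightarrow> x \<otimes>\<^bsub>A\<^esub> y \<otimes>\<^bsub>A\<^esub> z = \<zero>\<^bsub>A\<^esub>"
begin

lemma J_carrier [simp, intro]: "x \<in> J \<Longrightarrow> x \<in> carrier A"
  using J_subset by auto

abbreviation sc :: "'k \<Rightarrow> 'a" where "sc c \<equiv> c \<odot>\<^bsub>A\<^esub> \<one>\<^bsub>A\<^esub>"

lemma sc_closed [simp, intro]: "c \<in> carrier k \<Longrightarrow> sc c \<in> carrier A"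
  by simp

lemma sc_mult:
  assumes "c \<in> carrier k" "x \<in> carrier A"
  shows "sc c \<otimes>\<^bsub>A\<^esub> x = c \<odot>\<^bsub>A\<^esub> x" "x \<otimes>\<^bsub>A\<^esub> sc c = c \<odot>\<^bsub>A\<^esub> x"
  using assms smult_mult_left[of c "\<one>\<^bsub>A\<^esub>" x] smult_mult_right[of c x "\<one>\<^bsub>A\<^esub>"] by simp_all

lemma sc_hom:
  assumes "c \<in> carrier k" "d \<in> carrier k"
  shows "sc (c \<oplus>\<^bsub>k\<^esub> d) = sc c \<oplus>\<^bsub>A\<^esub> sc d" "sc (c \<otimes>\<^bsub>k\<^esub> d) = sc c \<otimes>\<^bsub>A\<^esub> sc d"
    "sc \<one>\<^bsub>k\<^esub> = \<one>\<^bsub>A\<^esub>"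
  using assms by (simp_all add: smult_l_distr smult_assoc1 sc_mult(1))

lemma J_smult: "c \<in> carrier k \<Longrightarrow> x \<in> J \<Longrightarrow> c \<odot>\<^bsub>A\<^esub> x \<in> J"
  using J_left[of "sc c" x] sc_mult(1)[of c x] by simp

lemma J_neg: "x \<in> J \<Longrightarrow> \<ominus>\<^bsub>A\<^esub> x \<in> J"
  using J_left[of "\<ominus>\<^bsub>A\<^esub> \<one>\<^bsub>A\<^esub>" x] A.l_minus[of "\<one>\<^bsub>A\<^esub>" x] by simp

sublocale A: fd_space k A
  by unfold_locales (rule finite_dimensional)

lemma subspace_J: "subspace k J A"
  by (rule subspaceI) (auto intro: J_zero J_add J_smult)

text \<open>
  Up to a nonzero scalar the element is \<open>1 - y\<close> with \<open>y \<in> J\<close>, and the geometric series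
  \<open>1 + y + y\<^sup>2\<close> is its inverse because \<open>y\<^sup>3 = 0\<close>.
\<close>

lemma inverse_outside_J:
  assumes r: "r \<in> carrier A" "r \<notin> J"
  shows "\<exists>s\<in>carrier A. s \<otimes>\<^bsub>A\<^esub> r = \<one>\<^bsub>A\<^esub> \<and> r \<otimes>\<^bsub>A\<^esub> s = \<one>\<^bsub>A\<^esub>"
proof -
  obtain c x where c: "c \<in> carrier k" "x \<in> J" "r = sc c \<oplus>\<^bsub>A\<^esub> x" using scalar_plus_J[OF r(1)] by blast
  have c0: "c \<noteq> \<zero>\<^bsub>k\<^esub>" using c r(2) by auto
  define d where "d = inv\<^bsub>k\<^esub> c"
  define y where "y = \<ominus>\<^bsub>A\<^esub> (d \<odot>\<^bsub>A\<^esub> x)"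
  have d: "d \<in> carrier k" unfolding d_def using smult_cancel(1)[OF c(1) c0, of "\<one>\<^bsub>A\<^esub>"] by simp
  have y: "y \<in> J" unfolding y_def by (intro J_neg J_smult d c)
  have dr: "d \<odot>\<^bsub>A\<^esub> r = \<one>\<^bsub>A\<^esub> \<ominus>\<^bsub>A\<^esub> y"
    unfolding c(3) y_def using c d smult_cancel(2)[OF c(1) c0, of "\<one>\<^bsub>A\<^esub>"]
    by (simp add: smult_r_distr d_def M.minus_eq)
  have cy: "y \<in> carrier A" using y by auto
  have cancel: "y \<oplus>\<^bsub>A\<^esub> (\<one>\<^bsub>A\<^esub> \<oplus>\<^bsub>A\<^esub> (y \<otimes>\<^bsub>A\<^esub> y \<oplus>\<^bsub>A\<^esub> \<ominus>\<^bsub>A\<^esub> (y \<oplus>\<^bsub>A\<^esub> y \<otimes>\<^bsub>A\<^esub> y))) = \<one>\<^bsub>A\<^esub>"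
  proof -
    have "y \<oplus>\<^bsub>A\<^esub> (\<one>\<^bsub>A\<^esub> \<oplus>\<^bsub>A\<^esub> (y \<otimes>\<^bsub>A\<^esub> y \<oplus>\<^bsub>A\<^esub> \<ominus>\<^bsub>A\<^esub> (y \<oplus>\<^bsub>A\<^esub> y \<otimes>\<^bsub>A\<^esub> y)))
        = \<one>\<^bsub>A\<^esub> \<oplus>\<^bsub>A\<^esub> ((y \<oplus>\<^bsub>A\<^esub> y \<otimes>\<^bsub>A\<^esub> y) \<oplus>\<^bsub>A\<^esub> \<ominus>\<^bsub>A\<^esub> (y \<oplus>\<^bsub>A\<^esub> y \<otimes>\<^bsub>A\<^esub> y))"
      using cy by (simp add: M.a_ac)
    then show ?thesis using cy by (simp only: M.r_neg A.m_closed M.a_closed M.r_zero A.one_closed)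
  qed
  define s where "s = d \<odot>\<^bsub>A\<^esub> (\<one>\<^bsub>A\<^esub> \<oplus>\<^bsub>A\<^esub> y \<oplus>\<^bsub>A\<^esub> y \<otimes>\<^bsub>A\<^esub> y)"
  have yyy: "y \<otimes>\<^bsub>A\<^esub> (y \<otimes>\<^bsub>A\<^esub> y) = \<zero>\<^bsub>A\<^esub>" using J_cubed[OF y y y] y by (simp add: A.m_assoc)
  have cs: "y \<in> carrier A" using y by auto
  have s: "s \<in> carrier A" using d cs by (simp add: s_def)
  have "s \<otimes>\<^bsub>A\<^esub> r = (\<one>\<^bsub>A\<^esub> \<oplus>\<^bsub>A\<^esub> y \<oplus>\<^bsub>A\<^esub> y \<otimes>\<^bsub>A\<^esub> y) \<otimes>\<^bsub>A\<^esub> (d \<odot>\<^bsub>A\<^esub> r)"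
    unfolding s_def using d r(1) cs by (simp add: smult_mult_left smult_mult_right)
  also have "\<dots> = \<one>\<^bsub>A\<^esub>"
    unfolding dr using cs yyy
    by (simp add: M.minus_eq A.l_distr A.r_distr A.r_minus A.m_assoc M.a_ac M.r_neg M.r_neg1 M.r_neg2 cancel)
  finally have 1: "s \<otimes>\<^bsub>A\<^esub> r = \<one>\<^bsub>A\<^esub>" .
  have "r \<otimes>\<^bsub>A\<^esub> s = (d \<odot>\<^bsub>A\<^esub> r) \<otimes>\<^bsub>A\<^esub> (\<one>\<^bsub>A\<^esub> \<oplus>\<^bsub>A\<^esub> y \<oplus>\<^bsub>A\<^esub> y \<otimes>\<^bsub>A\<^esub> y)"
    unfolding s_def using d r(1) cs by (simp add: smult_mult_left smult_mult_right)
  also have "\<dots> = \<one>\<^bsub>A\<^esub>"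
    unfolding dr using cs yyy
    by (simp add: M.minus_eq A.l_distr A.r_distr A.l_minus A.m_assoc M.a_ac M.r_neg M.r_neg1 M.r_neg2 cancel)
  finally show ?thesis using 1 s by auto
qed

text \<open>
  A proper left ideal contains no unit, hence it is contained in \<open>J\<close>.
\<close>

lemma maximal_left_ideal_iff: "maximal_left_ideal A I \<longleftrightarrow> I = J"
proof -
  note sm = submodule_iff[OF A.left_module_left_regular]
  have proper: "N \<subseteq> J" if N: "Module.submodule N A (left_regular A)" "N \<noteq> carrier A" for N
  proof
    fix x assume x: "x \<in> N"
    show "x \<in> J"
    proof (rule ccontr)
      assume "x \<notin> J"
      then obtain s where s: "s \<in> carrier A" "s \<otimes>\<^bsub>A\<^esub> x = \<one>\<^bsub>A\<^esub>"
        using inverse_outside_J[of x] x N(1) sm by auto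
      then have "\<one>\<^bsub>A\<^esub> \<in> N" using x N(1) sm by force
      then have "r \<in> N" if "r \<in> carrier A" for r
        using that N(1) sm[of N] A.r_one[OF that] by force
      then show False using N sm by auto
    qed
  qed
  have "Module.submodule J A (left_regular A)"
    using sm J_subset J_zero J_add J_left by auto
  then show ?thesis
    unfolding maximal_left_ideal_def using proper one_notin_J by (auto; blast)
qed

lemma radical_eq: "radical A = J"
  using J_subset by (auto simp: radical_def maximal_left_ideal_iff)

definition J2 :: "'a set" where "J2 = ideal_prod A J J"

lemma J2_mult: "x \<in> J \<Longrightarrow> y \<in> J \<Longrightarrow> x \<otimes>\<^bsub>A\<^esub> y \<in> J2"
  unfolding J2_def by (rule ideal_prod.prod)

lemma J2_add: "x \<in> J2 \<Longrightarrow> y \<in> J2 \<Longrightarrow> x \<oplus>\<^bsub>A\<^esub> y \<in> J2"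
  unfolding J2_def by (rule ideal_prod.sum)

lemma J2_J: "x \<in> J2 \<Longrightarrow> x \<in> J"
  unfolding J2_def by (induction rule: ideal_prod.induct) (auto intro: J_left J_add)

lemma J2_subset: "J2 \<subseteq> J" using J2_J by auto

lemma J2_smult: "c \<in> carrier k \<Longrightarrow> x \<in> J2 \<Longrightarrow> c \<odot>\<^bsub>A\<^esub> x \<in> J2"
proof -
  assume c: "c \<in> carrier k" and "x \<in> J2"
  from this(2) show ?thesis unfolding J2_def
  proof (induction rule: ideal_prod.induct)
    case (prod i j)
    then show ?case using smult_mult_left[of c i j] c ideal_prod.prod[of "c \<odot>\<^bsub>A\<^esub> i" J j J A] J_smult by auto
  next
    case (sum x y)
    then have "x \<in> carrier A" "y \<in> carrier A" using J2_J unfolding J2_def by blast+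
    then show ?case using sum c ideal_prod.sum by (force simp: smult_r_distr)
  qed
qed

lemma J2_zero: "\<zero>\<^bsub>A\<^esub> \<in> J2"
  using J2_mult[OF J_zero J_zero] by simp

lemma subspace_J2: "subspace k J2 A"
  using J2_J by (intro subspaceI) (auto intro: J2_zero J2_add J2_smult)

lemma J_J2: "x \<in> J \<Longrightarrow> y \<in> J2 \<Longrightarrow> x \<otimes>\<^bsub>A\<^esub> y = \<zero>\<^bsub>A\<^esub>"
proof -
  assume x: "x \<in> J" and "y \<in> J2"
  from this(2) show ?thesis unfolding J2_def
  proof (induction rule: ideal_prod.induct)
    case (prod i j)
    then show ?case using J_cubed[OF x prod] x by (simp add: A.m_assoc)
  next
    case (sum u v)
    then have "u \<in> carrier A" "v \<in> carrier A" using J2_J unfolding J2_def by blast+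
    then show ?case using sum x by (simp add: A.r_distr)
  qed
qed

lemma J2_J_zero: "y \<in> J \<Longrightarrow> x \<in> J2 \<Longrightarrow> x \<otimes>\<^bsub>A\<^esub> y = \<zero>\<^bsub>A\<^esub>"
proof -
  assume y: "y \<in> J" and "x \<in> J2"
  from this(2) show ?thesis unfolding J2_def
  proof (induction rule: ideal_prod.induct)
    case (prod i j)
    then show ?case using J_cubed[OF prod y] by simp
  next
    case (sum u v)
    then have "u \<in> carrier A" "v \<in> carrier A" using J2_J unfolding J2_def by blast+
    then show ?case using sum y by (simp add: A.l_distr)
  qed
qed

lemma rad_power_1: "rad_power A (Suc 0) = J"
proof -
  have "x \<in> J" if "x \<in> ideal_prod A (carrier A) J" for x
    using that by (induction rule: ideal_prod.induct) (auto intro: J_left J_add)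
  moreover have "x \<in> ideal_prod A (carrier A) J" if "x \<in> J" for x
    using ideal_prod.prod[of "\<one>\<^bsub>A\<^esub>" "carrier A" x J A] that by simp
  ultimately show ?thesis by (auto simp: radical_eq)
qed

lemma rad_power_2: "rad_power A 2 = J2"
  using rad_power_1 by (simp add: numeral_2_eq_2 radical_eq J2_def)

definition left_soc :: "'a set" where
  "left_soc = {x \<in> J. \<forall>y\<in>J. y \<otimes>\<^bsub>A\<^esub> x = \<zero>\<^bsub>A\<^esub>}"

definition right_soc :: "'a set" where
  "right_soc = {x \<in> J. \<forall>y\<in>J. x \<otimes>\<^bsub>A\<^esub> y = \<zero>\<^bsub>A\<^esub>}"

lemma J2_soc: "J2 \<subseteq> left_soc" "J2 \<subseteq> right_soc"
  using J_J2 J2_J_zero J2_J by (auto simp: left_soc_def right_soc_def)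

lemma short_local_algebra_opposite: "short_local_algebra k (opposite A) J"
proof -
  have ag: "abelian_group (opposite A)"
    by (rule abelian_groupI) (auto simp: M.a_ac intro: M.l_neg bexI[of _ "\<ominus>\<^bsub>A\<^esub> _"])
  have r: "ring (opposite A)"
    by (rule ringI[OF ag]) (auto simp: A.m_assoc A.l_distr A.r_distr intro!: monoid.intro)
  have "module k (opposite A)"
    by (intro module.intro ag module_axioms.intro is_cring)
      (auto simp: smult_l_distr smult_r_distr smult_assoc1)
  then interpret op: vectorspace k "opposite A" by (intro vectorspace.intro field_axioms)
  have "linear_map k A (opposite A) id"
    by (auto simp: linear_map_def mod_hom_def mod_hom_axioms_def module_hom_def
        vectorspace_axioms op.vectorspace_axioms module_axioms op.module_axioms)
  then have "op.fin_dim" using linear_map.surj_fin_dim[of k A "opposite A" id] finite_dimensional by auto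
  then have "fd_algebra k (opposite A)"
    by (intro fd_algebra.intro fd_algebra_axioms.intro r op.vectorspace_axioms)
      (simp_all add: smult_mult_left smult_mult_right)
  moreover have "short_local_algebra_axioms k (opposite A) J"
  proof
    show "\<exists>c\<in>carrier k. \<exists>x\<in>J. r = c \<odot>\<^bsub>opposite A\<^esub> \<one>\<^bsub>opposite A\<^esub> \<oplus>\<^bsub>opposite A\<^esub> x"
      if "r \<in> carrier (opposite A)" for r
      using scalar_plus_J[of r] that by simp
    show "x \<otimes>\<^bsub>opposite A\<^esub> y \<otimes>\<^bsub>opposite A\<^esub> z = \<zero>\<^bsub>opposite A\<^esub>" if "x \<in> J" "y \<in> J" "z \<in> J" for x y z
      using J_cubed[OF that(3,2,1)] that by (simp add: A.m_assoc)
  qed (use J_subset J_zero J_add J_left J_right one_notin_J in simp_all)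
  ultimately show ?thesis by (rule short_local_algebra.intro)
qed

end

text \<open>
  The unique maximal left ideal \<open>I\<close> is also a right ideal: an element of \<open>A\<close> is \<open>c 1 + y\<close> with \<open>y \<in> I\<close>,
  and scalars commute with everything, so \<open>x (c 1 + y) = c x + x y\<close> is in \<open>I\<close> for \<open>x \<in> I\<close>.
\<close>

lemma fd_local_imp_short_local_algebra:
  assumes "fd_local_algebra k A" "short_algebra A"
  shows "short_local_algebra k A (radical A)"
proof -
  interpret fd_local_algebra k A by fact
  note sm = submodule_iff[OF A.left_module_left_regular]
  obtain I where I: "maximal_left_ideal A I" and u: "\<And>I'. maximal_left_ideal A I' \<Longrightarrow> I' = I"
    using local unfolding local_ring_def by auto
  have si: "Module.submodule I A (left_regular A)" "I \<noteq> carrier A" using I by (auto simp: maximal_left_ideal_def)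
  have "{I. maximal_left_ideal A I} = {I}" using I u by blast
  then have rad: "radical A = I" using si(1) sm by (auto simp: radical_def)
  have sub: "I \<subseteq> carrier A" and zero: "\<zero>\<^bsub>A\<^esub> \<in> I" and add: "\<And>x y. x \<in> I \<Longrightarrow> y \<in> I \<Longrightarrow> x \<oplus>\<^bsub>A\<^esub> y \<in> I"
    and left: "\<And>r x. r \<in> carrier A \<Longrightarrow> x \<in> I \<Longrightarrow> r \<otimes>\<^bsub>A\<^esub> x \<in> I"
    using si(1) sm by auto
  have one: "\<one>\<^bsub>A\<^esub> \<notin> I"
  proof
    assume "\<one>\<^bsub>A\<^esub> \<in> I"
    then have "r \<in> I" if "r \<in> carrier A" for r using left[OF that] A.r_one[OF that] by force
    then show False using sub si by auto
  qed
  have dec: "\<exists>c\<in>carrier k. \<exists>x\<in>I. r = c \<odot>\<^bsub>A\<^esub> \<one>\<^bsub>A\<^esub> \<oplus>\<^bsub>A\<^esub> x" if r: "r \<in> carrier A" for r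
  proof -
    have "I +>\<^bsub>A\<^esub> r \<in> carrier (A Quot radical A)"
      using r by (auto simp: FactRing_def A_RCOSETS_def' rad)
    then obtain c where c: "c \<in> carrier k" "I +>\<^bsub>A\<^esub> r = I +>\<^bsub>A\<^esub> (c \<odot>\<^bsub>A\<^esub> \<one>\<^bsub>A\<^esub>)"
      using residue_field unfolding bij_betw_def rad by (metis (no_types, lifting) imageE)
    have "r \<in> I +>\<^bsub>A\<^esub> r" using zero r by (force simp: a_r_coset_def')
    then obtain x where "x \<in> I" "r = x \<oplus>\<^bsub>A\<^esub> c \<odot>\<^bsub>A\<^esub> \<one>\<^bsub>A\<^esub>" using c(2) by (auto simp: a_r_coset_def')
    then have "x \<in> I" "r = c \<odot>\<^bsub>A\<^esub> \<one>\<^bsub>A\<^esub> \<oplus>\<^bsub>A\<^esub> x" using c(1) sub by (auto simp: M.a_comm)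
    then show ?thesis using c(1) by blast
  qed
  have right: "x \<otimes>\<^bsub>A\<^esub> r \<in> I" if x: "x \<in> I" and r: "r \<in> carrier A" for x r
  proof -
    obtain c y where c: "c \<in> carrier k" "y \<in> I" "r = c \<odot>\<^bsub>A\<^esub> \<one>\<^bsub>A\<^esub> \<oplus>\<^bsub>A\<^esub> y" using dec[OF r] by auto
    have xc: "x \<in> carrier A" "y \<in> carrier A" using x c sub by auto
    have "x \<otimes>\<^bsub>A\<^esub> r = (c \<odot>\<^bsub>A\<^esub> \<one>\<^bsub>A\<^esub>) \<otimes>\<^bsub>A\<^esub> x \<oplus>\<^bsub>A\<^esub> x \<otimes>\<^bsub>A\<^esub> y"
      unfolding c(3) using xc c(1) smult_mult_left[of c "\<one>\<^bsub>A\<^esub>" x] smult_mult_right[of c x "\<one>\<^bsub>A\<^esub>"]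
      by (simp add: A.r_distr)
    then show ?thesis using left x c xc add by simp
  qed
  have cube: "x \<otimes>\<^bsub>A\<^esub> y \<otimes>\<^bsub>A\<^esub> z = \<zero>\<^bsub>A\<^esub>" if "x \<in> I" "y \<in> I" "z \<in> I" for x y z
  proof -
    have "\<one>\<^bsub>A\<^esub> \<otimes>\<^bsub>A\<^esub> x \<otimes>\<^bsub>A\<^esub> y \<otimes>\<^bsub>A\<^esub> z \<in> rad_power A (Suc (Suc (Suc 0)))"
      unfolding rad_power.simps rad using that by (intro ideal_prod.prod) auto
    then show ?thesis using assms(2) that sub by (auto simp: short_algebra_def numeral_3_eq_3)
  qed
  show ?thesis unfolding rad using sub zero add left one dec right cube by unfold_locales auto
qed

section \<open>Length of modules over a short local algebra\<close>

definition restrict_scalars :: "('k, 'a) module \<Rightarrow> ('a, 'm) module \<Rightarrow> ('k, 'm) module" where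
  "restrict_scalars A M = \<lparr>carrier = carrier M, mult = mult M, one = one M, zero = zero M,
     add = add M, smult = (\<lambda>c x. (c \<odot>\<^bsub>A\<^esub> \<one>\<^bsub>A\<^esub>) \<odot>\<^bsub>M\<^esub> x)\<rparr>"

lemma restrict_scalars_simps [simp]:
  "carrier (restrict_scalars A M) = carrier M" "zero (restrict_scalars A M) = zero M"
  "add (restrict_scalars A M) = add M"
  "c \<odot>\<^bsub>restrict_scalars A M\<^esub> x = (c \<odot>\<^bsub>A\<^esub> \<one>\<^bsub>A\<^esub>) \<odot>\<^bsub>M\<^esub> x"
  "(restrict_scalars A M)\<lparr>carrier := U\<rparr> = restrict_scalars A (M\<lparr>carrier := U\<rparr>)"
  by (simp_all add: restrict_scalars_def)

lemma left_moduleI: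
  assumes "ring R" and "abelian_group M"
    and "\<And>r x. \<lbrakk>r \<in> carrier R; x \<in> carrier M\<rbrakk> \<Longrightarrow> r \<odot>\<^bsub>M\<^esub> x \<in> carrier M"
    and "\<And>r s x. \<lbrakk>r \<in> carrier R; s \<in> carrier R; x \<in> carrier M\<rbrakk>
        \<Longrightarrow> (r \<oplus>\<^bsub>R\<^esub> s) \<odot>\<^bsub>M\<^esub> x = r \<odot>\<^bsub>M\<^esub> x \<oplus>\<^bsub>M\<^esub> s \<odot>\<^bsub>M\<^esub> x"
    and "\<And>r x y. \<lbrakk>r \<in> carrier R; x \<in> carrier M; y \<in> carrier M\<rbrakk>
        \<Longrightarrow> r \<odot>\<^bsub>M\<^esub> (x \<oplus>\<^bsub>M\<^esub> y) = r \<odot>\<^bsub>M\<^esub> x \<oplus>\<^bsub>M\<^esub> r \<odot>\<^bsub>M\<^esub> y"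
    and "\<And>r s x. \<lbrakk>r \<in> carrier R; s \<in> carrier R; x \<in> carrier M\<rbrakk>
        \<Longrightarrow> (r \<otimes>\<^bsub>R\<^esub> s) \<odot>\<^bsub>M\<^esub> x = r \<odot>\<^bsub>M\<^esub> (s \<odot>\<^bsub>M\<^esub> x)"
    and "\<And>x. x \<in> carrier M \<Longrightarrow> \<one>\<^bsub>R\<^esub> \<odot>\<^bsub>M\<^esub> x = x"
  shows "left_module R M"
  by (intro left_module.intro left_module_axioms.intro assms)

lemma left_module_submodule:
  assumes M: "left_module R M" and N: "Module.submodule N R M"
  shows "left_module R (M\<lparr>carrier := N\<rparr>)"
proof -
  interpret left_module R M by fact
  note n = N[unfolded submodule_iff[OF M]]
  interpret N: Module.submodule N R M by fact
  have neg: "\<ominus>\<^bsub>M\<^esub> x \<in> N" if "x \<in> N" for x using N.m_inv_closed[OF that] by (simp add: a_inv_def)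
  have "abelian_group (M\<lparr>carrier := N\<rparr>)"
  proof (rule abelian_groupI)
    fix x assume "x \<in> carrier (M\<lparr>carrier := N\<rparr>)"
    then show "\<exists>y\<in>carrier (M\<lparr>carrier := N\<rparr>). y \<oplus>\<^bsub>M\<lparr>carrier := N\<rparr>\<^esub> x = \<zero>\<^bsub>M\<lparr>carrier := N\<rparr>\<^esub>"
      using n neg[of x] by (auto intro!: bexI[of _ "\<ominus>\<^bsub>M\<^esub> x"] M.l_neg)
  qed (use n in \<open>auto simp: M.a_ac subset_iff\<close>)
  then show ?thesis
    using n by (intro left_moduleI R.ring_axioms)
      (auto simp: smult_l_distr smult_r_distr smult_assoc smult_one subset_iff)
qed

text \<open>
  The axioms are identities, so they pass to images; this is how quotient modules are recognized as modules.
\<close>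

lemma left_module_image:
  assumes M: "left_module R M" and im: "h ` carrier M = carrier Q"
    and zero: "h \<zero>\<^bsub>M\<^esub> = \<zero>\<^bsub>Q\<^esub>"
    and add: "\<And>x y. \<lbrakk>x \<in> carrier M; y \<in> carrier M\<rbrakk> \<Longrightarrow> h (x \<oplus>\<^bsub>M\<^esub> y) = h x \<oplus>\<^bsub>Q\<^esub> h y"
    and smult: "\<And>r x. \<lbrakk>r \<in> carrier R; x \<in> carrier M\<rbrakk> \<Longrightarrow> h (r \<odot>\<^bsub>M\<^esub> x) = r \<odot>\<^bsub>Q\<^esub> h x"
  shows "left_module R Q"
proof -
  interpret left_module R M by fact
  have ex: "\<exists>x\<in>carrier M. q = h x" if "q \<in> carrier Q" for q using im that by auto
  have cl: "h x \<in> carrier Q" if "x \<in> carrier M" for x using im that by auto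
  have ag: "abelian_group Q"
  proof (rule abelian_groupI)
    fix x y assume "x \<in> carrier Q" "y \<in> carrier Q"
    then obtain u v where e: "u \<in> carrier M" "v \<in> carrier M" "x = h u" "y = h v" using ex by metis
    show "x \<oplus>\<^bsub>Q\<^esub> y \<in> carrier Q" using e by (simp add: add[symmetric] cl)
    show "x \<oplus>\<^bsub>Q\<^esub> y = y \<oplus>\<^bsub>Q\<^esub> x" using e by (simp add: add[symmetric] M.a_comm)
    fix z assume "z \<in> carrier Q"
    then obtain w where w: "w \<in> carrier M" "z = h w" using ex by metis
    show "x \<oplus>\<^bsub>Q\<^esub> y \<oplus>\<^bsub>Q\<^esub> z = x \<oplus>\<^bsub>Q\<^esub> (y \<oplus>\<^bsub>Q\<^esub> z)" using e w by (simp add: add[symmetric] M.a_assoc)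
  next
    show "\<zero>\<^bsub>Q\<^esub> \<in> carrier Q" using cl[of "\<zero>\<^bsub>M\<^esub>"] zero by simp
    fix x assume "x \<in> carrier Q"
    then obtain u where u: "u \<in> carrier M" "x = h u" using ex by metis
    show "\<zero>\<^bsub>Q\<^esub> \<oplus>\<^bsub>Q\<^esub> x = x" using u by (simp add: add[symmetric] zero[symmetric])
    show "\<exists>y\<in>carrier Q. y \<oplus>\<^bsub>Q\<^esub> x = \<zero>\<^bsub>Q\<^esub>"
      using u by (intro bexI[of _ "h (\<ominus>\<^bsub>M\<^esub> u)"]) (simp_all add: add[symmetric] zero[symmetric] M.l_neg cl)
  qed
  show ?thesis
  proof (rule left_moduleI[OF R.ring_axioms ag])
    note [simp] = smult_closed cl
    fix r x assume r: "r \<in> carrier R" and "x \<in> carrier Q"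
    then obtain u where u: "u \<in> carrier M" "x = h u" using ex by metis
    show "r \<odot>\<^bsub>Q\<^esub> x \<in> carrier Q" using u r by (simp add: smult[symmetric])
    show "(r \<oplus>\<^bsub>R\<^esub> s) \<odot>\<^bsub>Q\<^esub> x = r \<odot>\<^bsub>Q\<^esub> x \<oplus>\<^bsub>Q\<^esub> s \<odot>\<^bsub>Q\<^esub> x" if "s \<in> carrier R" for s
      using u r that by (simp add: smult[symmetric] add[symmetric] smult_l_distr)
    show "(r \<otimes>\<^bsub>R\<^esub> s) \<odot>\<^bsub>Q\<^esub> x = r \<odot>\<^bsub>Q\<^esub> (s \<odot>\<^bsub>Q\<^esub> x)" if "s \<in> carrier R" for s
      using u r that by (simp add: smult[symmetric] smult_assoc)
    show "r \<odot>\<^bsub>Q\<^esub> (x \<oplus>\<^bsub>Q\<^esub> y) = r \<odot>\<^bsub>Q\<^esub> x \<oplus>\<^bsub>Q\<^esub> r \<odot>\<^bsub>Q\<^esub> y" if "y \<in> carrier Q" for y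
    proof -
      obtain v where "v \<in> carrier M" "y = h v" using ex \<open>y \<in> carrier Q\<close> by metis
      then show ?thesis using u r by (simp add: smult[symmetric] add[symmetric] smult_r_distr)
    qed
  next
    fix x assume "x \<in> carrier Q"
    then obtain u where u: "u \<in> carrier M" "x = h u" using ex by metis
    then show "\<one>\<^bsub>R\<^esub> \<odot>\<^bsub>Q\<^esub> x = x" by (simp add: smult[symmetric] smult_one)
  qed
qed

locale short_module = short_local_algebra k A J + left_module A M
  for k :: "'k ring" and A :: "('k, 'a) module" and J :: "'a set" and M :: "('a, 'm) module"
begin

abbreviation V where "V \<equiv> restrict_scalars A M"

lemmas act_closed [simp] = local.left_module_axioms[THEN left_module.smult_closed]
lemmas act_add = local.left_module_axioms[THEN left_module.smult_l_distr]
lemmas act_add_right = local.left_module_axioms[THEN left_module.smult_r_distr]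
lemmas act_mult = local.left_module_axioms[THEN left_module.smult_assoc]
lemmas act_one = local.left_module_axioms[THEN left_module.smult_one]

lemma abelian_group_M: "abelian_group M"
  using left_module_axioms by (simp add: left_module_def)

lemma vectorspace_V: "vectorspace k V"
proof -
  interpret M: abelian_group M by (rule abelian_group_M)
  have "abelian_group V"
  proof (rule abelian_groupI)
    fix x assume "x \<in> carrier V"
    then show "\<exists>y\<in>carrier V. y \<oplus>\<^bsub>V\<^esub> x = \<zero>\<^bsub>V\<^esub>" by (intro bexI[of _ "\<ominus>\<^bsub>M\<^esub> x"]) (auto simp: M.l_neg)
  qed (auto simp: M.a_ac)
  then have "module k V"
    by (intro module.intro is_cring module_axioms.intro)
      (simp_all add: sc_hom act_add act_add_right act_mult act_one)
  then show ?thesis by (intro vectorspace.intro field_axioms)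
qed

sublocale V: vectorspace k V by (rule vectorspace_V)

lemma act_zero [simp]:
  "r \<in> carrier A \<Longrightarrow> r \<odot>\<^bsub>M\<^esub> \<zero>\<^bsub>M\<^esub> = \<zero>\<^bsub>M\<^esub>" "x \<in> carrier M \<Longrightarrow> \<zero>\<^bsub>A\<^esub> \<odot>\<^bsub>M\<^esub> x = \<zero>\<^bsub>M\<^esub>"
proof -
  interpret M: abelian_group M by (rule abelian_group_M)
  show "r \<odot>\<^bsub>M\<^esub> \<zero>\<^bsub>M\<^esub> = \<zero>\<^bsub>M\<^esub>" if "r \<in> carrier A"
    using act_add_right[of r "\<zero>\<^bsub>M\<^esub>" "\<zero>\<^bsub>M\<^esub>"] that by simp
  show "\<zero>\<^bsub>A\<^esub> \<odot>\<^bsub>M\<^esub> x = \<zero>\<^bsub>M\<^esub>" if "x \<in> carrier M"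
    using act_add[of "\<zero>\<^bsub>A\<^esub>" "\<zero>\<^bsub>A\<^esub>" x] that by simp
qed

lemma act_sc_commute:
  assumes "c \<in> carrier k" "r \<in> carrier A" "x \<in> carrier M"
  shows "r \<odot>\<^bsub>M\<^esub> (sc c \<odot>\<^bsub>M\<^esub> x) = sc c \<odot>\<^bsub>M\<^esub> (r \<odot>\<^bsub>M\<^esub> x)"
  using assms by (simp add: act_mult[symmetric] sc_mult)

lemma smult_V: "(c \<odot>\<^bsub>A\<^esub> r) \<odot>\<^bsub>M\<^esub> x = sc c \<odot>\<^bsub>M\<^esub> (r \<odot>\<^bsub>M\<^esub> x)"
  if "c \<in> carrier k" "r \<in> carrier A" "x \<in> carrier M"
  using that by (simp add: act_mult[symmetric] sc_mult)

lemma submodule_iff_subspace: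
  "Module.submodule N A M \<longleftrightarrow> subspace k N V \<and> (\<forall>r\<in>J. \<forall>x\<in>N. r \<odot>\<^bsub>M\<^esub> x \<in> N)"
proof
  assume N: "Module.submodule N A M"
  then have n: "N \<subseteq> carrier M" "\<zero>\<^bsub>M\<^esub> \<in> N" "\<And>x y. x \<in> N \<Longrightarrow> y \<in> N \<Longrightarrow> x \<oplus>\<^bsub>M\<^esub> y \<in> N"
      "\<And>r x. r \<in> carrier A \<Longrightarrow> x \<in> N \<Longrightarrow> r \<odot>\<^bsub>M\<^esub> x \<in> N"
    using submodule_iff[OF left_module_axioms] by auto
  then show "subspace k N V \<and> (\<forall>r\<in>J. \<forall>x\<in>N. r \<odot>\<^bsub>M\<^esub> x \<in> N)"
    by (intro conjI V.subspaceI) auto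
next
  assume "subspace k N V \<and> (\<forall>r\<in>J. \<forall>x\<in>N. r \<odot>\<^bsub>M\<^esub> x \<in> N)"
  then have N: "subspace k N V" and JN: "\<And>r x. r \<in> J \<Longrightarrow> x \<in> N \<Longrightarrow> r \<odot>\<^bsub>M\<^esub> x \<in> N" by auto
  note n = V.subspaceD[OF N, simplified]
  have "r \<odot>\<^bsub>M\<^esub> x \<in> N" if r: "r \<in> carrier A" and x: "x \<in> N" for r x
  proof -
    obtain c y where c: "c \<in> carrier k" "y \<in> J" "r = sc c \<oplus>\<^bsub>A\<^esub> y" using scalar_plus_J[OF r] by blast
    then have "r \<odot>\<^bsub>M\<^esub> x = sc c \<odot>\<^bsub>M\<^esub> x \<oplus>\<^bsub>M\<^esub> y \<odot>\<^bsub>M\<^esub> x" using x n(1) by (simp add: act_add subset_iff)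
    then show ?thesis using n(3)[OF n(4)[OF c(1) x] JN[OF c(2) x]] by simp
  qed
  then show "Module.submodule N A M" using n submodule_iff[OF left_module_axioms] by auto
qed

lemma submodule_carrier: "Module.submodule (carrier M) A M"
  using V.subspace_carrier by (auto simp: submodule_iff_subspace)

lemma submodule_zero: "Module.submodule {\<zero>\<^bsub>M\<^esub>} A M"
  using V.subspace_zero by (auto simp: submodule_iff_subspace)

text \<open>
  A form of Nakayama's lemma. If no such \<open>v\<close> existed, then starting from any vector in \<open>N'\<close> outside \<open>N\<close>
  one could multiply by elements of \<open>J\<close> three times without entering \<open>N\<close>, although \<open>J\<^sup>3 = 0\<close>.
\<close>

lemma almost_invariant_vector:
  assumes N: "Module.submodule N A M" and N': "Module.submodule N' A M" and "N \<subset> N'"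
  shows "\<exists>v\<in>N'. v \<notin> N \<and> (\<forall>r\<in>J. r \<odot>\<^bsub>M\<^esub> v \<in> N)"
proof (rule ccontr)
  assume no: "\<not> ?thesis"
  have n: "subspace k N V" "N' \<subseteq> carrier M" "\<And>r x. r \<in> J \<Longrightarrow> x \<in> N' \<Longrightarrow> r \<odot>\<^bsub>M\<^esub> x \<in> N'"
    using N N' V.subspaceD(1)[of N'] unfolding submodule_iff_subspace by simp_all
  obtain v where v: "v \<in> N'" "v \<notin> N" using assms(3) by auto
  have move: "\<exists>r\<in>J. r \<odot>\<^bsub>M\<^esub> x \<notin> N" if "x \<in> N'" "x \<notin> N" for x using no that by blast
  obtain r where r: "r \<in> J" "r \<odot>\<^bsub>M\<^esub> v \<notin> N" using move[OF v] by blast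
  obtain s where s: "s \<in> J" "s \<odot>\<^bsub>M\<^esub> (r \<odot>\<^bsub>M\<^esub> v) \<notin> N" using move[OF n(3)[OF r(1) v(1)] r(2)] by blast
  obtain t where t: "t \<in> J" "t \<odot>\<^bsub>M\<^esub> (s \<odot>\<^bsub>M\<^esub> (r \<odot>\<^bsub>M\<^esub> v)) \<notin> N"
    using move[OF n(3)[OF s(1) n(3)[OF r(1) v(1)]] s(2)] by blast
  have "t \<odot>\<^bsub>M\<^esub> (s \<odot>\<^bsub>M\<^esub> (r \<odot>\<^bsub>M\<^esub> v)) = (t \<otimes>\<^bsub>A\<^esub> s \<otimes>\<^bsub>A\<^esub> r) \<odot>\<^bsub>M\<^esub> v"
    using J_carrier[OF t(1)] J_carrier[OF s(1)] J_carrier[OF r(1)] subsetD[OF n(2) v(1)]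
    by (simp add: act_mult)
  then have "t \<odot>\<^bsub>M\<^esub> (s \<odot>\<^bsub>M\<^esub> (r \<odot>\<^bsub>M\<^esub> v)) = \<zero>\<^bsub>M\<^esub>" 
    using J_cubed[OF t(1) s(1) r(1)] subsetD[OF n(2) v(1)] by simp
  then show False using t(2) V.subspaceD(2)[OF n(1)] by simp
qed

lemma submodule_add_line:
  assumes N: "Module.submodule N A M" and v: "v \<in> carrier M" "\<And>r. r \<in> J \<Longrightarrow> r \<odot>\<^bsub>M\<^esub> v \<in> N"
  shows "Module.submodule (N <+>\<^bsub>V\<^esub> V.line v) A M"
proof -
  have n: "subspace k N V" "\<And>r x. r \<in> J \<Longrightarrow> x \<in> N \<Longrightarrow> r \<odot>\<^bsub>M\<^esub> x \<in> N"
    using N unfolding submodule_iff_subspace by simp_all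
  have vV: "v \<in> carrier V" using v by simp
  have "r \<odot>\<^bsub>M\<^esub> x \<in> N <+>\<^bsub>V\<^esub> V.line v" if r: "r \<in> J" and x: "x \<in> N <+>\<^bsub>V\<^esub> V.line v" for r x
  proof -
    obtain y c where y: "y \<in> N" "c \<in> carrier k" "x = y \<oplus>\<^bsub>M\<^esub> sc c \<odot>\<^bsub>M\<^esub> v"
      using x by (auto simp: V.in_set_add V.line_def)
    have yc: "y \<in> carrier M" using y V.subspaceD(1)[OF n(1)] by auto
    have "r \<odot>\<^bsub>M\<^esub> x = r \<odot>\<^bsub>M\<^esub> y \<oplus>\<^bsub>M\<^esub> sc c \<odot>\<^bsub>M\<^esub> (r \<odot>\<^bsub>M\<^esub> v)"
      unfolding y(3) using r yc y(2) v(1) by (simp add: act_add_right act_sc_commute)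
    then have "r \<odot>\<^bsub>M\<^esub> x \<in> N"
      using n(2)[OF r y(1)] V.subspaceD(3)[OF n(1)] V.subspaceD(4)[OF n(1) y(2) v(2)[OF r]] by simp
    then show ?thesis using V.set_add_upper(1)[OF n(1) V.subspace_line[OF vV]] by auto
  qed
  then show ?thesis
    using V.subspace_set_add[OF n(1) V.subspace_line[OF vV]] by (simp add: submodule_iff_subspace)
qed

text \<open>
  Composition factors are one-dimensional because \<open>A/J = k\<close>; hence length is dimension.
\<close>

lemma composition_step:
  assumes N: "Module.submodule N A M" and N': "Module.submodule N' A M" and "N \<subset> N'"
    and no: "\<And>X. Module.submodule X A M \<Longrightarrow> \<not> (N \<subset> X \<and> X \<subset> N')"
  shows "\<exists>v\<in>N'. v \<notin> N \<and> N' = N <+>\<^bsub>V\<^esub> V.line v"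
proof -
  obtain v where v: "v \<in> N'" "v \<notin> N" "\<And>r. r \<in> J \<Longrightarrow> r \<odot>\<^bsub>M\<^esub> v \<in> N"
    using almost_invariant_vector[OF assms(1-3)] by auto
  have n: "subspace k N V" "subspace k N' V" using N N' submodule_iff_subspace by auto
  have vV: "v \<in> carrier V" "v \<in> carrier M" using v(1) V.subspaceD(1)[OF n(2)] by auto
  have "N <+>\<^bsub>V\<^esub> V.line v \<subseteq> N'"
  proof
    fix x assume "x \<in> N <+>\<^bsub>V\<^esub> V.line v"
    then obtain y c where y: "y \<in> N" "c \<in> carrier k" "x = y \<oplus>\<^bsub>V\<^esub> c \<odot>\<^bsub>V\<^esub> v"
      by (auto simp: V.in_set_add V.line_def)
    then show "x \<in> N'" using assms(3) V.subspaceD(3)[OF n(2)] V.subspaceD(4)[OF n(2) y(2) v(1)] by auto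
  qed
  moreover have "N \<subset> N <+>\<^bsub>V\<^esub> V.line v"
    using V.set_add_upper[OF n(1) V.subspace_line[OF vV(1)]] V.mem_line[OF vV(1)] v(2) by auto
  ultimately have "N <+>\<^bsub>V\<^esub> V.line v = N'" using no[OF submodule_add_line[OF N vV(2) v(3)]] by auto
  then show ?thesis using v by auto
qed

lemma fin_dim_if_finite_length:
  assumes "composition_series A M n S"
  shows "V.fin_dim"
proof -
  note S = assms[unfolded composition_series_def]
  have "i \<le> n \<Longrightarrow> \<exists>F. finite F \<and> F \<subseteq> carrier V \<and> S i \<subseteq> V.span F" for i
  proof (induction i)
    case 0
    then show ?case using S by (intro exI[of _ "{}"]) (auto simp: V.span_empty)
  next
    case (Suc i)
    then obtain F where F: "finite F" "F \<subseteq> carrier V" "S i \<subseteq> V.span F" by auto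
    obtain v where v: "v \<in> S (Suc i)" "S (Suc i) = S i <+>\<^bsub>V\<^esub> V.line v"
      using composition_step[of "S i" "S (Suc i)"] S Suc.prems by auto
    have vc: "v \<in> carrier V"
      using v(1) S Suc.prems submodule_iff_subspace V.subspaceD(1)[of "S (Suc i)"] by auto
    let ?F = "insert v F"
    have F': "?F \<subseteq> carrier V" using F vc by auto
    note sp = V.span_is_subspace[OF F']
    have "S i \<subseteq> V.span ?F" using F(3) V.span_is_monotone[of F ?F] by auto
    moreover have "v \<in> V.span ?F" using V.in_own_span[OF F'] by auto
    ultimately have "S (Suc i) \<subseteq> V.span ?F"
      unfolding v(2) using V.subspaceD(3,4)[OF sp]
      by (auto simp: V.in_set_add V.line_def subset_iff simp del: restrict_scalars_simps)
    then show ?case using F(1) F' by blast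
  qed
  from this[of n] obtain F where F: "finite F" "F \<subseteq> carrier V" "carrier V \<subseteq> V.span F" using S by auto
  then have "V.gen_set F" using V.span_is_subset2[OF F(2)] by auto
  then show ?thesis using F unfolding V.fin_dim_def by blast
qed

end

locale fd_module = short_module +
  assumes fd_V: "V.fin_dim"
begin

sublocale V: fd_space k V
  by unfold_locales (rule fd_V)

lemma composition_series_length:
  assumes "composition_series A M n S"
  shows "n = sdim k V (carrier M)"
proof -
  note S = assms[unfolded composition_series_def]
  have "i \<le> n \<Longrightarrow> sdim k V (S i) = i" for i
  proof (induction i)
    case 0
    then show ?case using S V.sdim_zero by auto
  next
    case (Suc i)
    obtain v where v: "v \<in> S (Suc i)" "v \<notin> S i" "S (Suc i) = S i <+>\<^bsub>V\<^esub> V.line v"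
      using composition_step[of "S i" "S (Suc i)"] S Suc.prems by auto
    have "subspace k (S i) V" "subspace k (S (Suc i)) V"
      using S Suc.prems submodule_iff_subspace by auto
    then show ?case using V.sdim_add_line(2)[of "S i" v] v Suc V.subspaceD(1)[of "S (Suc i)"] by auto
  qed
  from this[of n] show ?thesis using S by auto
qed

lemma composition_series_exists:
  "\<exists>S. composition_series A M (sdim k V (carrier M)) S"
proof -
  let ?d = "sdim k V (carrier M)"
  have "n \<le> ?d \<Longrightarrow> \<exists>S. S 0 = {\<zero>\<^bsub>M\<^esub>} \<and> (\<forall>i\<le>n. Module.submodule (S i) A M \<and> sdim k V (S i) = i) \<and>
      (\<forall>i<n. S i \<subset> S (Suc i))" for n
  proof (induction n)
    case 0
    show ?case using submodule_zero V.sdim_zero by (intro exI[of _ "\<lambda>_. {\<zero>\<^bsub>M\<^esub>}"]) auto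
  next
    case (Suc n)
    then obtain S where S: "S 0 = {\<zero>\<^bsub>M\<^esub>}" "\<And>i. i \<le> n \<Longrightarrow> Module.submodule (S i) A M"
      "\<And>i. i \<le> n \<Longrightarrow> sdim k V (S i) = i" "\<And>i. i < n \<Longrightarrow> S i \<subset> S (Suc i)" by auto
    have sub: "subspace k (S n) V" using S(2)[of n] submodule_iff_subspace by auto
    have "S n \<noteq> carrier M" using S(3)[of n] Suc.prems by auto
    then have "S n \<subset> carrier M" using V.subspaceD(1)[OF sub] by auto
    then obtain v where v: "v \<in> carrier M" "v \<notin> S n" "\<And>r. r \<in> J \<Longrightarrow> r \<odot>\<^bsub>M\<^esub> v \<in> S n"
      using almost_invariant_vector[OF S(2)[of n] submodule_carrier] by auto
    let ?N = "S n <+>\<^bsub>V\<^esub> V.line v"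
    have N: "Module.submodule ?N A M" by (rule submodule_add_line[OF S(2)[OF order_refl] v(1,3)])
    have N2: "sdim k V ?N = Suc n" "S n \<subset> ?N"
      using V.sdim_add_line[OF sub, of v] v S(3)[of n] by auto
    show ?case
      by (rule exI[of _ "S(Suc n := ?N)"]) (use S N N2 in \<open>auto simp: le_Suc_eq less_Suc_eq\<close>)
  qed
  from this[of ?d] obtain S where S: "S 0 = {\<zero>\<^bsub>M\<^esub>}" "\<And>i. i \<le> ?d \<Longrightarrow> Module.submodule (S i) A M"
      "\<And>i. i \<le> ?d \<Longrightarrow> sdim k V (S i) = i" "\<And>i. i < ?d \<Longrightarrow> S i \<subset> S (Suc i)" by auto
  have sub: "subspace k (S i) V" if "i \<le> ?d" for i using S(2)[OF that] submodule_iff_subspace by auto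
  have "S ?d = carrier V"
    using V.sdim_mono(2)[OF sub[OF order_refl] V.subspace_carrier] V.subspaceD(1)[OF sub[OF order_refl]] S(3)[of ?d] by auto
  moreover have "\<not> (S i \<subset> N \<and> N \<subset> S (Suc i))" if "i < ?d" "Module.submodule N A M" for i N
  proof
    assume N: "S i \<subset> N \<and> N \<subset> S (Suc i)"
    have "subspace k N V" using that submodule_iff_subspace by auto
    then have "sdim k V (S i) < sdim k V N" "sdim k V N < sdim k V (S (Suc i))"
      using V.sdim_strict_mono[of "S i" N] V.sdim_strict_mono[of N "S (Suc i)"] N sub that(1) by auto
    then show False using S(3) that(1) by auto
  qed
  ultimately have "composition_series A M ?d S" using S by (auto simp: composition_series_def)
  then show ?thesis by blast
qed

lemma mlength_eq: "mlength A M = sdim k V (carrier M)"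
  unfolding mlength_def
  by (rule Least_equality) (use composition_series_exists composition_series_length in auto)

lemma finite_length: "finite_length_module A M"
  using composition_series_exists left_module_axioms by (auto simp: finite_length_module_def)

end

lemma (in short_module) fd_module_if_finite_length:
  "finite_length_module A M \<Longrightarrow> fd_module k A J M"
  using fin_dim_if_finite_length
  by (auto simp: finite_length_module_def intro!: fd_module.intro short_module_axioms fd_module_axioms.intro)

text \<open>
  A simple submodule contains a nonzero vector killed by \<open>J\<close>, and the vectors killed by \<open>J\<close> in it form a
  submodule.
\<close>

lemma (in short_module) socle_subset:
  "socle A M \<subseteq> {x \<in> carrier M. \<forall>r\<in>J. r \<odot>\<^bsub>M\<^esub> x = \<zero>\<^bsub>M\<^esub>}" (is "_ \<subseteq> ?N")
proof -
  interpret M: abelian_group M by (rule abelian_group_M)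
  have "subspace k ?N V" by (rule V.subspaceI) (auto simp: act_add_right act_sc_commute)
  then have N: "Module.submodule ?N A M" using V.subspaceD(2)[of ?N] by (auto simp: submodule_iff_subspace)
  have "S \<subseteq> ?N" if S: "Module.submodule S A M" and simple: "simple_module A (M\<lparr>carrier := S\<rparr>)" for S
  proof -
    interpret S: short_module k A J "M\<lparr>carrier := S\<rparr>"
      by (intro short_module.intro short_local_algebra_axioms left_module_submodule[OF left_module_axioms S])
    have "S \<noteq> {\<zero>\<^bsub>M\<^esub>}" and S0: "\<zero>\<^bsub>M\<^esub> \<in> S" and Sc: "S \<subseteq> carrier M"
      using simple S submodule_iff[OF left_module_axioms] by (auto simp: simple_module_def)
    then have "{\<zero>\<^bsub>M\<^esub>} \<subset> S" by auto
    then obtain v where v: "v \<in> S" "v \<noteq> \<zero>\<^bsub>M\<^esub>" "\<And>r. r \<in> J \<Longrightarrow> r \<odot>\<^bsub>M\<^esub> v = \<zero>\<^bsub>M\<^esub>"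
      using almost_invariant_vector[OF submodule_zero S] by auto
    have "subspace k (S \<inter> ?N) V"
      using V.subspace_Int S \<open>subspace k ?N V\<close> submodule_iff_subspace by blast
    then have "subspace k (S \<inter> ?N) S.V"
      using V.subspaceD[of "S \<inter> ?N"] by (intro S.V.subspaceI) auto
    then have "Module.submodule (S \<inter> ?N) A (M\<lparr>carrier := S\<rparr>)"
      using S0 by (auto simp: S.submodule_iff_subspace)
    then have "S \<inter> ?N = {\<zero>\<^bsub>M\<^esub>} \<or> S \<inter> ?N = S" using simple by (auto simp: simple_module_def)
    moreover have "v \<in> S \<inter> ?N" using v Sc by auto
    ultimately show ?thesis using v by blast
  qed
  then show ?thesis using N unfolding socle_def by blast
qed

section \<open>Modules in duality\<close>

context short_local_algebra
begin

lemma J2_opposite: "short_local_algebra.J2 (opposite A) J = J2"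
proof -
  interpret op: short_local_algebra k "opposite A" J by (rule short_local_algebra_opposite)
  have "x \<in> J2" if "x \<in> op.J2" for x
    using that unfolding op.J2_def
    by (induction rule: ideal_prod.induct) (auto intro: J2_mult J2_add)
  moreover have "x \<in> op.J2" if "x \<in> J2" for x
    using that unfolding J2_def
  proof (induction rule: ideal_prod.induct)
    case (prod i j) then show ?case using op.J2_mult[of j i] by simp
  next
    case (sum x y) then show ?case using op.J2_add[of x y] by simp
  qed
  ultimately show ?thesis by auto
qed

lemma soc_opposite:
  "short_local_algebra.left_soc (opposite A) J = right_soc"
  "short_local_algebra.right_soc (opposite A) J = left_soc"
proof -
  interpret op: short_local_algebra k "opposite A" J by (rule short_local_algebra_opposite)
  show "op.left_soc = right_soc" "op.right_soc = left_soc"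
    unfolding op.left_soc_def op.right_soc_def left_soc_def right_soc_def by simp_all
qed

end

context short_module
begin

text \<open>
  The socle, because a module is semisimple exactly if \<open>J\<close> annihilates it.
\<close>

definition soc :: "'m set" where "soc = {x \<in> carrier M. \<forall>r\<in>J. r \<odot>\<^bsub>M\<^esub> x = \<zero>\<^bsub>M\<^esub>}"

text \<open>
  The subspace usually written \<open>JU\<close>.
\<close>

definition Jspan :: "'m set \<Rightarrow> 'm set" where
  "Jspan U = carrier M \<inter> \<Inter>{Y. subspace k Y V \<and> (\<forall>r\<in>J. \<forall>u\<in>U. r \<odot>\<^bsub>M\<^esub> u \<in> Y)}"

lemma subspace_soc: "subspace k soc V"
proof -
  interpret M: abelian_group M by (rule abelian_group_M)
  show ?thesis by (rule V.subspaceI) (auto simp: soc_def act_add_right act_sc_commute)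
qed

lemma subspace_Jspan: "subspace k (Jspan U) V"
proof -
  interpret M: abelian_group M by (rule abelian_group_M)
  show ?thesis
    by (rule V.subspaceI)
      (auto simp: Jspan_def intro: V.subspaceD(2)[simplified] V.subspaceD(3,4)[simplified])
qed

lemma Jspan_mem: "r \<in> J \<Longrightarrow> u \<in> U \<Longrightarrow> u \<in> carrier M \<Longrightarrow> r \<odot>\<^bsub>M\<^esub> u \<in> Jspan U"
  by (auto simp: Jspan_def)

lemma Jspan_least:
  "subspace k Y V \<Longrightarrow> (\<And>r u. r \<in> J \<Longrightarrow> u \<in> U \<Longrightarrow> r \<odot>\<^bsub>M\<^esub> u \<in> Y) \<Longrightarrow> Jspan U \<subseteq> Y"
  by (auto simp: Jspan_def)

end

text \<open>
  The abstract form of a reflexive module \<open>M\<close> and its dual \<open>N\<close> when all homomorphisms \<open>M \<rightarrow> A\<close> have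
  values in \<open>J\<close>. Duals and biduals are replaced by the two statements that the pairing represents all
  homomorphisms into \<open>J\<close>.
\<close>

locale dual_pair = short_local_algebra k A J + M: fd_module k A J M + N: fd_module k "opposite A" J N
  for k :: "'k ring" and A :: "('k, 'a) module" and J :: "'a set"
    and M :: "('a, 'm) module" and N :: "('a, 'n) module" +
  fixes B :: "'n \<Rightarrow> 'm \<Rightarrow> 'a"
  assumes B_J: "\<lbrakk>f \<in> carrier N; m \<in> carrier M\<rbrakk> \<Longrightarrow> B f m \<in> J"
    and B_add_left: "\<lbrakk>f \<in> carrier N; g \<in> carrier N; m \<in> carrier M\<rbrakk> \<Longrightarrow> B (f \<oplus>\<^bsub>N\<^esub> g) m = B f m \<oplus>\<^bsub>A\<^esub> B g m"
    and B_add_right: "\<lbrakk>f \<in> carrier N; m \<in> carrier M; m' \<in> carrier M\<rbrakk> \<Longrightarrow> B f (m \<oplus>\<^bsub>M\<^esub> m') = B f m \<oplus>\<^bsub>A\<^esub> B f m'"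
    and B_act_left: "\<lbrakk>r \<in> carrier A; f \<in> carrier N; m \<in> carrier M\<rbrakk> \<Longrightarrow> B (r \<odot>\<^bsub>N\<^esub> f) m = B f m \<otimes>\<^bsub>A\<^esub> r"
    and B_act_right: "\<lbrakk>r \<in> carrier A; f \<in> carrier N; m \<in> carrier M\<rbrakk> \<Longrightarrow> B f (r \<odot>\<^bsub>M\<^esub> m) = r \<otimes>\<^bsub>A\<^esub> B f m"
    and all_homs_left: "\<lbrakk>h \<in> carrier M \<rightarrow> J;
        \<And>x y. \<lbrakk>x \<in> carrier M; y \<in> carrier M\<rbrakk> \<Longrightarrow> h (x \<oplus>\<^bsub>M\<^esub> y) = h x \<oplus>\<^bsub>A\<^esub> h y;
        \<And>r x. \<lbrakk>r \<in> carrier A; x \<in> carrier M\<rbrakk> \<Longrightarrow> h (r \<odot>\<^bsub>M\<^esub> x) = r \<otimes>\<^bsub>A\<^esub> h x\<rbrakk>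
      \<Longrightarrow> \<exists>f\<in>carrier N. \<forall>x\<in>carrier M. B f x = h x"
    and all_homs_right: "\<lbrakk>h' \<in> carrier N \<rightarrow> J;
        \<And>f g. \<lbrakk>f \<in> carrier N; g \<in> carrier N\<rbrakk> \<Longrightarrow> h' (f \<oplus>\<^bsub>N\<^esub> g) = h' f \<oplus>\<^bsub>A\<^esub> h' g;
        \<And>r f. \<lbrakk>r \<in> carrier A; f \<in> carrier N\<rbrakk> \<Longrightarrow> h' (r \<odot>\<^bsub>N\<^esub> f) = h' f \<otimes>\<^bsub>A\<^esub> r\<rbrakk>
      \<Longrightarrow> \<exists>x\<in>carrier M. \<forall>f\<in>carrier N. B f x = h' f"
    and nondegenerate_left: "\<lbrakk>f \<in> carrier N; \<And>m. m \<in> carrier M \<Longrightarrow> B f m = \<zero>\<^bsub>A\<^esub>\<rbrakk> \<Longrightarrow> f = \<zero>\<^bsub>N\<^esub>"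
    and nondegenerate_right: "\<lbrakk>m \<in> carrier M; \<And>f. f \<in> carrier N \<Longrightarrow> B f m = \<zero>\<^bsub>A\<^esub>\<rbrakk> \<Longrightarrow> m = \<zero>\<^bsub>M\<^esub>"
    and nonzero: "carrier M \<noteq> {\<zero>\<^bsub>M\<^esub>}"
begin

lemma B_carrier [simp, intro]: "\<lbrakk>f \<in> carrier N; m \<in> carrier M\<rbrakk> \<Longrightarrow> B f m \<in> carrier A"
  using B_J by auto

sublocale B: bilinear_pairing k N.V M.V A B
  by unfold_locales (auto simp: B_add_left B_add_right B_act_left B_act_right sc_mult)

lemma nonzero_N: "carrier N \<noteq> {\<zero>\<^bsub>N\<^esub>}"
proof
  assume "carrier N = {\<zero>\<^bsub>N\<^esub>}"
  then have "m = \<zero>\<^bsub>M\<^esub>" if "m \<in> carrier M" for m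
    using nondegenerate_right[OF that] B.zero_left[of m] that by simp
  then show False using nonzero M.V.subspaceD(2)[OF M.V.subspace_carrier] by auto
qed

lemma dual_pair_opposite: "dual_pair k (opposite A) J N M (\<lambda>m f. B f m)"
proof -
  have "short_local_algebra k (opposite A) J" by (rule short_local_algebra_opposite)
  moreover have "fd_module k (opposite (opposite A)) J M" using M.fd_module_axioms by simp
  ultimately show ?thesis
    by (intro dual_pair.intro dual_pair_axioms.intro N.fd_module_axioms)
      (simp_all add: B_J B_add_left B_add_right B_act_left B_act_right all_homs_left all_homs_right
        nondegenerate_left nondegenerate_right nonzero_N)
qed

lemma JJ_zero:
  assumes "r \<in> J" "s \<in> J" "m \<in> carrier M" shows "r \<odot>\<^bsub>M\<^esub> (s \<odot>\<^bsub>M\<^esub> m) = \<zero>\<^bsub>M\<^esub>"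
proof (rule nondegenerate_right)
  fix f assume f: "f \<in> carrier N"
  show "B f (r \<odot>\<^bsub>M\<^esub> (s \<odot>\<^bsub>M\<^esub> m)) = \<zero>\<^bsub>A\<^esub>"
    using f assms J_cubed[of r s "B f m"] B_J[of f m] by (simp add: B_act_right A.m_assoc)
qed (use assms in auto)

lemma Jspan_soc: "M.Jspan U \<subseteq> M.soc" if "U \<subseteq> carrier M"
  using that JJ_zero by (intro M.Jspan_least M.subspace_soc) (auto simp: M.soc_def)

text \<open>
  As \<open>J J M = 0\<close>, the equation \<open>JM = M\<close> would make \<open>J\<close> annihilate \<open>M = JM\<close>, so that \<open>M = 0\<close>.
\<close>

lemma Jspan_proper: "M.Jspan (carrier M) \<noteq> carrier M"
proof
  assume e: "M.Jspan (carrier M) = carrier M"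
  then have "carrier M \<subseteq> M.soc" using Jspan_soc[of "carrier M"] by simp
  then have "M.Jspan (carrier M) \<subseteq> {\<zero>\<^bsub>M\<^esub>}"
    using M.V.subspace_zero by (intro M.Jspan_least) (auto simp: M.soc_def)
  then show False using e nonzero M.V.subspaceD(2)[OF M.V.subspace_carrier] by auto
qed

lemma top_functional:
  "\<exists>\<nu> m. M.V.functional \<nu> \<and> (\<forall>x\<in>M.Jspan (carrier M). \<nu> x = \<zero>\<^bsub>k\<^esub>) \<and> m \<in> carrier M \<and> \<nu> m = \<one>\<^bsub>k\<^esub>"
proof -
  obtain m where m: "m \<in> carrier M" "m \<notin> M.Jspan (carrier M)"
    using Jspan_proper M.V.subspaceD(1)[OF M.subspace_Jspan, of "carrier M"] by auto
  then show ?thesis using M.V.functional_exists[OF M.subspace_Jspan, of m "carrier M"] by auto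
qed

lemma functional_act:
  assumes \<nu>: "M.V.functional \<nu>" "\<And>x. x \<in> M.Jspan (carrier M) \<Longrightarrow> \<nu> x = \<zero>\<^bsub>k\<^esub>"
    and c: "c \<in> carrier k" "x \<in> J" "m \<in> carrier M"
  shows "\<nu> ((sc c \<oplus>\<^bsub>A\<^esub> x) \<odot>\<^bsub>M\<^esub> m) = c \<otimes>\<^bsub>k\<^esub> \<nu> m"
proof -
  have "\<nu> (x \<odot>\<^bsub>M\<^esub> m) = \<zero>\<^bsub>k\<^esub>" using \<nu>(2) M.Jspan_mem[OF c(2), of m "carrier M"] c(3) by auto
  moreover have "\<nu> m \<in> carrier k" using \<nu>(1) c(3) by (auto simp: M.V.functional_def)
  ultimately show ?thesis using c \<nu>(1) by (simp add: M.act_add M.V.functional_def)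
qed

text \<open>
  The map \<open>m \<mapsto> \<nu>(m) l\<close> is \<open>A\<close>-linear because \<open>J\<close> kills both \<open>M/JM\<close> and \<open>l\<close>.
\<close>

lemma rank_one_left:
  assumes \<nu>: "M.V.functional \<nu>" "\<And>x. x \<in> M.Jspan (carrier M) \<Longrightarrow> \<nu> x = \<zero>\<^bsub>k\<^esub>" and l: "l \<in> left_soc"
  shows "\<exists>f\<in>carrier N. \<forall>m\<in>carrier M. B f m = \<nu> m \<odot>\<^bsub>A\<^esub> l"
proof (rule all_homs_left)
  have \<nu>c: "\<nu> m \<in> carrier k" if "m \<in> carrier M" for m using \<nu>(1) that by (auto simp: M.V.functional_def)
  have lJ: "l \<in> J" "l \<in> carrier A" using l by (auto simp: left_soc_def)
  show "(\<lambda>m. \<nu> m \<odot>\<^bsub>A\<^esub> l) \<in> carrier M \<rightarrow> J" using \<nu>c lJ J_smult by auto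
  show "\<nu> (x \<oplus>\<^bsub>M\<^esub> y) \<odot>\<^bsub>A\<^esub> l = \<nu> x \<odot>\<^bsub>A\<^esub> l \<oplus>\<^bsub>A\<^esub> \<nu> y \<odot>\<^bsub>A\<^esub> l" if "x \<in> carrier M" "y \<in> carrier M" for x y
    using that \<nu>(1) \<nu>c lJ by (simp add: M.V.functional_def smult_l_distr)
  show "\<nu> (r \<odot>\<^bsub>M\<^esub> m) \<odot>\<^bsub>A\<^esub> l = r \<otimes>\<^bsub>A\<^esub> (\<nu> m \<odot>\<^bsub>A\<^esub> l)" if r: "r \<in> carrier A" and m: "m \<in> carrier M" for r m
  proof -
    obtain c x where c: "c \<in> carrier k" "x \<in> J" "r = sc c \<oplus>\<^bsub>A\<^esub> x" using scalar_plus_J[OF r] by blast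
    have "x \<otimes>\<^bsub>A\<^esub> (\<nu> m \<odot>\<^bsub>A\<^esub> l) = \<zero>\<^bsub>A\<^esub>"
      using l c(2) \<nu>c[OF m] by (simp add: left_soc_def smult_mult_right)
    then have "r \<otimes>\<^bsub>A\<^esub> (\<nu> m \<odot>\<^bsub>A\<^esub> l) = c \<odot>\<^bsub>A\<^esub> (\<nu> m \<odot>\<^bsub>A\<^esub> l)"
      unfolding c(3) using c lJ \<nu>c[OF m] by (simp add: A.l_distr sc_mult)
    then show ?thesis
      using functional_act[OF \<nu> c(1,2) m] c lJ \<nu>c[OF m] by (simp add: smult_assoc1)
  qed
qed

lemma rank_one_right:
  assumes \<nu>: "N.V.functional \<nu>" "\<And>f. f \<in> N.Jspan (carrier N) \<Longrightarrow> \<nu> f = \<zero>\<^bsub>k\<^esub>" and z: "z \<in> right_soc"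
  shows "\<exists>m\<in>carrier M. \<forall>f\<in>carrier N. B f m = \<nu> f \<odot>\<^bsub>A\<^esub> z"
proof -
  interpret op: dual_pair k "opposite A" J N M "\<lambda>m f. B f m" by (rule dual_pair_opposite)
  show ?thesis using op.rank_one_left[OF \<nu>] z by (simp add: soc_opposite)
qed

text \<open>
  So \<open>f \<mapsto> \<mu>(f(m)) z\<close> is one of the maps of rank one on \<open>N\<close>, and therefore an evaluation.
\<close>

lemma evaluation_functional:
  assumes \<mu>: "A.functional \<mu>" "\<And>x. x \<in> J2 \<Longrightarrow> \<mu> x = \<zero>\<^bsub>k\<^esub>" and m: "m \<in> carrier M"
  shows "N.V.functional (\<lambda>f. \<mu> (B f m))" "\<And>f. f \<in> N.Jspan (carrier N) \<Longrightarrow> \<mu> (B f m) = \<zero>\<^bsub>k\<^esub>"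
proof -
  show fn: "N.V.functional (\<lambda>f. \<mu> (B f m))"
    unfolding N.V.functional_def
    using \<mu>(1) m by (auto simp: A.functional_def B_add_left B_act_left sc_mult Pi_iff)
  have "subspace k {f \<in> carrier N. \<mu> (B f m) = \<zero>\<^bsub>k\<^esub>} N.V"
    by (rule N.V.subspace_functional_kernel[OF fn, simplified])
  moreover have "\<mu> (B (r \<odot>\<^bsub>N\<^esub> f) m) = \<zero>\<^bsub>k\<^esub>" if "r \<in> J" "f \<in> carrier N" for r f
    using that m \<mu>(2)[OF J2_mult[OF B_J[OF that(2) m] that(1)]] by (simp add: B_act_left)
  ultimately have "N.Jspan (carrier N) \<subseteq> {f \<in> carrier N. \<mu> (B f m) = \<zero>\<^bsub>k\<^esub>}"
    by (intro N.Jspan_least) auto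
  then show "\<And>f. f \<in> N.Jspan (carrier N) \<Longrightarrow> \<mu> (B f m) = \<zero>\<^bsub>k\<^esub>" by auto
qed

text \<open>
  An endomorphism of the left module \<open>J\<close>; its values outside \<open>J\<close> are arbitrary.
\<close>

definition left_endo :: "('a \<Rightarrow> 'a) \<Rightarrow> bool" where
  "left_endo \<psi> \<longleftrightarrow> \<psi> \<in> J \<rightarrow> J \<and> (\<forall>x\<in>J. \<forall>y\<in>J. \<psi> (x \<oplus>\<^bsub>A\<^esub> y) = \<psi> x \<oplus>\<^bsub>A\<^esub> \<psi> y) \<and>
     (\<forall>r\<in>carrier A. \<forall>x\<in>J. \<psi> (r \<otimes>\<^bsub>A\<^esub> x) = r \<otimes>\<^bsub>A\<^esub> \<psi> x)"

text \<open>
  There are \<open>m'\<close> with \<open>g(m') = \<mu>(g(m)) z\<close> for all \<open>g\<close> and \<open>g\<close> with \<open>g(x) = \<psi>(f(x))\<close> for all \<open>x\<close>. The two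
  sides are the values of \<open>g(m') = \<psi>(f(m'))\<close> computed with either property.
\<close>

lemma left_endo_commutes:
  assumes f: "f \<in> carrier N" and m: "m \<in> carrier M" and \<psi>: "left_endo \<psi>"
    and \<mu>: "A.functional \<mu>" "\<And>x. x \<in> J2 \<Longrightarrow> \<mu> x = \<zero>\<^bsub>k\<^esub>" and z: "z \<in> right_soc"
  shows "\<mu> (B f m) \<odot>\<^bsub>A\<^esub> \<psi> z = \<mu> (\<psi> (B f m)) \<odot>\<^bsub>A\<^esub> z"
proof -
  note p = \<psi>[unfolded left_endo_def]
  have zJ: "z \<in> J" using z by (auto simp: right_soc_def)
  obtain m' where m': "m' \<in> carrier M" "\<And>g. g \<in> carrier N \<Longrightarrow> B g m' = \<mu> (B g m) \<odot>\<^bsub>A\<^esub> z"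
    using rank_one_right[OF evaluation_functional[OF \<mu> m] z] by auto
  have "\<exists>g\<in>carrier N. \<forall>x\<in>carrier M. B g x = \<psi> (B f x)"
    using p f B_J[OF f] by (intro all_homs_left) (auto simp: B_add_right B_act_right)
  then obtain g where g: "g \<in> carrier N" "\<And>x. x \<in> carrier M \<Longrightarrow> B g x = \<psi> (B f x)" by auto
  have c: "\<mu> (B f m) \<in> carrier k" using \<mu>(1) f m by (auto simp: A.functional_def Pi_iff)
  have "\<psi> (B f m') = sc (\<mu> (B f m)) \<otimes>\<^bsub>A\<^esub> \<psi> z"
  proof -
    have "\<mu> (B f m) \<odot>\<^bsub>A\<^esub> z = sc (\<mu> (B f m)) \<otimes>\<^bsub>A\<^esub> z" using sc_mult(1)[OF c] zJ by simp
    moreover have "\<psi> (r \<otimes>\<^bsub>A\<^esub> x) = r \<otimes>\<^bsub>A\<^esub> \<psi> x" if "r \<in> carrier A" "x \<in> J" for r x using p that by blast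
    ultimately show ?thesis using m'(2)[OF f] sc_closed[OF c] zJ by simp
  qed
  also have "\<dots> = \<mu> (B f m) \<odot>\<^bsub>A\<^esub> \<psi> z" using c zJ p by (intro sc_mult) auto
  finally show ?thesis using g(2)[OF m'(1)] m'(2)[OF g(1)] g(2)[OF m] by simp
qed

text \<open>
  Take \<open>\<psi> = \<mu>(-) l\<close> with \<open>\<mu>(l) = 1\<close> and a pair with \<open>f(m) = l\<close>. Then \<open>left_endo_commutes\<close> reads
  \<open>\<mu>(z) l = z\<close> for \<open>z\<close> in the right socle, and the left hand side vanishes for \<open>z \<in> J\<^sup>2\<close>.
\<close>

lemma left_soc_outside_J2:
  assumes l: "l \<in> left_soc" "l \<notin> J2"
  shows "right_soc \<subseteq> line l" "J2 \<subseteq> {\<zero>\<^bsub>A\<^esub>}"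
proof -
  have lJ: "l \<in> J" "l \<in> carrier A" and Jl: "\<And>x. x \<in> J \<Longrightarrow> x \<otimes>\<^bsub>A\<^esub> l = \<zero>\<^bsub>A\<^esub>" using l by (auto simp: left_soc_def)
  obtain \<mu> where \<mu>: "A.functional \<mu>" "\<And>x. x \<in> J2 \<Longrightarrow> \<mu> x = \<zero>\<^bsub>k\<^esub>" "\<mu> l = \<one>\<^bsub>k\<^esub>"
    using A.functional_exists[OF subspace_J2 lJ(2) l(2)] by auto
  have \<mu>c: "\<mu> x \<in> carrier k" if "x \<in> J" for x using \<mu>(1) that by (auto simp: A.functional_def Pi_iff)
  define \<psi> where "\<psi> x = \<mu> x \<odot>\<^bsub>A\<^esub> l" for x
  have "left_endo \<psi>" unfolding left_endo_def
  proof (intro conjI ballI)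
    show "\<psi> \<in> J \<rightarrow> J" using \<mu>c lJ J_smult by (auto simp: \<psi>_def)
    show "\<psi> (x \<oplus>\<^bsub>A\<^esub> y) = \<psi> x \<oplus>\<^bsub>A\<^esub> \<psi> y" if "x \<in> J" "y \<in> J" for x y
      using that \<mu>(1) \<mu>c lJ by (simp add: \<psi>_def A.functional_def smult_l_distr)
    show "\<psi> (r \<otimes>\<^bsub>A\<^esub> x) = r \<otimes>\<^bsub>A\<^esub> \<psi> x" if r: "r \<in> carrier A" and x: "x \<in> J" for r x
    proof -
      obtain c y where c: "c \<in> carrier k" "y \<in> J" "r = sc c \<oplus>\<^bsub>A\<^esub> y" using scalar_plus_J[OF r] by blast
      have "\<mu> (r \<otimes>\<^bsub>A\<^esub> x) = c \<otimes>\<^bsub>k\<^esub> \<mu> x"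
        unfolding c(3) using c x \<mu>(1) \<mu>(2)[OF J2_mult[OF c(2) x]] \<mu>c[OF x]
        by (simp add: A.l_distr sc_mult A.functional_def)
      moreover have "r \<otimes>\<^bsub>A\<^esub> \<psi> x = c \<odot>\<^bsub>A\<^esub> (\<mu> x \<odot>\<^bsub>A\<^esub> l)"
      proof -
        have "y \<otimes>\<^bsub>A\<^esub> (\<mu> x \<odot>\<^bsub>A\<^esub> l) = \<zero>\<^bsub>A\<^esub>" using Jl[OF c(2)] c(2) lJ \<mu>c[OF x] by (simp add: smult_mult_right)
        then show ?thesis unfolding c(3) \<psi>_def using c lJ \<mu>c[OF x] by (simp add: A.l_distr sc_mult)
      qed
      ultimately show ?thesis unfolding \<psi>_def using c lJ \<mu>c[OF x] by (simp add: smult_assoc1)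
    qed
  qed
  moreover obtain \<nu> m where \<nu>: "M.V.functional \<nu>" "\<And>x. x \<in> M.Jspan (carrier M) \<Longrightarrow> \<nu> x = \<zero>\<^bsub>k\<^esub>"
      "m \<in> carrier M" "\<nu> m = \<one>\<^bsub>k\<^esub>" using top_functional by auto
  moreover obtain f where f: "f \<in> carrier N" "\<And>x. x \<in> carrier M \<Longrightarrow> B f x = \<nu> x \<odot>\<^bsub>A\<^esub> l"
    using rank_one_left[OF \<nu>(1,2) l(1)] by auto
  moreover have "B f m = l" using f(2)[OF \<nu>(3)] \<nu>(4) lJ by simp
  ultimately have *: "\<mu> z \<odot>\<^bsub>A\<^esub> l = z" if "z \<in> right_soc" for z
    using left_endo_commutes[OF f(1) \<nu>(3) _ \<mu>(1,2) that, of \<psi>] \<mu>(3) lJ that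
    by (simp add: \<psi>_def right_soc_def \<mu>c)
  show "right_soc \<subseteq> line l"
    using * \<mu>c by (force simp: line_def right_soc_def)
  show "J2 \<subseteq> {\<zero>\<^bsub>A\<^esub>}"
    using * J2_soc(2) \<mu>(2) lJ by force
qed

text \<open>
  An element of the right socle outside \<open>J\<^sup>2\<close> confines the left socle to a line by the mirror image of
  \<open>left_soc_outside_J2\<close>. An element of the left socle outside \<open>J\<^sup>2\<close> confines the right socle, but it
  also forces \<open>J\<^sup>2 = 0\<close>, and then both socles are \<open>J\<close>.
\<close>

lemma socles_eq_J2:
  assumes wide: "\<And>z. z \<in> carrier A \<Longrightarrow> \<not> left_soc \<subseteq> line z"
  shows "left_soc = J2" "right_soc = J2"
proof -
  interpret op: dual_pair k "opposite A" J N M "\<lambda>m f. B f m" by (rule dual_pair_opposite)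
  have L: "l \<in> J2" if l: "l \<in> left_soc" for l
  proof (rule ccontr)
    assume n: "l \<notin> J2"
    have "x \<otimes>\<^bsub>A\<^esub> y = \<zero>\<^bsub>A\<^esub>" if "x \<in> J" "y \<in> J" for x y
      using left_soc_outside_J2(2)[OF l n] J2_mult[OF that] by auto
    then have "left_soc = right_soc" by (auto simp: left_soc_def right_soc_def)
    then show False using wide[of l] left_soc_outside_J2(1)[OF l n] l by (auto simp: left_soc_def)
  qed
  have R: "z \<in> J2" if z: "z \<in> right_soc" for z
  proof (rule ccontr)
    assume "z \<notin> J2"
    then have "left_soc \<subseteq> N.line z"
      using op.left_soc_outside_J2(1)[of z] z by (simp add: soc_opposite J2_opposite)
    moreover have "N.line z = line z" by (simp add: N.line_def line_def)
    ultimately show False using wide[of z] z by (auto simp: right_soc_def)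
  qed
  show "left_soc = J2" "right_soc = J2" using L R J2_soc by auto
qed

end

section \<open>The inequality between the dimensions\<close>

locale dual_pair_soc = dual_pair k A J M N B
  for k :: "'k ring" and A :: "('k, 'a) module" and J :: "'a set"
    and M :: "('a, 'm) module" and N :: "('a, 'n) module" and B :: "'n \<Rightarrow> 'm \<Rightarrow> 'a" +
  assumes left_soc_eq: "left_soc = J2" and right_soc_eq: "right_soc = J2"
begin

lemma dual_pair_soc_opposite: "dual_pair_soc k (opposite A) J N M (\<lambda>m f. B f m)"
  by (intro dual_pair_soc.intro dual_pair_opposite dual_pair_soc_axioms.intro)
    (simp_all add: soc_opposite J2_opposite left_soc_eq right_soc_eq)

text \<open>
  If all values are in \<open>J\<^sup>2\<close>, then \<open>J\<close> annihilates \<open>N\<close>, and every linear form on \<open>N\<close> gives a homomorphism of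
  rank one. For \<open>f = \<nu>(-) w\<close> choose such a form \<open>\<mu>\<close> with \<open>\<mu>(f) = 1\<close>, and let \<open>m\<close> represent \<open>\<mu>(-) z\<close>. Then
  \<open>f(m)\<close> is \<open>z\<close> as well as \<open>\<nu>(m) w\<close>, which is impossible if \<open>z\<close> is not a multiple of \<open>w\<close>.
\<close>

lemma trace_outside_J2:
  assumes wide: "\<And>z. z \<in> carrier A \<Longrightarrow> \<not> J2 \<subseteq> line z"
  shows "\<exists>f\<in>carrier N. \<exists>m\<in>carrier M. B f m \<notin> J2"
proof (rule ccontr)
  assume "\<not> ?thesis"
  then have inJ2: "B f m \<in> J2" if "f \<in> carrier N" "m \<in> carrier M" for f m using that by auto
  obtain w where w: "w \<in> J2" "w \<noteq> \<zero>\<^bsub>A\<^esub>"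
    using wide[of "\<zero>\<^bsub>A\<^esub>"] subspaceD(2)[OF subspace_line[of "\<zero>\<^bsub>A\<^esub>"]] by auto
  have wA: "w \<in> carrier A" using J2_J[OF w(1)] by auto
  obtain z where z: "z \<in> J2" "z \<notin> line w" using wide[OF wA] by auto
  obtain \<nu> m0 where \<nu>: "M.V.functional \<nu>" "\<And>x. x \<in> M.Jspan (carrier M) \<Longrightarrow> \<nu> x = \<zero>\<^bsub>k\<^esub>"
    "m0 \<in> carrier M" "\<nu> m0 = \<one>\<^bsub>k\<^esub>" using top_functional by auto
  obtain f where f: "f \<in> carrier N" "\<And>x. x \<in> carrier M \<Longrightarrow> B f x = \<nu> x \<odot>\<^bsub>A\<^esub> w"
    using rank_one_left[OF \<nu>(1,2) subsetD[OF J2_soc(1) w(1)]] by auto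
  have "r \<odot>\<^bsub>N\<^esub> g = \<zero>\<^bsub>N\<^esub>" if "r \<in> J" "g \<in> carrier N" for r g
  proof (rule nondegenerate_left)
    show "B (r \<odot>\<^bsub>N\<^esub> g) m = \<zero>\<^bsub>A\<^esub>" if "m \<in> carrier M" for m
      using that J2_J_zero[OF \<open>r \<in> J\<close> inJ2[OF \<open>g \<in> carrier N\<close> that]] \<open>r \<in> J\<close> \<open>g \<in> carrier N\<close>
      by (simp add: B_act_left)
  qed (use that in auto)
  then have "N.Jspan (carrier N) \<subseteq> {\<zero>\<^bsub>N\<^esub>}"
    using N.V.subspace_zero by (intro N.Jspan_least) auto
  moreover have "f \<noteq> \<zero>\<^bsub>N\<^esub>" using f(2)[OF \<nu>(3)] \<nu>(3,4) w wA B.zero_left[of m0] by auto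
  then have "f \<notin> {\<zero>\<^bsub>N\<^esub>}" by auto
  then obtain \<mu> where \<mu>: "N.V.functional \<mu>" "\<forall>x\<in>{\<zero>\<^bsub>N\<^esub>}. \<mu> x = \<zero>\<^bsub>k\<^esub>" "\<mu> f = \<one>\<^bsub>k\<^esub>"
    using N.V.functional_exists[OF N.V.subspace_zero, of f] f(1) by auto
  ultimately obtain m where m: "m \<in> carrier M" "\<And>g. g \<in> carrier N \<Longrightarrow> B g m = \<mu> g \<odot>\<^bsub>A\<^esub> z"
    using rank_one_right[OF \<mu>(1), of z] z J2_soc by blast
  have "z = \<nu> m \<odot>\<^bsub>A\<^esub> w" using m(2)[OF f(1)] f(2)[OF m(1)] \<mu>(3) J2_J[OF z(1)] by simp
  moreover have "\<nu> m \<in> carrier k" using \<nu>(1) m(1) by (auto simp: M.V.functional_def Pi_iff)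
  ultimately show False using z(2) by (auto simp: line_def)
qed

lemma left_endo_scalar:
  assumes wide: "\<And>z. z \<in> carrier A \<Longrightarrow> \<not> J2 \<subseteq> line z" and \<psi>: "left_endo \<psi>"
  shows "\<exists>c\<in>carrier k. \<forall>z\<in>J2. \<psi> z = c \<odot>\<^bsub>A\<^esub> z"
proof -
  obtain f m where f: "f \<in> carrier N" "m \<in> carrier M" "B f m \<notin> J2" using trace_outside_J2[OF wide] by auto
  obtain \<mu> where \<mu>: "A.functional \<mu>" "\<And>x. x \<in> J2 \<Longrightarrow> \<mu> x = \<zero>\<^bsub>k\<^esub>" "\<mu> (B f m) = \<one>\<^bsub>k\<^esub>"
    using A.functional_exists[OF subspace_J2 _ f(3)] f(1,2) by auto
  have p: "\<psi> x \<in> J" if "x \<in> J" for x using \<psi> that by (auto simp: left_endo_def)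
  have "\<psi> (B f m) \<in> J" using p B_J f by auto
  then have "\<mu> (\<psi> (B f m)) \<in> carrier k" using \<mu>(1) by (auto simp: A.functional_def Pi_iff)
  moreover have "\<psi> z = \<mu> (\<psi> (B f m)) \<odot>\<^bsub>A\<^esub> z" if "z \<in> J2" for z
    using left_endo_commutes[OF f(1,2) \<psi> \<mu>(1,2), of z] that J2_soc p[OF J2_J[OF that]] \<mu>(3) by auto
  ultimately show ?thesis by blast
qed

lemma Jspan_subset_soc: "M.Jspan (carrier M) \<subseteq> M.soc"
  using Jspan_soc by auto

lemma J2_act_zero:
  assumes "x \<in> J2" "m \<in> carrier M" shows "x \<odot>\<^bsub>M\<^esub> m = \<zero>\<^bsub>M\<^esub>"
proof (rule nondegenerate_right)
  fix f assume "f \<in> carrier N"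
  then show "B f (x \<odot>\<^bsub>M\<^esub> m) = \<zero>\<^bsub>A\<^esub>"
    using assms J2_J_zero[OF B_J assms(1)] J2_J[OF assms(1)] by (simp add: B_act_right)
qed (use assms J2_J[OF assms(1)] in auto)

lemma soc_iff: "m \<in> M.soc \<longleftrightarrow> m \<in> carrier M \<and> (\<forall>f\<in>carrier N. B f m \<in> J2)"
proof
  assume m: "m \<in> M.soc"
  have "B f m \<in> left_soc" if "f \<in> carrier N" for f
    using m that B_J[OF that] B_act_right[symmetric, of _ f m] B.zero_right[of f]
    by (auto simp: left_soc_def M.soc_def)
  then show "m \<in> carrier M \<and> (\<forall>f\<in>carrier N. B f m \<in> J2)" using m left_soc_eq by (auto simp: M.soc_def)
next
  assume m: "m \<in> carrier M \<and> (\<forall>f\<in>carrier N. B f m \<in> J2)"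
  have "r \<odot>\<^bsub>M\<^esub> m = \<zero>\<^bsub>M\<^esub>" if "r \<in> J" for r
    by (rule nondegenerate_right) (use m that J_J2[OF that] in \<open>auto simp: B_act_right\<close>)
  then show "m \<in> M.soc" using m by (auto simp: M.soc_def)
qed

abbreviation dim_M where "dim_M \<equiv> sdim k M.V (carrier M)"
abbreviation dim_N where "dim_N \<equiv> sdim k N.V (carrier N)"
abbreviation soc_M where "soc_M \<equiv> sdim k M.V M.soc"
abbreviation soc_N where "soc_N \<equiv> sdim k N.V N.soc"
abbreviation rad_M where "rad_M \<equiv> sdim k M.V (M.Jspan (carrier M))"
abbreviation rad_N where "rad_N \<equiv> sdim k N.V (N.Jspan (carrier N))"
abbreviation dim_J where "dim_J \<equiv> sdim k A J"
abbreviation dim_J2 where "dim_J2 \<equiv> sdim k A J2"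

text \<open>
  Along a flag from \<open>NJ\<close> to \<open>N\<close>, the part of \<open>soc M\<close> that is killed
  by the members of the flag loses exactly \<open>a\<close> dimensions at each step: if \<open>g\<close> is the vector added
  to \<open>U\<close>, then every \<open>z \<in> J\<^sup>2\<close> is the value at \<open>g\<close> of an evaluation \<open>\<nu>(-) z\<close> with \<open>\<nu>\<close> zero on \<open>U\<close>.
  Therefore \<open>a dim(N/NJ) \<le> dim (soc M)\<close>.
\<close>

lemma socle_lower_bound: "dim_J2 * dim_N \<le> soc_M + dim_J2 * rad_N"
proof -
  define W where "W U = M.soc \<inter> B.annihilator U" for U
  have subW: "subspace k (W U) M.V" if "U \<subseteq> carrier N" for U
    unfolding W_def using that by (intro M.V.subspace_Int M.subspace_soc B.subspace_annihilator) auto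
  have "dim_J2 * sdim k N.V (carrier N.V) + sdim k M.V (W (carrier N.V)) \<le> soc_M + dim_J2 * rad_N"
  proof (rule N.V.subspace_interval_induct[OF N.subspace_Jspan N.V.subspace_carrier])
    show "N.Jspan (carrier N) \<subseteq> carrier N.V" using N.V.subspaceD(1)[OF N.subspace_Jspan] .
    show "dim_J2 * rad_N + sdim k M.V (W (N.Jspan (carrier N))) \<le> soc_M + dim_J2 * rad_N"
      using M.V.sdim_mono(1)[OF subW M.subspace_soc] N.V.subspaceD(1)[OF N.subspace_Jspan]
      by (simp add: W_def)
  next
    fix U g assume U: "subspace k U N.V" "N.Jspan (carrier N) \<subseteq> U" "U \<subseteq> carrier N.V"
      and g: "g \<in> carrier N.V" "g \<notin> U"
      and IH: "dim_J2 * sdim k N.V U + sdim k M.V (W U) \<le> soc_M + dim_J2 * rad_N"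
    have gN: "g \<in> carrier N" using g by simp
    note UN = U(3)[simplified]
    have W': "W (U <+>\<^bsub>N.V\<^esub> N.V.line g) = {m \<in> W U. B g m = \<zero>\<^bsub>A\<^esub>}"
      using B.annihilator_add_line[OF U(1) g(1)] by (auto simp: W_def)
    have "B g ` W U = J2"
    proof
      show "B g ` W U \<subseteq> J2" using gN by (auto simp: W_def soc_iff)
      show "J2 \<subseteq> B g ` W U"
      proof
        fix z assume z: "z \<in> J2"
        obtain \<nu> where \<nu>: "N.V.functional \<nu>" "\<And>x. x \<in> U \<Longrightarrow> \<nu> x = \<zero>\<^bsub>k\<^esub>" "\<nu> g = \<one>\<^bsub>k\<^esub>"
          using N.V.functional_exists[OF U(1) g] by auto
        obtain m where m: "m \<in> carrier M" "\<And>f. f \<in> carrier N \<Longrightarrow> B f m = \<nu> f \<odot>\<^bsub>A\<^esub> z"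
          using rank_one_right[OF \<nu>(1), of z] \<nu>(2) U(2) z J2_soc by blast
        have zA: "z \<in> carrier A" using J2_J[OF z] by auto
        have "\<nu> f \<in> carrier k" if "f \<in> carrier N" for f using \<nu>(1) that by (auto simp: N.V.functional_def Pi_iff)
        then have "m \<in> M.soc" using m z J2_smult by (auto simp: soc_iff)
        moreover have "m \<in> B.annihilator U" using m \<nu>(2) UN zA by (auto simp: B.annihilator_def subset_iff)
        ultimately show "z \<in> B g ` W U" using m(2)[OF gN] \<nu>(3) zA by (force simp: W_def)
      qed
    qed
    moreover have "W U \<subseteq> carrier M" by (auto simp: W_def M.soc_def)
    ultimately have "sdim k M.V (W U) = sdim k M.V (W (U <+>\<^bsub>N.V\<^esub> N.V.line g)) + dim_J2"
      unfolding W'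
      using M.V.rank_nullity_subspace(3)[OF subW[OF UN] vectorspace_axioms, of "B g"] gN
      by (auto simp: B_add_right B_act_right sc_mult subset_iff Pi_iff)
    moreover have "sdim k N.V (U <+>\<^bsub>N.V\<^esub> N.V.line g) = Suc (sdim k N.V U)"
      by (rule N.V.sdim_add_line(2)[OF U(1) g])
    ultimately show "dim_J2 * sdim k N.V (U <+>\<^bsub>N.V\<^esub> N.V.line g) + sdim k M.V (W (U <+>\<^bsub>N.V\<^esub> N.V.line g))
        \<le> soc_M + dim_J2 * rad_N"
      using IH by simp
  qed
  then show ?thesis by simp
qed

definition orbit :: "'m \<Rightarrow> 'm set" where "orbit m = (\<lambda>x. x \<odot>\<^bsub>M\<^esub> m) ` J"

lemma orbit:
  assumes m: "m \<in> carrier M"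
  shows "subspace k (orbit m) M.V" "subspace k {x \<in> J. x \<odot>\<^bsub>M\<^esub> m = \<zero>\<^bsub>M\<^esub>} A"
    "J2 \<subseteq> {x \<in> J. x \<odot>\<^bsub>M\<^esub> m = \<zero>\<^bsub>M\<^esub>}"
    "dim_J = sdim k A {x \<in> J. x \<odot>\<^bsub>M\<^esub> m = \<zero>\<^bsub>M\<^esub>} + sdim k M.V (orbit m)"
proof -
  note rn = A.rank_nullity_subspace[OF subspace_J M.vectorspace_V, of "\<lambda>x. x \<odot>\<^bsub>M\<^esub> m"]
  have 1: "(\<lambda>x. x \<odot>\<^bsub>M\<^esub> m) \<in> J \<rightarrow> carrier M.V" using m by auto
  have 2: "(x \<oplus>\<^bsub>A\<^esub> y) \<odot>\<^bsub>M\<^esub> m = x \<odot>\<^bsub>M\<^esub> m \<oplus>\<^bsub>M.V\<^esub> y \<odot>\<^bsub>M\<^esub> m" if "x \<in> J" "y \<in> J" for x y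
    using that m by (simp add: M.act_add)
  have 3: "(c \<odot>\<^bsub>A\<^esub> x) \<odot>\<^bsub>M\<^esub> m = c \<odot>\<^bsub>M.V\<^esub> (x \<odot>\<^bsub>M\<^esub> m)" if "c \<in> carrier k" "x \<in> J" for c x
    using M.smult_V[OF that(1) J_carrier[OF that(2)] m] by simp
  show "subspace k (orbit m) M.V" "subspace k {x \<in> J. x \<odot>\<^bsub>M\<^esub> m = \<zero>\<^bsub>M\<^esub>} A"
    "dim_J = sdim k A {x \<in> J. x \<odot>\<^bsub>M\<^esub> m = \<zero>\<^bsub>M\<^esub>} + sdim k M.V (orbit m)"
    using rn[OF 1 2 3] by (simp_all add: orbit_def)
  show "J2 \<subseteq> {x \<in> J. x \<odot>\<^bsub>M\<^esub> m = \<zero>\<^bsub>M\<^esub>}" using J2_act_zero m J2_subset by auto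
qed

lemma orbit_dim: "m \<in> carrier M \<Longrightarrow> sdim k M.V (orbit m) + dim_J2 \<le> dim_J"
  using orbit(4)[of m] A.sdim_mono(1)[OF subspace_J2 orbit(2,3)[of m]] by simp

lemma J2_le_J: "dim_J2 \<le> dim_J"
  by (rule A.sdim_mono(1)[OF subspace_J2 subspace_J J2_subset])

lemma Jspan_add_line:
  assumes U: "subspace k U M.V" and m: "m \<in> carrier M"
  shows "M.Jspan (U <+>\<^bsub>M.V\<^esub> M.V.line m) \<subseteq> M.Jspan U <+>\<^bsub>M.V\<^esub> orbit m"
proof (rule M.Jspan_least)
  note S = M.V.subspace_set_add[OF M.subspace_Jspan orbit(1)[OF m]]
  show "subspace k (M.Jspan U <+>\<^bsub>M.V\<^esub> orbit m) M.V" by (rule S)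
  fix r u assume r: "r \<in> J" and "u \<in> U <+>\<^bsub>M.V\<^esub> M.V.line m"
  then obtain y c where y: "y \<in> U" "c \<in> carrier k" "u = y \<oplus>\<^bsub>M\<^esub> sc c \<odot>\<^bsub>M\<^esub> m"
    by (auto simp: M.V.in_set_add M.V.line_def)
  have yM: "y \<in> carrier M" using y(1) M.V.subspaceD(1)[OF U] by auto
  have "r \<odot>\<^bsub>M\<^esub> u = r \<odot>\<^bsub>M\<^esub> y \<oplus>\<^bsub>M\<^esub> (c \<odot>\<^bsub>A\<^esub> r) \<odot>\<^bsub>M\<^esub> m"
    unfolding y(3) M.smult_V[OF y(2) J_carrier[OF r] m]
    using r yM y(2) m by (simp add: M.act_add_right M.act_sc_commute)
  moreover have "r \<odot>\<^bsub>M\<^esub> y \<in> M.Jspan U" by (rule M.Jspan_mem[OF r y(1) yM])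
  moreover have "(c \<odot>\<^bsub>A\<^esub> r) \<odot>\<^bsub>M\<^esub> m \<in> orbit m" using J_smult[OF y(2) r] by (auto simp: orbit_def)
  ultimately show "r \<odot>\<^bsub>M\<^esub> u \<in> M.Jspan U <+>\<^bsub>M.V\<^esub> orbit m"
    by (auto simp: M.V.in_set_add)
qed

text \<open>
  Each vector \<open>v\<close> added to \<open>U\<close> enlarges \<open>JU\<close> by at most \<open>Jv\<close>, which is an image of \<open>J/J\<^sup>2\<close>. Therefore
  \<open>dim (JU) \<le> e dim(U/soc M)\<close>.
\<close>

lemma Jspan_upper_bound:
  assumes U: "subspace k U M.V" "M.soc \<subseteq> U"
  shows "sdim k M.V (M.Jspan U) + (dim_J - dim_J2) * soc_M \<le> (dim_J - dim_J2) * sdim k M.V U"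
proof (rule M.V.subspace_interval_induct[OF M.subspace_soc U])
  have "M.Jspan M.soc \<subseteq> {\<zero>\<^bsub>M\<^esub>}"
    using M.V.subspace_zero by (intro M.Jspan_least) (auto simp: M.soc_def)
  then have "sdim k M.V (M.Jspan M.soc) \<le> 0"
    using M.V.sdim_mono(1)[OF M.subspace_Jspan M.V.subspace_zero, of M.soc] M.V.sdim_zero by simp
  then show "sdim k M.V (M.Jspan M.soc) + (dim_J - dim_J2) * soc_M \<le> (dim_J - dim_J2) * soc_M" by simp
next
  fix W v assume W: "subspace k W M.V" "M.soc \<subseteq> W" "W \<subseteq> U" and v: "v \<in> U" "v \<notin> W"
    and IH: "sdim k M.V (M.Jspan W) + (dim_J - dim_J2) * soc_M \<le> (dim_J - dim_J2) * sdim k M.V W"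
  have vM: "v \<in> carrier M" using v M.V.subspaceD(1)[OF U(1)] by auto
  note S = M.V.subspace_set_add[OF M.subspace_Jspan orbit(1)[OF vM]]
  have "sdim k M.V (M.Jspan (W <+>\<^bsub>M.V\<^esub> M.V.line v)) \<le> sdim k M.V (M.Jspan W <+>\<^bsub>M.V\<^esub> orbit v)"
    by (rule M.V.sdim_mono(1)[OF M.subspace_Jspan S Jspan_add_line[OF W(1) vM]])
  also have "\<dots> \<le> sdim k M.V (M.Jspan W) + sdim k M.V (orbit v)"
    using M.V.sdim_set_add[OF M.subspace_Jspan orbit(1)[OF vM], of W] by simp
  also have "\<dots> \<le> sdim k M.V (M.Jspan W) + (dim_J - dim_J2)" using orbit_dim[OF vM] by simp
  finally show "sdim k M.V (M.Jspan (W <+>\<^bsub>M.V\<^esub> M.V.line v)) + (dim_J - dim_J2) * soc_M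
      \<le> (dim_J - dim_J2) * sdim k M.V (W <+>\<^bsub>M.V\<^esub> M.V.line v)"
    using IH M.V.sdim_add_line(2)[OF W(1), of v] vM v(2) by simp
qed

text \<open>
  The first entry \<open>e\<close> of the Hilbert type.
\<close>

abbreviation edim where "edim \<equiv> dim_J - dim_J2"

text \<open>
  This is the extremal case \<open>soc M = JM\<close>, \<open>dim (JM) = e dim(M/JM)\<close>. For the hyperplane \<open>H\<close> with equation \<open>\<nu> = 0\<close> the
  bound for \<open>JH\<close> leaves no slack in \<open>JM = JH + Jm\<close>: the sum is direct, and \<open>Jm\<close> has dimension \<open>e\<close>, so
  that only elements of \<open>J\<^sup>2\<close> kill \<open>m\<close>. Hence \<open>m\<close> behaves like a member of a basis over \<open>A/J\<^sup>2\<close>, and its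
  image in \<open>J\<close> can be prescribed.
\<close>

lemma extremal_module_is_free:
  assumes JM: "M.Jspan (carrier M) = M.soc" and extremal: "edim * (dim_M - rad_M) \<le> rad_M"
    and \<nu>: "M.V.functional \<nu>" "\<And>y. y \<in> M.Jspan (carrier M) \<Longrightarrow> \<nu> y = \<zero>\<^bsub>k\<^esub>"
    and m: "m \<in> carrier M" "\<nu> m = \<one>\<^bsub>k\<^esub>" and x: "x \<in> J"
  shows "\<exists>f\<in>carrier N. B f m = x \<and> (\<forall>y\<in>carrier M. \<nu> y = \<zero>\<^bsub>k\<^esub> \<longrightarrow> B f y \<in> J2)"
proof -
  have \<nu>c: "\<nu> y \<in> carrier k" if "y \<in> carrier M" for y using \<nu>(1) that by (auto simp: M.V.functional_def Pi_iff)
  have \<nu>_add: "\<nu> (y \<oplus>\<^bsub>M\<^esub> y') = \<nu> y \<oplus>\<^bsub>k\<^esub> \<nu> y'" if "y \<in> carrier M" "y' \<in> carrier M" for y y'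
    using \<nu>(1) that by (auto simp: M.V.functional_def)
  have \<nu>_smult: "\<nu> (sc c \<odot>\<^bsub>M\<^esub> y) = c \<otimes>\<^bsub>k\<^esub> \<nu> y" if "c \<in> carrier k" "y \<in> carrier M" for c y
    using \<nu>(1) that by (auto simp: M.V.functional_def)
  have Jm: "w \<odot>\<^bsub>M\<^esub> y \<in> M.Jspan (carrier M)" if "w \<in> J" "y \<in> carrier M" for w y
    using M.Jspan_mem[OF that(1) that(2) that(2)] .
  have \<nu>J: "\<nu> (w \<odot>\<^bsub>M\<^esub> y) = \<zero>\<^bsub>k\<^esub>" if "w \<in> J" "y \<in> carrier M" for w y
    using \<nu>(2)[OF Jm[OF that]] .
  define H where "H = {y \<in> carrier M. \<nu> y = \<zero>\<^bsub>k\<^esub>}"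
  have H: "subspace k H M.V" unfolding H_def using M.V.subspace_functional_kernel[OF \<nu>(1)] by simp
  have HM: "H \<subseteq> carrier M" by (auto simp: H_def)
  have mH: "m \<notin> H" using m by (auto simp: H_def)
  have socH: "M.soc \<subseteq> H" using \<nu>(2) M.V.subspaceD(1)[OF M.subspace_Jspan, of "carrier M"] by (auto simp: JM[symmetric] H_def)
  have split: "\<exists>y0\<in>H. y = y0 \<oplus>\<^bsub>M\<^esub> sc (\<nu> y) \<odot>\<^bsub>M\<^esub> m" if y: "y \<in> carrier M" for y
  proof -
    let ?c = "\<nu> y"
    define y0 where "y0 = y \<oplus>\<^bsub>M\<^esub> sc (\<ominus>\<^bsub>k\<^esub> ?c) \<odot>\<^bsub>M\<^esub> m"
    note c = \<nu>c[OF y]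
    have "sc (\<ominus>\<^bsub>k\<^esub> ?c) \<odot>\<^bsub>M\<^esub> m \<oplus>\<^bsub>M\<^esub> sc ?c \<odot>\<^bsub>M\<^esub> m = \<zero>\<^bsub>M\<^esub>"
      using m(1) c by (simp add: M.act_add[symmetric] sc_hom(1)[symmetric] R.l_neg)
    then have "y = y0 \<oplus>\<^bsub>M\<^esub> sc ?c \<odot>\<^bsub>M\<^esub> m" unfolding y0_def using y m(1) c M.V.M.a_assoc by simp
    moreover have "y0 \<in> H"
      unfolding H_def y0_def using y m c by (simp add: \<nu>_add \<nu>_smult R.r_neg)
    ultimately show ?thesis by blast
  qed
  have M_dec: "H <+>\<^bsub>M.V\<^esub> M.V.line m = carrier M"
  proof
    show "H <+>\<^bsub>M.V\<^esub> M.V.line m \<subseteq> carrier M"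
      using M.V.subspaceD(1)[OF M.V.subspace_set_add[OF H M.V.subspace_line[of m]]] m(1) by simp
    show "carrier M \<subseteq> H <+>\<^bsub>M.V\<^esub> M.V.line m"
      using split \<nu>c by (force simp: M.V.in_set_add M.V.line_def)
  qed
  have dimH: "dim_M = Suc (sdim k M.V H)"
    using M.V.sdim_add_line(2)[OF H, of m] m(1) mH M_dec by simp
  note O = orbit[OF m(1)]
  note JH = M.subspace_Jspan[of H]
  have JM_sub: "M.Jspan (carrier M) \<subseteq> M.Jspan H <+>\<^bsub>M.V\<^esub> orbit m"
    using Jspan_add_line[OF H m(1)] M_dec by simp
  have 1: "rad_M \<le> sdim k M.V (M.Jspan H <+>\<^bsub>M.V\<^esub> orbit m)"
    by (rule M.V.sdim_mono(1)[OF M.subspace_Jspan M.V.subspace_set_add[OF JH O(1)] JM_sub])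
  have 2: "sdim k M.V (M.Jspan H <+>\<^bsub>M.V\<^esub> orbit m) + sdim k M.V (M.Jspan H \<inter> orbit m)
      = sdim k M.V (M.Jspan H) + sdim k M.V (orbit m)"
    by (rule M.V.sdim_set_add[OF JH O(1)])
  have 3: "sdim k M.V (M.Jspan H) + edim * rad_M \<le> edim * sdim k M.V H"
    using Jspan_upper_bound[OF H socH] JM by simp
  have 4: "sdim k M.V (orbit m) + dim_J2 \<le> dim_J" by (rule orbit_dim[OF m(1)])
  have le: "rad_M \<le> dim_M"
    using M.V.sdim_mono(1)[OF M.subspace_Jspan M.V.subspace_carrier] M.V.subspaceD(1)[OF M.subspace_Jspan] by simp
  have "edim * dim_M \<le> rad_M + edim * rad_M" using extremal le by (simp add: diff_mult_distrib2)
  then have "sdim k M.V (M.Jspan H) + edim \<le> rad_M" using 3 dimH by simp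
  then have "sdim k M.V (M.Jspan H \<inter> orbit m) = 0" and orb: "sdim k M.V (orbit m) + dim_J2 = dim_J"
    using 1 2 4 by simp_all
  then have disj: "M.Jspan H \<inter> orbit m = {\<zero>\<^bsub>M\<^esub>}"
    using M.V.sdim_eq_0[OF M.V.subspace_Int[OF JH O(1)]] by simp
  have ker: "{w \<in> J. w \<odot>\<^bsub>M\<^esub> m = \<zero>\<^bsub>M\<^esub>} = J2"
    using A.sdim_mono(2)[OF subspace_J2 O(2,3)] O(4) orb by simp
  \<comment> \<open>The homomorphism is \<open>y \<mapsto> G(y) + \<nu>(y) x\<close>, where \<open>G\<close> projects to \<open>Jm\<close>, killing \<open>JH\<close>
    and \<open>m\<close>, and then sends \<open>v m\<close> to \<open>v x\<close>.\<close>
  let ?P = "M.Jspan H <+>\<^bsub>M.V\<^esub> M.V.line m"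
  have P: "subspace k ?P M.V" using M.V.subspace_set_add[OF JH M.V.subspace_line[of m]] m(1) by simp
  have JHM: "M.Jspan H \<subseteq> M.Jspan (carrier M)"
    by (rule M.Jspan_least[OF M.subspace_Jspan]) (use Jm HM in auto)
  have "y = \<zero>\<^bsub>M\<^esub>" if y: "y \<in> ?P" "y \<in> orbit m" for y
  proof -
    obtain z c where z: "z \<in> M.Jspan H" "c \<in> carrier k" "y = z \<oplus>\<^bsub>M\<^esub> sc c \<odot>\<^bsub>M\<^esub> m"
      using y(1) by (auto simp: M.V.in_set_add M.V.line_def)
    have zM: "z \<in> carrier M" using z(1) M.V.subspaceD(1)[OF JH] by auto
    have "\<nu> z = \<zero>\<^bsub>k\<^esub>" using z(1) JHM \<nu>(2) by auto
    then have "\<nu> y = c" unfolding z(3) using zM z(2) m by (simp add: \<nu>_add \<nu>_smult)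
    moreover have "\<nu> y = \<zero>\<^bsub>k\<^esub>" using y(2) \<nu>J m(1) by (auto simp: orbit_def)
    ultimately have "y = z" using z zM m(1) by simp
    then show ?thesis using z(1) y(2) disj by auto
  qed
  moreover have "\<zero>\<^bsub>M\<^esub> \<in> ?P" "\<zero>\<^bsub>M\<^esub> \<in> orbit m"
    using M.V.subspaceD(2)[OF P] M.V.subspaceD(2)[OF O(1)] by simp_all
  ultimately have "?P \<inter> orbit m = {\<zero>\<^bsub>M\<^esub>}" by blast
  then have disj': "?P \<inter> orbit m = {\<zero>\<^bsub>M.V\<^esub>}" by simp
  obtain \<pi> where \<pi>: "\<pi> \<in> carrier M.V \<rightarrow> orbit m"
    "\<And>y z. y \<in> carrier M.V \<Longrightarrow> z \<in> carrier M.V \<Longrightarrow> \<pi> (y \<oplus>\<^bsub>M.V\<^esub> z) = \<pi> y \<oplus>\<^bsub>M.V\<^esub> \<pi> z"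
    "\<And>c y. c \<in> carrier k \<Longrightarrow> y \<in> carrier M.V \<Longrightarrow> \<pi> (c \<odot>\<^bsub>M.V\<^esub> y) = c \<odot>\<^bsub>M.V\<^esub> \<pi> y"
    "\<And>y. y \<in> ?P \<Longrightarrow> \<pi> y = \<zero>\<^bsub>M.V\<^esub>" "\<And>y. y \<in> orbit m \<Longrightarrow> \<pi> y = y"
    by (rule M.V.projection_exists[OF P O(1) disj']) (rule that)
  have "\<exists>w\<in>J. \<pi> y = w \<odot>\<^bsub>M\<^esub> m" if "y \<in> carrier M" for y
    using funcset_mem[OF \<pi>(1), of y] that by (auto simp: orbit_def)
  then obtain w where w: "\<And>y. y \<in> carrier M \<Longrightarrow> w y \<in> J" "\<And>y. y \<in> carrier M \<Longrightarrow> \<pi> y = w y \<odot>\<^bsub>M\<^esub> m" by metis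
  define G where "G y = w y \<otimes>\<^bsub>A\<^esub> x" for y
  have xA: "x \<in> carrier A" using x by auto
  \<comment> \<open>The choice of the coefficient \<open>w y\<close> does not matter, as it is unique modulo \<open>J\<^sup>2\<close>.\<close>
  have GI: "G y = v \<otimes>\<^bsub>A\<^esub> x" if y: "y \<in> carrier M" and v: "v \<in> J" "\<pi> y = v \<odot>\<^bsub>M\<^esub> m" for y v
  proof -
    let ?d = "v \<ominus>\<^bsub>A\<^esub> w y"
    note wy = w(1)[OF y]
    have d: "?d \<in> J" using v(1) wy by (simp add: a_minus_def J_add J_neg)
    have v_eq: "v = w y \<oplus>\<^bsub>A\<^esub> ?d"
      using J_carrier[OF v(1)] J_carrier[OF wy]
      by (simp add: a_minus_def module.M.a_lcomm[of "w y" v] module.M.r_neg)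
    have "w y \<odot>\<^bsub>M\<^esub> m = w y \<odot>\<^bsub>M\<^esub> m \<oplus>\<^bsub>M\<^esub> ?d \<odot>\<^bsub>M\<^esub> m"
      using v(2) w(2)[OF y] M.act_add[of "w y" ?d m] v_eq wy d m(1) by auto
    then have "?d \<odot>\<^bsub>M\<^esub> m = \<zero>\<^bsub>M\<^esub>"
      using M.V.M.add.r_cancel_one'[of "w y \<odot>\<^bsub>M\<^esub> m" "?d \<odot>\<^bsub>M\<^esub> m"] wy d m(1) by simp
    then have "?d \<in> J2" using ker d by auto
    then have "?d \<otimes>\<^bsub>A\<^esub> x = \<zero>\<^bsub>A\<^esub>" using J2_J_zero[OF x] by auto
    then show ?thesis
      using A.l_distr[of "w y" ?d x] v_eq wy d xA by (simp add: G_def)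
  qed
  have GJ2: "G y \<in> J2" if "y \<in> carrier M" for y using J2_mult[OF w(1)[OF that] x] by (simp add: G_def)
  define h where "h y = G y \<oplus>\<^bsub>A\<^esub> \<nu> y \<odot>\<^bsub>A\<^esub> x" for y
  have "\<exists>f\<in>carrier N. \<forall>y\<in>carrier M. B f y = h y"
  proof (rule all_homs_left)
    show "h \<in> carrier M \<rightarrow> J" using GJ2 J2_J x \<nu>c by (auto simp: h_def intro!: J_add J_smult)
    have G_add: "G (y \<oplus>\<^bsub>M\<^esub> z) = G y \<oplus>\<^bsub>A\<^esub> G z" if "y \<in> carrier M" "z \<in> carrier M" for y z
    proof -
      have "G (y \<oplus>\<^bsub>M\<^esub> z) = (w y \<oplus>\<^bsub>A\<^esub> w z) \<otimes>\<^bsub>A\<^esub> x"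
        using that w \<pi>(2)[of y z] m(1) by (intro GI) (auto simp: J_add M.act_add M.V.M.a_closed[simplified])
      then show ?thesis using that w xA by (simp add: G_def A.l_distr)
    qed
    then show "h (y \<oplus>\<^bsub>M\<^esub> z) = h y \<oplus>\<^bsub>A\<^esub> h z" if "y \<in> carrier M" "z \<in> carrier M" for y z
      using that GJ2[OF that(1)] GJ2[OF that(2)] J2_J \<nu>c xA
      by (simp add: h_def \<nu>_add smult_l_distr module.M.a_ac)
    fix r y assume r: "r \<in> carrier A" and y: "y \<in> carrier M"
    obtain c v where c: "c \<in> carrier k" "v \<in> J" "r = sc c \<oplus>\<^bsub>A\<^esub> v" using scalar_plus_J[OF r] by blast
    obtain y0 where y0: "y0 \<in> H" "y = y0 \<oplus>\<^bsub>M\<^esub> sc (\<nu> y) \<odot>\<^bsub>M\<^esub> m" using split[OF y] by auto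
    have y0M: "y0 \<in> carrier M" using y0(1) HM by auto
    have "\<pi> (v \<odot>\<^bsub>M\<^esub> y) = \<pi> (v \<odot>\<^bsub>M\<^esub> y0) \<oplus>\<^bsub>M\<^esub> sc (\<nu> y) \<odot>\<^bsub>M\<^esub> \<pi> (v \<odot>\<^bsub>M\<^esub> m)"
    proof -
      have "v \<odot>\<^bsub>M\<^esub> y = v \<odot>\<^bsub>M\<^esub> y0 \<oplus>\<^bsub>M\<^esub> sc (\<nu> y) \<odot>\<^bsub>M\<^esub> (v \<odot>\<^bsub>M\<^esub> m)"
        using arg_cong[OF y0(2), of "\<lambda>u. v \<odot>\<^bsub>M\<^esub> u"] c(2) y0M m(1) \<nu>c[OF y]
        by (simp add: M.act_add_right M.act_sc_commute)
      then show ?thesis using \<pi>(2)[of "v \<odot>\<^bsub>M\<^esub> y0" "sc (\<nu> y) \<odot>\<^bsub>M\<^esub> (v \<odot>\<^bsub>M\<^esub> m)"]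
          \<pi>(3)[of "\<nu> y" "v \<odot>\<^bsub>M\<^esub> m"] c(2) y0M m(1) \<nu>c[OF y] by simp
    qed
    moreover have "\<pi> (v \<odot>\<^bsub>M\<^esub> y0) = \<zero>\<^bsub>M\<^esub>"
      using \<pi>(4)[of "v \<odot>\<^bsub>M\<^esub> y0"] M.Jspan_mem[OF c(2) y0(1) y0M]
        M.V.set_add_upper(1)[OF JH M.V.subspace_line[of m]] m(1) by auto
    moreover have "\<pi> (v \<odot>\<^bsub>M\<^esub> m) = v \<odot>\<^bsub>M\<^esub> m" using \<pi>(5) c(2) by (auto simp: orbit_def)
    ultimately have "\<pi> (v \<odot>\<^bsub>M\<^esub> y) = sc (\<nu> y) \<odot>\<^bsub>M\<^esub> (v \<odot>\<^bsub>M\<^esub> m)"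
      using c(2) m(1) \<nu>c[OF y] by simp
    then have "\<pi> (v \<odot>\<^bsub>M\<^esub> y) = (\<nu> y \<odot>\<^bsub>A\<^esub> v) \<odot>\<^bsub>M\<^esub> m"
      using M.smult_V[OF \<nu>c[OF y] J_carrier[OF c(2)] m(1)] by simp
    then have Gv: "G (v \<odot>\<^bsub>M\<^esub> y) = \<nu> y \<odot>\<^bsub>A\<^esub> (v \<otimes>\<^bsub>A\<^esub> x)"
      using GI[of "v \<odot>\<^bsub>M\<^esub> y" "\<nu> y \<odot>\<^bsub>A\<^esub> v"] c(2) y \<nu>c[OF y] xA by (simp add: J_smult smult_mult_left)
    have "\<pi> (sc c \<odot>\<^bsub>M\<^esub> y) = (c \<odot>\<^bsub>A\<^esub> w y) \<odot>\<^bsub>M\<^esub> m"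
      using \<pi>(3)[of c y] w[OF y] c(1) y M.smult_V[OF c(1) J_carrier[OF w(1)[OF y]] m(1)] by simp
    then have Gc: "G (sc c \<odot>\<^bsub>M\<^esub> y) = c \<odot>\<^bsub>A\<^esub> G y"
      using GI[of "sc c \<odot>\<^bsub>M\<^esub> y" "c \<odot>\<^bsub>A\<^esub> w y"] c(1) y w(1)[OF y] xA by (simp add: J_smult smult_mult_left G_def)
    have ry: "r \<odot>\<^bsub>M\<^esub> y = sc c \<odot>\<^bsub>M\<^esub> y \<oplus>\<^bsub>M\<^esub> v \<odot>\<^bsub>M\<^esub> y" unfolding c(3) using c y by (simp add: M.act_add)
    have GA: "G y \<in> carrier A" using GJ2[OF y] J2_J by auto
    have "h (r \<odot>\<^bsub>M\<^esub> y) = (c \<odot>\<^bsub>A\<^esub> G y \<oplus>\<^bsub>A\<^esub> \<nu> y \<odot>\<^bsub>A\<^esub> (v \<otimes>\<^bsub>A\<^esub> x)) \<oplus>\<^bsub>A\<^esub> c \<odot>\<^bsub>A\<^esub> (\<nu> y \<odot>\<^bsub>A\<^esub> x)"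
      unfolding h_def ry using c y \<nu>c[OF y] xA by (simp add: G_add Gc Gv \<nu>_add \<nu>_smult \<nu>J smult_assoc1)
    moreover have "v \<otimes>\<^bsub>A\<^esub> h y = \<nu> y \<odot>\<^bsub>A\<^esub> (v \<otimes>\<^bsub>A\<^esub> x)"
      unfolding h_def using c(2) GA J_J2[OF c(2) GJ2[OF y]] xA \<nu>c[OF y]
      by (simp add: A.r_distr smult_mult_right)
    moreover have "sc c \<otimes>\<^bsub>A\<^esub> h y = c \<odot>\<^bsub>A\<^esub> G y \<oplus>\<^bsub>A\<^esub> c \<odot>\<^bsub>A\<^esub> (\<nu> y \<odot>\<^bsub>A\<^esub> x)"
      unfolding h_def using c(1) GA xA \<nu>c[OF y] by (simp add: sc_mult(1) smult_r_distr)
    moreover have "h y \<in> carrier A" unfolding h_def using GA xA \<nu>c[OF y] by simp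
    ultimately show "h (r \<odot>\<^bsub>M\<^esub> y) = r \<otimes>\<^bsub>A\<^esub> h y"
      unfolding c(3) using c GA xA \<nu>c[OF y] by (simp add: A.l_distr module.M.a_ac)
  qed
  then obtain f where f: "f \<in> carrier N" "\<And>y. y \<in> carrier M \<Longrightarrow> B f y = h y" by auto
  have "m \<in> ?P" using M.V.set_add_upper(2)[OF JH M.V.subspace_line[of m]] M.V.mem_line[of m] m(1) by auto
  then have "G m = \<zero>\<^bsub>A\<^esub>" using \<pi>(4)[of m] GI[of m "\<zero>\<^bsub>A\<^esub>"] m(1) J_zero xA by simp
  then have "B f m = x" using f(2)[OF m(1)] m xA by (simp add: h_def)
  moreover have "B f y \<in> J2" if "y \<in> carrier M" "\<nu> y = \<zero>\<^bsub>k\<^esub>" for y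
    using f(2)[OF that(1)] that GJ2[OF that(1)] J2_J xA by (simp add: h_def)
  ultimately show ?thesis using f(1) by blast
qed

text \<open>
  The homomorphisms that map a given subspace of \<open>M\<close> into \<open>J\<^sup>2\<close> lose exactly \<open>e\<close> dimensions whenever a
  vector \<open>v\<close> is added to the subspace, since the image of \<open>v\<close> modulo \<open>J\<^sup>2\<close> can be prescribed. For the
  subspace \<open>M\<close> itself they contain the socle of \<open>N\<close>.
\<close>

lemma extremal_bound:
  assumes JM: "M.Jspan (carrier M) = M.soc" and extremal: "edim * (dim_M - rad_M) \<le> rad_M"
  shows "soc_N + edim * dim_M \<le> dim_N + edim * rad_M"
proof -
  define F where "F U = {f \<in> carrier N. \<forall>u\<in>U. B f u \<in> J2}" for U
  have sF: "subspace k (F U) N.V" if "U \<subseteq> carrier M" for U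
    unfolding F_def using that
    by (intro N.V.subspaceI)
      (auto simp: B_add_left B_act_left sc_mult J2_add J2_smult J2_zero subset_iff B.zero_left[simplified])
  have "sdim k N.V (F (carrier M.V)) + edim * sdim k M.V (carrier M.V) \<le> dim_N + edim * rad_M"
  proof (rule M.V.subspace_interval_induct[OF M.subspace_Jspan M.V.subspace_carrier])
    show JMc: "M.Jspan (carrier M) \<subseteq> carrier M.V" using M.V.subspaceD(1)[OF M.subspace_Jspan] .
    then show "sdim k N.V (F (M.Jspan (carrier M))) + edim * rad_M \<le> dim_N + edim * rad_M"
      using N.V.sdim_mono(1)[OF sF N.V.subspace_carrier] by (simp add: F_def)
  next
    fix U v assume U: "subspace k U M.V" "M.Jspan (carrier M) \<subseteq> U" "U \<subseteq> carrier M.V"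
      and v: "v \<in> carrier M.V" "v \<notin> U"
      and IH: "sdim k N.V (F U) + edim * sdim k M.V U \<le> dim_N + edim * rad_M"
    let ?U = "U <+>\<^bsub>M.V\<^esub> M.V.line v"
    have vM: "v \<in> carrier M" and UM: "U \<subseteq> carrier M" using v U(3) by simp_all
    note U' = M.V.sdim_add_line[OF U(1) v]
    have UM': "?U \<subseteq> carrier M" using M.V.subspaceD(1)[OF U'(1)] by simp
    obtain \<nu> where \<nu>: "M.V.functional \<nu>" "\<And>y. y \<in> U \<Longrightarrow> \<nu> y = \<zero>\<^bsub>k\<^esub>" "\<nu> v = \<one>\<^bsub>k\<^esub>"
      using M.V.functional_exists[OF U(1) v] by auto
    have free: "\<exists>f\<in>F U. B f v = x" if "x \<in> J" for x
      using extremal_module_is_free[OF JM extremal \<nu>(1) _ vM \<nu>(3) that] \<nu>(2) U(2) UM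
      by (fastforce simp: F_def)
    have FU': "F ?U = {f \<in> F U. B f v \<in> J2}"
    proof
      show "F ?U \<subseteq> {f \<in> F U. B f v \<in> J2}" using U'(3,4) by (auto simp: F_def)
      show "{f \<in> F U. B f v \<in> J2} \<subseteq> F ?U"
        using UM vM J2_add J2_smult
        by (auto simp: F_def M.V.in_set_add M.V.line_def B_add_right B_act_right sc_mult subset_iff)
    qed
    let ?K = "{f \<in> F U. B f v = \<zero>\<^bsub>A\<^esub>}"
    have "(\<lambda>f. B f v) ` F U = J"
      using free B_J[OF _ vM] by (force simp: F_def)
    then have 1: "sdim k N.V (F U) = sdim k N.V ?K + dim_J"
      using N.V.rank_nullity_subspace(3)[OF sF[OF UM] vectorspace_axioms, of "\<lambda>f. B f v"] vM
      by (auto simp: F_def B_add_left B_act_left sc_mult)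
    have "(\<lambda>f. B f v) ` F ?U = J2" unfolding FU' using free J2_J by force
    moreover have "{f \<in> F ?U. B f v = \<zero>\<^bsub>A\<^esub>} = ?K" unfolding FU' using J2_zero by auto
    ultimately have 2: "sdim k N.V (F ?U) = sdim k N.V ?K + dim_J2"
      using N.V.rank_nullity_subspace(3)[OF sF[OF UM'] vectorspace_axioms, of "\<lambda>f. B f v"] vM
      by (auto simp: F_def B_add_left B_act_left sc_mult)
    show "sdim k N.V (F ?U) + edim * sdim k M.V ?U \<le> dim_N + edim * rad_M"
      using IH 1 2 U'(2) J2_le_J by simp
  qed
  moreover have "N.soc \<subseteq> F (carrier M)"
  proof
    fix f assume f: "f \<in> N.soc"
    then have fN: "f \<in> carrier N" and fz: "\<And>r. r \<in> J \<Longrightarrow> r \<odot>\<^bsub>N\<^esub> f = \<zero>\<^bsub>N\<^esub>" by (auto simp: N.soc_def)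
    have "B f m \<in> right_soc" if "m \<in> carrier M" for m
      using B_J[OF fN that] B_act_left[OF _ fN that, symmetric] fz B.zero_left[of m] that
      by (auto simp: right_soc_def)
    then show "f \<in> F (carrier M)" using fN right_soc_eq by (auto simp: F_def)
  qed
  then have "soc_N \<le> sdim k N.V (F (carrier M))" by (rule N.V.sdim_mono(1)[OF N.subspace_soc sF[OF order_refl]])
  ultimately show ?thesis by simp
qed

end

text \<open>
  The arithmetic of the dimension count, with the letters of the introduction: the two estimates give
  \<open>a t' \<le> e t \<le> a t\<close> and \<open>a t \<le> e t' \<le> a t'\<close>, and every inequality on the way becomes an equality.
\<close>

lemma extremal_counting:
  fixes a e s s' t t' p p' :: nat
  assumes a: "2 \<le> a" "e \<le> a" and t: "0 < t" "0 < t'" and p: "p \<le> t" "p' \<le> t'"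
    and lower: "a * t' + p \<le> s + t" "a * t + p' \<le> s' + t'"
    and upper: "s \<le> e * p" "s' \<le> e * p'"
  shows "a = e" "p = t" "s = e * t" "p' = t" "t' = t"
proof -
  have e0: "e \<noteq> 0"
  proof
    assume "e = 0"
    then have "a * t' \<le> t" "a * t \<le> t'" using lower upper by auto
    moreover have "2 * t \<le> a * t" "2 * t' \<le> a * t'" using a(1) by auto
    ultimately show False using t by linarith
  qed
  then obtain d where d: "e = Suc d" by (cases e) auto
  have "d * p \<le> d * t" "d * p' \<le> d * t'" using p by auto
  then have at: "a * t' \<le> e * t" "a * t \<le> e * t'" 
    using lower upper unfolding d mult_Suc by linarith+
  have "e * t \<le> a * t" "e * t' \<le> a * t'" using a(2) by auto
  then have "a * t' \<le> a * t" "a * t \<le> a * t'" using at by linarith+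
  then show tt: "t' = t" using a(1) by auto
  then have "a \<le> e" using at(1) t by auto
  then show ae: "a = e" using a(2) by auto
  have "d \<noteq> 0" using d ae a(1) by auto
  moreover have "d * t \<le> d * p" "d * t \<le> d * p'"
    using lower upper unfolding ae d tt mult_Suc by linarith+
  ultimately show pt: "p = t" and "p' = t" using p tt by auto
  show "s = e * t" using lower(1) upper(1) pt ae tt by auto
qed

context dual_pair_soc
begin

lemma rad_le_soc: "rad_M \<le> soc_M" "soc_M \<le> dim_M" "rad_M < dim_M"
proof -
  have c: "subspace k (carrier M) M.V" using M.V.subspace_carrier by simp
  show "rad_M \<le> soc_M" by (rule M.V.sdim_mono(1)[OF M.subspace_Jspan M.subspace_soc Jspan_subset_soc])
  show "soc_M \<le> dim_M" by (rule M.V.sdim_mono(1)[OF M.subspace_soc c]) (auto simp: M.soc_def)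
  show "rad_M < dim_M"
    by (rule M.V.sdim_strict_mono[OF M.subspace_Jspan c])
      (use Jspan_proper M.V.subspaceD(1)[OF M.subspace_Jspan] in auto)
qed

lemma J2_smaller:
  assumes wide: "2 \<le> dim_J2"
  shows "dim_J2 < edim"
proof (rule ccontr)
  assume "\<not> dim_J2 < edim"
  then have ea: "edim \<le> dim_J2" by simp
  interpret op: dual_pair_soc k "opposite A" J N M "\<lambda>m f. B f m" by (rule dual_pair_soc_opposite)
  note op_vs = fd_algebra.axioms(1)[OF short_local_algebra.axioms(1)[OF short_local_algebra_opposite]]
  have opA: "sdim k (opposite A) U = sdim k A U" if "subspace k U A" for U
    using A.sdim_image[OF that op_vs, of "\<lambda>x. x"] subspaceD(1)[OF that] by (simp add: subset_iff)
  note op_simps = opA[OF subspace_J] opA[OF subspace_J2] J2_opposite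
  have c: "subspace k (carrier M) M.V" "subspace k (carrier N) N.V"
    using M.V.subspace_carrier N.V.subspace_carrier by simp_all
  have 1: "rad_M + edim * soc_M \<le> edim * dim_M"
    by (rule Jspan_upper_bound[OF c(1)]) (auto simp: M.soc_def)
  have 2: "rad_N + edim * soc_N \<le> edim * dim_N"
    using op.Jspan_upper_bound[OF c(2)] by (auto simp: N.soc_def op_simps)
  have 3: "dim_J2 * dim_N \<le> soc_M + dim_J2 * rad_N" by (rule socle_lower_bound)
  have 4: "dim_J2 * dim_M \<le> soc_N + dim_J2 * rad_M" using op.socle_lower_bound by (simp add: op_simps)
  note le = rad_le_soc op.rad_le_soc
  note res = extremal_counting[OF wide ea, where t = "dim_M - rad_M" and t' = "dim_N - rad_N" and s = rad_M and s' = rad_N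
    and p = "dim_M - soc_M" and p' = "dim_N - soc_N"]
  have prem: "0 < dim_M - rad_M" "0 < dim_N - rad_N" "dim_M - soc_M \<le> dim_M - rad_M" "dim_N - soc_N \<le> dim_N - rad_N"
    "dim_J2 * (dim_N - rad_N) + (dim_M - soc_M) \<le> rad_M + (dim_M - rad_M)"
    "dim_J2 * (dim_M - rad_M) + (dim_N - soc_N) \<le> rad_N + (dim_N - rad_N)"
    "rad_M \<le> edim * (dim_M - soc_M)" "rad_N \<le> edim * (dim_N - soc_N)"
    using 1 2 3 4 le by (auto simp: diff_mult_distrib2)
  note res = res[OF prem]
  have "rad_M = soc_M" using res(2) le by linarith
  then have JM: "M.Jspan (carrier M) = M.soc"
    by (rule M.V.sdim_mono(2)[OF M.subspace_Jspan M.subspace_soc Jspan_subset_soc])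
  have "soc_N + edim * dim_M \<le> dim_N + edim * rad_M"
    by (rule extremal_bound[OF JM]) (use res(3) in simp)
  then have "edim * (dim_M - rad_M) \<le> dim_N - soc_N" using le by (simp add: diff_mult_distrib2)
  then have "edim * (dim_M - rad_M) \<le> 1 * (dim_M - rad_M)" using res(4) by simp
  then have "edim \<le> 1" using prem(1) mult_le_cancel2 by blast
  then show False using res(1) wide by simp
qed

end

section \<open>Self-injective short local algebras\<close>

context short_local_algebra
begin

lemma left_soc_nonzero:
  assumes "J \<noteq> {\<zero>\<^bsub>A\<^esub>}" shows "\<exists>w\<in>left_soc. w \<noteq> \<zero>\<^bsub>A\<^esub>"
proof -
  obtain x where x: "x \<in> J" "x \<noteq> \<zero>\<^bsub>A\<^esub>" using assms J_zero by auto
  show ?thesis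
  proof (cases "x \<in> left_soc")
    case False
    then obtain y where y: "y \<in> J" "y \<otimes>\<^bsub>A\<^esub> x \<noteq> \<zero>\<^bsub>A\<^esub>" using x(1) by (auto simp: left_soc_def)
    then have "y \<otimes>\<^bsub>A\<^esub> x \<in> left_soc" using J2_mult[OF y(1) x(1)] J2_soc by auto
    then show ?thesis using y by auto
  qed (use x in auto)
qed

text \<open>
  The left ideal \<open>A b\<close> is zero or contains a nonzero multiple of \<open>w\<close>, and \<open>\<mu>\<close> does not vanish there.
\<close>

lemma trace_form_nondegenerate:
  assumes w: "w \<in> left_soc" "left_soc \<subseteq> line w" and \<lambda>: "A.functional \<mu>" "\<mu> w = \<one>\<^bsub>k\<^esub>"
    and b: "b \<in> carrier A" "\<And>a. a \<in> carrier A \<Longrightarrow> \<mu> (a \<otimes>\<^bsub>A\<^esub> b) = \<zero>\<^bsub>k\<^esub>"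
  shows "b = \<zero>\<^bsub>A\<^esub>"
proof (rule ccontr)
  assume b0: "b \<noteq> \<zero>\<^bsub>A\<^esub>"
  have wA: "w \<in> carrier A" using w by (auto simp: left_soc_def)
  have w0: "w \<noteq> \<zero>\<^bsub>A\<^esub>"
  proof
    assume "w = \<zero>\<^bsub>A\<^esub>"
    then show False using A.subspace_functional_kernel[OF \<lambda>(1)] \<lambda>(2) subspaceD(2) by fastforce
  qed
  have "\<exists>a\<in>carrier A. a \<otimes>\<^bsub>A\<^esub> b \<in> left_soc \<and> a \<otimes>\<^bsub>A\<^esub> b \<noteq> \<zero>\<^bsub>A\<^esub>"
  proof (cases "b \<in> J")
    case False
    then obtain s where s: "s \<in> carrier A" "s \<otimes>\<^bsub>A\<^esub> b = \<one>\<^bsub>A\<^esub>" using inverse_outside_J b(1) by blast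
    then have "w \<otimes>\<^bsub>A\<^esub> s \<otimes>\<^bsub>A\<^esub> b = w" using wA b(1) by (simp add: A.m_assoc)
    then show ?thesis using w0 w(1) wA s(1) by (intro bexI[of _ "w \<otimes>\<^bsub>A\<^esub> s"]) auto
  next
    case bJ: True
    show ?thesis
    proof (cases "b \<in> left_soc")
      case True
      then show ?thesis using b0 b(1) by (intro bexI[of _ "\<one>\<^bsub>A\<^esub>"]) auto
    next
      case False
      then obtain y where y: "y \<in> J" "y \<otimes>\<^bsub>A\<^esub> b \<noteq> \<zero>\<^bsub>A\<^esub>" using bJ by (auto simp: left_soc_def)
      then show ?thesis using J2_mult[OF y(1) bJ] J2_soc by (intro bexI[of _ y]) auto
    qed
  qed
  then obtain a c where a: "a \<in> carrier A" "a \<otimes>\<^bsub>A\<^esub> b \<noteq> \<zero>\<^bsub>A\<^esub>" and c: "c \<in> carrier k" "a \<otimes>\<^bsub>A\<^esub> b = c \<odot>\<^bsub>A\<^esub> w"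
    using w(2) by (auto simp: line_def)
  have "\<mu> (a \<otimes>\<^bsub>A\<^esub> b) = c" unfolding c(2) using \<lambda> c(1) wA by (simp add: A.functional_def)
  then show False using b(2)[OF a(1)] a(2) c wA by simp
qed

text \<open>
  The form \<open>(a, b) \<mapsto> \<mu>(a b)\<close> is nondegenerate on one side, so it identifies \<open>A\<close> with its \<open>k\<close>-dual. The
  representing element is corrected along a flag of \<open>A\<close>. Here the annihilator must shrink at every step:
  each step costs at most one dimension, and the annihilator has to go from \<open>A\<close> to \<open>0\<close> in \<open>dim A\<close> steps.
\<close>

lemma functional_represented:
  assumes \<mu>: "A.functional \<mu>"
    and nd: "\<And>b. b \<in> carrier A \<Longrightarrow> (\<And>a. a \<in> carrier A \<Longrightarrow> \<mu> (a \<otimes>\<^bsub>A\<^esub> b) = \<zero>\<^bsub>k\<^esub>) \<Longrightarrow> b = \<zero>\<^bsub>A\<^esub>"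
    and \<nu>: "A.functional \<nu>"
  shows "\<exists>b\<in>carrier A. \<forall>a\<in>carrier A. \<nu> a = \<mu> (a \<otimes>\<^bsub>A\<^esub> b)"
proof -
  have \<mu>c [simp]: "\<mu> x \<in> carrier k" if "x \<in> carrier A" for x using \<mu> that by (auto simp: A.functional_def Pi_iff)
  have \<mu>_add: "\<mu> (x \<oplus>\<^bsub>A\<^esub> y) = \<mu> x \<oplus>\<^bsub>k\<^esub> \<mu> y" if "x \<in> carrier A" "y \<in> carrier A" for x y
    using \<mu> that by (auto simp: A.functional_def)
  have \<mu>_smult: "\<mu> (c \<odot>\<^bsub>A\<^esub> x) = c \<otimes>\<^bsub>k\<^esub> \<mu> x" if "c \<in> carrier k" "x \<in> carrier A" for c x
    using \<mu> that by (auto simp: A.functional_def)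
  have \<nu>c [simp]: "\<nu> x \<in> carrier k" if "x \<in> carrier A" for x using \<nu> that by (auto simp: A.functional_def Pi_iff)
  have one: "\<one>\<^bsub>A\<^esub> \<noteq> \<zero>\<^bsub>A\<^esub>" using one_notin_J J_zero by auto
  \<comment> \<open>\<open>Z\<close> is the ground field, realized as the line \<open>k 1\<close>, so that the pairing has values in a vector space.\<close>
  define Z where "Z = A\<lparr>carrier := line \<one>\<^bsub>A\<^esub>\<rparr>"
  note L = subspace_line[OF A.one_closed]
  interpret Z: fd_space k Z unfolding Z_def by (rule A.fd_space_subspace[OF L])
  have dimZ: "sdim k Z (carrier Z) = 1"
    using A.sdim_line[OF A.one_closed one] by (simp add: sdim_def Z_def)
  define \<beta> where "\<beta> a b = \<mu> (a \<otimes>\<^bsub>A\<^esub> b) \<odot>\<^bsub>A\<^esub> \<one>\<^bsub>A\<^esub>" for a b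
  interpret B: bilinear_pairing k A A Z \<beta>
    by unfold_locales
      (auto simp: \<beta>_def Z_def line_def A.l_distr A.r_distr \<mu>_add \<mu>_smult smult_l_distr smult_mult_left
        smult_mult_right smult_assoc1)
  have \<beta>0: "\<beta> a b = \<zero>\<^bsub>Z\<^esub> \<longleftrightarrow> \<mu> (a \<otimes>\<^bsub>A\<^esub> b) = \<zero>\<^bsub>k\<^esub>" if "a \<in> carrier A" "b \<in> carrier A" for a b
    using that one by (simp add: \<beta>_def Z_def smult_zero_iff)
  have "\<exists>b\<in>carrier A. \<forall>a\<in>carrier A. \<nu> a = \<mu> (a \<otimes>\<^bsub>A\<^esub> b)"
  proof (rule A.subspace_interval_induct[OF subspace_zero subspace_carrier,
        of "\<lambda>U. \<exists>b\<in>carrier A. \<forall>a\<in>U. \<nu> a = \<mu> (a \<otimes>\<^bsub>A\<^esub> b)"])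
    show "{\<zero>\<^bsub>A\<^esub>} \<subseteq> carrier A" by auto
    have z: "\<nu> \<zero>\<^bsub>A\<^esub> = \<zero>\<^bsub>k\<^esub>" "\<mu> \<zero>\<^bsub>A\<^esub> = \<zero>\<^bsub>k\<^esub>"
      using subspaceD(2)[OF A.subspace_functional_kernel[OF \<nu>]] subspaceD(2)[OF A.subspace_functional_kernel[OF \<mu>]] by auto
    show "\<exists>b\<in>carrier A. \<forall>a\<in>{\<zero>\<^bsub>A\<^esub>}. \<nu> a = \<mu> (a \<otimes>\<^bsub>A\<^esub> b)"
      using z by (intro bexI[of _ "\<zero>\<^bsub>A\<^esub>"]) auto
  next
    fix U v assume U: "subspace k U A" "U \<subseteq> carrier A" and v: "v \<in> carrier A" "v \<notin> U"
      and "\<exists>b\<in>carrier A. \<forall>a\<in>U. \<nu> a = \<mu> (a \<otimes>\<^bsub>A\<^esub> b)"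
    then obtain b where b: "b \<in> carrier A" "\<And>a. a \<in> U \<Longrightarrow> \<nu> a = \<mu> (a \<otimes>\<^bsub>A\<^esub> b)" by auto
    let ?U = "U <+>\<^bsub>A\<^esub> line v"
    note U' = A.sdim_add_line[OF U(1) v]
    have "B.annihilator (carrier A) \<subseteq> {\<zero>\<^bsub>A\<^esub>}" using nd \<beta>0 by (auto simp: B.annihilator_def)
    then have annA: "sdim k A (B.annihilator (carrier A)) = 0"
      using A.sdim_mono(1)[OF B.subspace_annihilator[OF order_refl] subspace_zero] A.sdim_zero by simp
    have ann0: "B.annihilator {\<zero>\<^bsub>A\<^esub>} = carrier A" by (auto simp: B.annihilator_def)
    have "sdim k A (carrier A) \<le> sdim k A (B.annihilator U) + sdim k A U"
      using B.sdim_annihilator_mono[OF finite_dimensional subspace_zero U(1)] subspaceD(2)[OF U(1)] dimZ ann0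
        A.sdim_zero by simp
    moreover have "sdim k A (B.annihilator ?U) + sdim k A ?U \<le> sdim k A (carrier A)"
      using B.sdim_annihilator_mono[OF finite_dimensional U'(1) subspace_carrier] subspaceD(1)[OF U'(1)] dimZ annA by simp
    ultimately have "B.annihilator ?U \<noteq> B.annihilator U" using U'(2) by auto
    then obtain c0 where c0: "c0 \<in> B.annihilator U" "\<beta> v c0 \<noteq> \<zero>\<^bsub>Z\<^esub>"
      unfolding B.annihilator_add_line[OF U(1) v(1)] by auto
    have c0A: "c0 \<in> carrier A" and c0U: "\<And>u. u \<in> U \<Longrightarrow> \<mu> (u \<otimes>\<^bsub>A\<^esub> c0) = \<zero>\<^bsub>k\<^esub>"
      using c0(1) \<beta>0 U(2) by (auto simp: B.annihilator_def subset_iff)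
    define \<delta> where "\<delta> = \<mu> (v \<otimes>\<^bsub>A\<^esub> c0)"
    have "\<delta> \<in> carrier k" "\<delta> \<noteq> \<zero>\<^bsub>k\<^esub>" using c0(2) \<beta>0 v(1) c0A by (auto simp: \<delta>_def)
    then have \<delta>: "\<delta> \<in> carrier k" "inv\<^bsub>k\<^esub> \<delta> \<in> carrier k" "inv\<^bsub>k\<^esub> \<delta> \<otimes>\<^bsub>k\<^esub> \<delta> = \<one>\<^bsub>k\<^esub>"
      using field_Units by auto
    define \<kappa> where "\<kappa> = (\<nu> v \<ominus>\<^bsub>k\<^esub> \<mu> (v \<otimes>\<^bsub>A\<^esub> b)) \<otimes>\<^bsub>k\<^esub> inv\<^bsub>k\<^esub> \<delta>"
    have \<kappa>: "\<kappa> \<in> carrier k" "\<kappa> \<otimes>\<^bsub>k\<^esub> \<delta> = \<nu> v \<ominus>\<^bsub>k\<^esub> \<mu> (v \<otimes>\<^bsub>A\<^esub> b)"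
      unfolding \<kappa>_def using \<delta> v(1) b(1) by (simp_all add: R.m_assoc)
    let ?b = "b \<oplus>\<^bsub>A\<^esub> \<kappa> \<odot>\<^bsub>A\<^esub> c0"
    have exp: "\<mu> (a \<otimes>\<^bsub>A\<^esub> ?b) = \<mu> (a \<otimes>\<^bsub>A\<^esub> b) \<oplus>\<^bsub>k\<^esub> \<kappa> \<otimes>\<^bsub>k\<^esub> \<mu> (a \<otimes>\<^bsub>A\<^esub> c0)" if "a \<in> carrier A" for a
      using that b(1) c0A \<kappa>(1) by (simp add: A.r_distr \<mu>_add smult_mult_right \<mu>_smult)
    have "\<nu> a = \<mu> (a \<otimes>\<^bsub>A\<^esub> ?b)" if a: "a \<in> ?U" for a
    proof -
      obtain u c where u: "u \<in> U" "c \<in> carrier k" "a = u \<oplus>\<^bsub>A\<^esub> c \<odot>\<^bsub>A\<^esub> v"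
        using a by (auto simp: in_set_add line_def)
      have uA: "u \<in> carrier A" using u(1) U(2) by auto
      have "\<mu> (v \<otimes>\<^bsub>A\<^esub> ?b) = \<nu> v"
        using exp[OF v(1)] \<kappa> \<delta>(1) v(1) b(1) by (simp add: \<delta>_def[symmetric] R.minus_eq R.a_ac R.r_neg1 R.r_neg2 R.r_neg)
      moreover have "\<mu> (u \<otimes>\<^bsub>A\<^esub> ?b) = \<nu> u"
        using exp[OF uA] c0U[OF u(1)] b(2)[OF u(1)] \<kappa>(1) uA b(1) by simp
      moreover have "?b \<in> carrier A" using b(1) \<kappa>(1) c0A by simp
      moreover from this have "\<mu> (a \<otimes>\<^bsub>A\<^esub> ?b) = \<mu> (u \<otimes>\<^bsub>A\<^esub> ?b) \<oplus>\<^bsub>k\<^esub> c \<otimes>\<^bsub>k\<^esub> \<mu> (v \<otimes>\<^bsub>A\<^esub> ?b)"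
        unfolding u(3) using uA u(2) v(1) by (simp only: A.l_distr \<mu>_add smult_mult_left \<mu>_smult smult_closed A.m_closed)
      moreover have "\<nu> a = \<nu> u \<oplus>\<^bsub>k\<^esub> c \<otimes>\<^bsub>k\<^esub> \<nu> v"
        unfolding u(3) using uA u(2) v(1) \<nu> by (simp add: A.functional_def)
      ultimately show ?thesis by simp
    qed
    then show "\<exists>b\<in>carrier A. \<forall>a\<in>?U. \<nu> a = \<mu> (a \<otimes>\<^bsub>A\<^esub> b)"
      using b(1) c0A \<kappa>(1) by (intro bexI[of _ ?b]) auto
  qed
  then show ?thesis .
qed

text \<open>
  Since \<open>A\<close> is isomorphic to its \<open>k\<close>-dual by \<open>b \<mapsto> \<mu>(- b)\<close>, homomorphisms \<open>h\<close> from a module to \<open>A\<close> correspond to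
  linear forms on the module, by \<open>h \<mapsto> \<mu> \<circ> h\<close>. So an extension of a homomorphism is obtained from an
  extension of a linear form.
\<close>

lemma self_injective_if_left_soc_line:
  assumes "J \<noteq> {\<zero>\<^bsub>A\<^esub>}" and z: "z \<in> carrier A" "left_soc \<subseteq> line z"
  shows "self_injective A"
proof -
  obtain w where w: "w \<in> left_soc" "w \<noteq> \<zero>\<^bsub>A\<^esub>" using left_soc_nonzero[OF assms(1)] by auto
  have wA: "w \<in> carrier A" using w(1) by (auto simp: left_soc_def)
  have "line z \<subseteq> line w"
  proof -
    obtain c where c: "c \<in> carrier k" "w = c \<odot>\<^bsub>A\<^esub> z" using w(1) z(2) by (auto simp: line_def)
    then have "c \<noteq> \<zero>\<^bsub>k\<^esub>" using w(2) z(1) by auto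
    then have "z \<in> line w" using smult_cancel[OF c(1) _ z(1)] c(2) by (auto simp: line_def intro!: image_eqI[of _ _ "inv\<^bsub>k\<^esub> c"])
    then show ?thesis using subspaceD(4)[OF subspace_line[OF wA]] by (auto simp: line_def[of z])
  qed
  then have lw: "left_soc \<subseteq> line w" using z(2) by auto
  obtain \<mu> where \<mu>: "A.functional \<mu>" "\<mu> w = \<one>\<^bsub>k\<^esub>"
    using A.functional_exists[OF subspace_zero wA] w(2) by auto
  note nd = trace_form_nondegenerate[OF w(1) lw \<mu>]
  note represented = functional_represented[OF \<mu>(1) nd]
  have \<mu>c: "\<mu> x \<in> carrier k" if "x \<in> carrier A" for x using \<mu> that by (auto simp: A.functional_def Pi_iff)
  have \<mu>_add: "\<mu> (x \<oplus>\<^bsub>A\<^esub> y) = \<mu> x \<oplus>\<^bsub>k\<^esub> \<mu> y" if "x \<in> carrier A" "y \<in> carrier A" for x y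
    using \<mu> that by (auto simp: A.functional_def)
  have \<mu>_smult: "\<mu> (c \<odot>\<^bsub>A\<^esub> x) = c \<otimes>\<^bsub>k\<^esub> \<mu> x" if "c \<in> carrier k" "x \<in> carrier A" for c x
    using \<mu> that by (auto simp: A.functional_def)
  have eqI: "b = b'" if "b \<in> carrier A" "b' \<in> carrier A" "\<And>a. a \<in> carrier A \<Longrightarrow> \<mu> (a \<otimes>\<^bsub>A\<^esub> b) = \<mu> (a \<otimes>\<^bsub>A\<^esub> b')" for b b'
  proof -
    have "b \<oplus>\<^bsub>A\<^esub> (\<ominus>\<^bsub>k\<^esub> \<one>\<^bsub>k\<^esub>) \<odot>\<^bsub>A\<^esub> b' = \<zero>\<^bsub>A\<^esub>"
    proof (rule nd)
      fix a assume a: "a \<in> carrier A"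
      have "\<mu> (a \<otimes>\<^bsub>A\<^esub> (b \<oplus>\<^bsub>A\<^esub> (\<ominus>\<^bsub>k\<^esub> \<one>\<^bsub>k\<^esub>) \<odot>\<^bsub>A\<^esub> b')) = \<mu> (a \<otimes>\<^bsub>A\<^esub> b) \<oplus>\<^bsub>k\<^esub> (\<ominus>\<^bsub>k\<^esub> \<one>\<^bsub>k\<^esub>) \<otimes>\<^bsub>k\<^esub> \<mu> (a \<otimes>\<^bsub>A\<^esub> b')"
        using a that(1,2) R.add.inv_closed[OF R.one_closed]
        by (simp only: A.r_distr smult_mult_right \<mu>_add \<mu>_smult smult_closed A.m_closed)
      then show "\<mu> (a \<otimes>\<^bsub>A\<^esub> (b \<oplus>\<^bsub>A\<^esub> (\<ominus>\<^bsub>k\<^esub> \<one>\<^bsub>k\<^esub>) \<odot>\<^bsub>A\<^esub> b')) = \<zero>\<^bsub>k\<^esub>"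
        using that(3)[OF a] \<mu>c[of "a \<otimes>\<^bsub>A\<^esub> b'"] a that(2) by (simp add: R.l_minus R.r_neg)
    qed (use that in simp)
    then have "b \<oplus>\<^bsub>A\<^esub> \<ominus>\<^bsub>A\<^esub> b' = \<zero>\<^bsub>A\<^esub>" using that(2) by (simp add: smult_l_minus)
    then show ?thesis using module.M.minus_equality[of b "\<ominus>\<^bsub>A\<^esub> b'"] that(1,2) by simp
  qed
  have inj: "\<exists>h\<in>module_hom A Y (left_regular A). \<forall>x\<in>carrier X. h (f x) = g x"
    if X: "finite_length_module A X" and Y: "finite_length_module A Y"
      and f: "f \<in> module_hom A X Y" "inj_on f (carrier X)" and g: "g \<in> module_hom A X (left_regular A)"
    for X Y :: "('a, nat \<Rightarrow> 'k) module" and f g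
  proof -
    have "short_module k A J X" "short_module k A J Y"
      using X Y by (auto simp: finite_length_module_def intro!: short_module.intro short_local_algebra_axioms)
    then have fdX: "fd_module k A J X" and fdY: "fd_module k A J Y"
      using X Y short_module.fd_module_if_finite_length by auto
    interpret X: fd_module k A J X by fact
    interpret Y: fd_module k A J Y by fact
    have fc: "f x \<in> carrier Y" if "x \<in> carrier X" for x using module_hom_closed[OF f(1)] that by auto
    have gc: "g x \<in> carrier A" if "x \<in> carrier X" for x using module_hom_closed[OF g] that by auto
    note f_add = module_hom_add[OF f(1)] and f_smult = module_hom_smult[OF f(1)]
    note g_add = module_hom_add[OF g, simplified] and g_smult = module_hom_smult[OF g, simplified]
    have imf: "subspace k (f ` carrier X) Y.V"
      using X.V.rank_nullity_subspace(2)[OF X.V.subspace_carrier Y.vectorspace_V, of f] fc f_add f_smult by auto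
    have "{\<zero>\<^bsub>Y.V\<^esub>} \<inter> f ` carrier X = {\<zero>\<^bsub>Y.V\<^esub>}" using Y.V.subspaceD(2)[OF imf] by auto
    then obtain \<pi> where \<pi>: "\<pi> \<in> carrier Y.V \<rightarrow> f ` carrier X"
      "\<And>y z. y \<in> carrier Y.V \<Longrightarrow> z \<in> carrier Y.V \<Longrightarrow> \<pi> (y \<oplus>\<^bsub>Y.V\<^esub> z) = \<pi> y \<oplus>\<^bsub>Y.V\<^esub> \<pi> z"
      "\<And>c y. c \<in> carrier k \<Longrightarrow> y \<in> carrier Y.V \<Longrightarrow> \<pi> (c \<odot>\<^bsub>Y.V\<^esub> y) = c \<odot>\<^bsub>Y.V\<^esub> \<pi> y"
      "\<And>y. y \<in> {\<zero>\<^bsub>Y.V\<^esub>} \<Longrightarrow> \<pi> y = \<zero>\<^bsub>Y.V\<^esub>" "\<And>y. y \<in> f ` carrier X \<Longrightarrow> \<pi> y = y"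
      by (rule Y.V.projection_exists[OF Y.V.subspace_zero imf]) (rule that)
    have "\<exists>x\<in>carrier X. \<pi> y = f x" if "y \<in> carrier Y" for y
      using funcset_mem[OF \<pi>(1), of y] that by auto
    then obtain p where p: "\<And>y. y \<in> carrier Y \<Longrightarrow> p y \<in> carrier X" "\<And>y. y \<in> carrier Y \<Longrightarrow> \<pi> y = f (p y)" by metis
    have pI: "p y = x" if "y \<in> carrier Y" "x \<in> carrier X" "\<pi> y = f x" for x y
      using inj_onD[OF f(2)] p that by metis
    have p_add: "p (y \<oplus>\<^bsub>Y\<^esub> z) = p y \<oplus>\<^bsub>X\<^esub> p z" if "y \<in> carrier Y" "z \<in> carrier Y" for y z
      using that \<pi>(2)[of y z] p f_add Y.V.M.a_closed[of y z] X.V.M.a_closed[of "p y" "p z"] by (intro pI) auto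
    have p_smult: "p (sc c \<odot>\<^bsub>Y\<^esub> y) = sc c \<odot>\<^bsub>X\<^esub> p y" if "c \<in> carrier k" "y \<in> carrier Y" for c y
      using that \<pi>(3)[of c y] p f_smult by (intro pI) auto
    have pf: "p (f x) = x" if "x \<in> carrier X" for x
      using that \<pi>(5)[of "f x"] fc by (intro pI) auto
    define \<nu> where "\<nu> y = \<mu> (g (p y))" for y
    have "A.functional (\<lambda>a. \<nu> (a \<odot>\<^bsub>Y\<^esub> y))" if y: "y \<in> carrier Y" for y
      unfolding A.functional_def \<nu>_def
    proof (intro conjI ballI)
      show "(\<lambda>a. \<mu> (g (p (a \<odot>\<^bsub>Y\<^esub> y)))) \<in> carrier A \<rightarrow> carrier k" using \<mu>c gc p(1) y by auto
      show "\<mu> (g (p ((a \<oplus>\<^bsub>A\<^esub> b) \<odot>\<^bsub>Y\<^esub> y))) = \<mu> (g (p (a \<odot>\<^bsub>Y\<^esub> y))) \<oplus>\<^bsub>k\<^esub> \<mu> (g (p (b \<odot>\<^bsub>Y\<^esub> y)))"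
        if "a \<in> carrier A" "b \<in> carrier A" for a b
        using that y p(1) gc by (simp add: Y.act_add p_add g_add \<mu>_add)
      show "\<mu> (g (p ((c \<odot>\<^bsub>A\<^esub> a) \<odot>\<^bsub>Y\<^esub> y))) = c \<otimes>\<^bsub>k\<^esub> \<mu> (g (p (a \<odot>\<^bsub>Y\<^esub> y)))"
        if "c \<in> carrier k" "a \<in> carrier A" for c a
        unfolding Y.smult_V[OF that y] using that y p(1) gc by (simp add: p_smult g_smult sc_mult \<mu>_smult)
    qed
    from represented[OF _ _ this] have "\<exists>b\<in>carrier A. \<forall>a\<in>carrier A. \<nu> (a \<odot>\<^bsub>Y\<^esub> y) = \<mu> (a \<otimes>\<^bsub>A\<^esub> b)" if "y \<in> carrier Y" for y
      using that by blast
    then obtain h where h: "\<And>y. y \<in> carrier Y \<Longrightarrow> h y \<in> carrier A"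
      "\<And>y a. y \<in> carrier Y \<Longrightarrow> a \<in> carrier A \<Longrightarrow> \<mu> (a \<otimes>\<^bsub>A\<^esub> h y) = \<nu> (a \<odot>\<^bsub>Y\<^esub> y)" by metis
    have "h (y \<oplus>\<^bsub>Y\<^esub> z) = h y \<oplus>\<^bsub>A\<^esub> h z" if "y \<in> carrier Y" "z \<in> carrier Y" for y z
    proof (rule eqI)
      show "h (y \<oplus>\<^bsub>Y\<^esub> z) \<in> carrier A" "h y \<oplus>\<^bsub>A\<^esub> h z \<in> carrier A" using that h(1) Y.V.M.a_closed[of y z] by auto
      fix a assume a: "a \<in> carrier A"
      have "\<mu> (a \<otimes>\<^bsub>A\<^esub> h (y \<oplus>\<^bsub>Y\<^esub> z)) = \<nu> (a \<odot>\<^bsub>Y\<^esub> y \<oplus>\<^bsub>Y\<^esub> a \<odot>\<^bsub>Y\<^esub> z)"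
        using h(2)[of "y \<oplus>\<^bsub>Y\<^esub> z" a] a that Y.V.M.a_closed[of y z] by (simp add: Y.act_add_right)
      also have "\<dots> = \<mu> (a \<otimes>\<^bsub>A\<^esub> h y) \<oplus>\<^bsub>k\<^esub> \<mu> (a \<otimes>\<^bsub>A\<^esub> h z)"
        using a that p(1) gc by (simp add: h(2) \<nu>_def p_add g_add \<mu>_add)
      finally show "\<mu> (a \<otimes>\<^bsub>A\<^esub> h (y \<oplus>\<^bsub>Y\<^esub> z)) = \<mu> (a \<otimes>\<^bsub>A\<^esub> (h y \<oplus>\<^bsub>A\<^esub> h z))"
        using a that h(1) by (simp add: A.r_distr \<mu>_add)
    qed
    moreover have "h (r \<odot>\<^bsub>Y\<^esub> y) = r \<otimes>\<^bsub>A\<^esub> h y" if "r \<in> carrier A" "y \<in> carrier Y" for r y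
    proof (rule eqI)
      fix a assume a: "a \<in> carrier A"
      show "\<mu> (a \<otimes>\<^bsub>A\<^esub> h (r \<odot>\<^bsub>Y\<^esub> y)) = \<mu> (a \<otimes>\<^bsub>A\<^esub> (r \<otimes>\<^bsub>A\<^esub> h y))"
        using a that h(1)[OF that(2)] h(2)[of y "a \<otimes>\<^bsub>A\<^esub> r"] h(2)[of "r \<odot>\<^bsub>Y\<^esub> y" a]
        by (simp add: A.m_assoc Y.act_mult)
    qed (use that h(1) in auto)
    ultimately have "h \<in> module_hom A Y (left_regular A)" using h(1) by (simp add: module_hom_def)
    moreover have "h (f x) = g x" if x: "x \<in> carrier X" for x
    proof (rule eqI)
      fix a assume a: "a \<in> carrier A"
      show "\<mu> (a \<otimes>\<^bsub>A\<^esub> h (f x)) = \<mu> (a \<otimes>\<^bsub>A\<^esub> g x)"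
        using h(2)[OF fc[OF x] a] f_smult[OF a x, symmetric] pf[of "a \<odot>\<^bsub>X\<^esub> x"] a x by (simp add: \<nu>_def g_smult)
    qed (use h(1) fc gc x in auto)
    ultimately show ?thesis by blast
  qed
  then show ?thesis
    unfolding self_injective_def injective_module_def using A.left_module_left_regular by blast
qed

end

section \<open>Splitting off free summands\<close>

lemma dual_module_simps [simp]:
  "carrier (dual_module R M) = module_hom R M (left_regular R) \<inter> extensional (carrier M)"
  "\<zero>\<^bsub>dual_module R M\<^esub> = (\<lambda>x\<in>carrier M. \<zero>\<^bsub>R\<^esub>)"
  "f \<oplus>\<^bsub>dual_module R M\<^esub> g = (\<lambda>x\<in>carrier M. f x \<oplus>\<^bsub>R\<^esub> g x)"
  "r \<odot>\<^bsub>dual_module R M\<^esub> f = (\<lambda>x\<in>carrier M. f x \<otimes>\<^bsub>R\<^esub> r)"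
  by (simp_all add: dual_module_def)

context left_module
begin

lemma abelian_group_dual: "abelian_group (dual_module R M)"
proof (rule abelian_groupI)
  fix f g h assume f: "f \<in> carrier (dual_module R M)" and g: "g \<in> carrier (dual_module R M)"
    and h: "h \<in> carrier (dual_module R M)"
  have c [simp]: "f x \<in> carrier R" "g x \<in> carrier R" "h x \<in> carrier R" if "x \<in> carrier M" for x
    using f g h that by (auto simp: module_hom_def)
  show "f \<oplus>\<^bsub>dual_module R M\<^esub> g \<in> carrier (dual_module R M)"
    using f g by (auto simp: module_hom_def smult_closed R.a_ac R.r_distr)
  show "f \<oplus>\<^bsub>dual_module R M\<^esub> g \<oplus>\<^bsub>dual_module R M\<^esub> h = f \<oplus>\<^bsub>dual_module R M\<^esub> (g \<oplus>\<^bsub>dual_module R M\<^esub> h)"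
    by (auto simp: R.a_ac)
  show "f \<oplus>\<^bsub>dual_module R M\<^esub> g = g \<oplus>\<^bsub>dual_module R M\<^esub> f" by (auto simp: R.a_ac)
next
  show "\<zero>\<^bsub>dual_module R M\<^esub> \<in> carrier (dual_module R M)"
    by (auto simp: module_hom_def smult_closed)
  fix f assume f: "f \<in> carrier (dual_module R M)"
  have c [simp]: "f x \<in> carrier R" if "x \<in> carrier M" for x using f that by (auto simp: module_hom_def)
  have e: "f \<in> extensional (carrier M)" using f by simp
  show "\<zero>\<^bsub>dual_module R M\<^esub> \<oplus>\<^bsub>dual_module R M\<^esub> f = f"
    using e by (intro extensionalityI[of _ "carrier M"]) auto
  show "\<exists>g\<in>carrier (dual_module R M). g \<oplus>\<^bsub>dual_module R M\<^esub> f = \<zero>\<^bsub>dual_module R M\<^esub>"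
  proof (intro bexI)
    show "(\<lambda>x\<in>carrier M. \<ominus>\<^bsub>R\<^esub> f x) \<in> carrier (dual_module R M)"
      using f by (auto simp: module_hom_def smult_closed R.minus_add R.r_minus)
    show "(\<lambda>x\<in>carrier M. \<ominus>\<^bsub>R\<^esub> f x) \<oplus>\<^bsub>dual_module R M\<^esub> f = \<zero>\<^bsub>dual_module R M\<^esub>"
      by (auto simp: R.l_neg)
  qed
qed

end

context short_local_algebra
begin

lemma left_module_dual:
  assumes "left_module A M" shows "left_module (opposite A) (dual_module A M)"
proof -
  interpret M: left_module A M by fact
  interpret op: short_local_algebra k "opposite A" J by (rule short_local_algebra_opposite)
  show ?thesis
  proof (rule left_moduleI[OF op.A.ring_axioms M.abelian_group_dual])
    fix r f assume r: "r \<in> carrier (opposite A)" and f: "f \<in> carrier (dual_module A M)"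
    have c [simp]: "f x \<in> carrier A" if "x \<in> carrier M" for x using f that by (auto simp: module_hom_def)
    have rA [simp]: "r \<in> carrier A" using r by simp
    show "r \<odot>\<^bsub>dual_module A M\<^esub> f \<in> carrier (dual_module A M)"
      using f by (auto simp: module_hom_def M.smult_closed A.l_distr A.m_assoc)
    show "(r \<oplus>\<^bsub>opposite A\<^esub> s) \<odot>\<^bsub>dual_module A M\<^esub> f
        = r \<odot>\<^bsub>dual_module A M\<^esub> f \<oplus>\<^bsub>dual_module A M\<^esub> s \<odot>\<^bsub>dual_module A M\<^esub> f"
      if "s \<in> carrier (opposite A)" for s
      using that by (auto simp: A.r_distr)
    show "(r \<otimes>\<^bsub>opposite A\<^esub> s) \<odot>\<^bsub>dual_module A M\<^esub> f = r \<odot>\<^bsub>dual_module A M\<^esub> (s \<odot>\<^bsub>dual_module A M\<^esub> f)"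
      if "s \<in> carrier (opposite A)" for s
      using that by (auto simp: A.m_assoc)
    show "r \<odot>\<^bsub>dual_module A M\<^esub> (f \<oplus>\<^bsub>dual_module A M\<^esub> g)
        = r \<odot>\<^bsub>dual_module A M\<^esub> f \<oplus>\<^bsub>dual_module A M\<^esub> r \<odot>\<^bsub>dual_module A M\<^esub> g"
      if "g \<in> carrier (dual_module A M)" for g
      using that by (auto simp: A.l_distr module_hom_def Pi_iff)
  next
    fix f assume f: "f \<in> carrier (dual_module A M)"
    show "\<one>\<^bsub>opposite A\<^esub> \<odot>\<^bsub>dual_module A M\<^esub> f = f"
      using f by (intro extensionalityI[of _ "carrier M"]) (auto simp: module_hom_def Pi_iff)
  qed
qed

lemma bidual_map_closed:
  assumes "left_module A M" "m \<in> carrier M"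
  shows "bidual_map A M m \<in> carrier (bidual_module A M)"
  using assms left_module.smult_closed[OF left_module_dual[OF assms(1)]]
    abelian_monoid.a_closed[OF abelian_group.axioms(1)[OF left_module.abelian_group_dual[OF assms(1)]]]
  by (auto simp: bidual_map_def bidual_module_def module_hom_def Pi_iff)

text \<open>
  Injectivity of the bidual map makes the pairing nondegenerate, its surjectivity represents the
  homomorphisms on \<open>M\<^sup>*\<close>.
\<close>

lemma dual_pair_of_reflexive:
  assumes M: "fd_module k A J M" and refl: "reflexive_module A M" and nz: "carrier M \<noteq> {\<zero>\<^bsub>M\<^esub>}"
    and inJ: "\<And>f m. f \<in> module_hom A M (left_regular A) \<Longrightarrow> m \<in> carrier M \<Longrightarrow> f m \<in> J"
  shows "dual_pair k A J M (dual_module A M) (\<lambda>f m. f m)"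
proof -
  interpret M: fd_module k A J M by fact
  let ?N = "dual_module A M"
  have lN: "left_module (opposite A) ?N" by (rule left_module_dual[OF M.left_module_axioms])
  interpret N: short_module k "opposite A" J ?N
    by (intro short_module.intro short_local_algebra_opposite lN)
  have fN: "f m \<in> J" "f m \<in> carrier A" if "f \<in> carrier ?N" "m \<in> carrier M" for f m using inJ[of f m] that by auto
  have f0: "f \<zero>\<^bsub>M\<^esub> = \<zero>\<^bsub>A\<^esub>" if "f \<in> carrier ?N" for f
    using that module_hom_smult[of f A M "left_regular A" "\<zero>\<^bsub>A\<^esub>" "\<zero>\<^bsub>M\<^esub>"] M.V.subspaceD(2)[OF M.V.subspace_carrier]
      fN(2)[OF that, of "\<zero>\<^bsub>M\<^esub>"] by simp
  have nondeg: "f = \<zero>\<^bsub>?N\<^esub>" if "f \<in> carrier ?N" "\<And>m. m \<in> carrier M \<Longrightarrow> f m = \<zero>\<^bsub>A\<^esub>" for f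
    using that by (intro extensionalityI[of _ "carrier M"]) auto
  interpret B: bilinear_pairing k M.V N.V A "\<lambda>m f. f m"
    by unfold_locales (auto simp: module_hom_def sc_mult Pi_iff)
  have "N.V.fin_dim" using nondeg by (intro B.fin_dim_right) (auto simp: B.annihilator_def)
  then have N: "fd_module k (opposite A) J ?N"
    by (intro fd_module.intro N.short_module_axioms fd_module_axioms.intro)
  have bij: "bij_betw (bidual_map A M) (carrier M) (carrier (bidual_module A M))"
    using refl by (simp add: reflexive_module_def)
  show ?thesis
  proof (intro dual_pair.intro short_local_algebra_axioms M N dual_pair_axioms.intro nz)
    show "f m \<in> J" if "f \<in> carrier ?N" "m \<in> carrier M" for f m using fN that by auto
    show "(f \<oplus>\<^bsub>?N\<^esub> g) m = f m \<oplus>\<^bsub>A\<^esub> g m" if "m \<in> carrier M" for f g m using that by simp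
    show "f (m \<oplus>\<^bsub>M\<^esub> m') = f m \<oplus>\<^bsub>A\<^esub> f m'" if "f \<in> carrier ?N" "m \<in> carrier M" "m' \<in> carrier M" for f m m'
      using that by (simp add: module_hom_def)
    show "(r \<odot>\<^bsub>?N\<^esub> f) m = f m \<otimes>\<^bsub>A\<^esub> r" if "m \<in> carrier M" for r f m using that by simp
    show "f (r \<odot>\<^bsub>M\<^esub> m) = r \<otimes>\<^bsub>A\<^esub> f m" if "r \<in> carrier A" "f \<in> carrier ?N" "m \<in> carrier M" for r f m
      using that by (simp add: module_hom_def)
    show "f = \<zero>\<^bsub>?N\<^esub>" if "f \<in> carrier ?N" "\<And>m. m \<in> carrier M \<Longrightarrow> f m = \<zero>\<^bsub>A\<^esub>" for f using nondeg that by blast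
    show "m = \<zero>\<^bsub>M\<^esub>" if m: "m \<in> carrier M" "\<And>f. f \<in> carrier ?N \<Longrightarrow> f m = \<zero>\<^bsub>A\<^esub>" for m
    proof -
      have z: "\<zero>\<^bsub>M\<^esub> \<in> carrier M" using M.V.subspaceD(2)[OF M.V.subspace_carrier] by simp
      have "bidual_map A M m = bidual_map A M \<zero>\<^bsub>M\<^esub>"
        unfolding bidual_map_def using m(2) f0 by (intro restrict_ext) metis
      then show ?thesis using bij m(1) z by (auto simp: bij_betw_def dest: inj_onD)
    qed
    show "\<exists>f\<in>carrier ?N. \<forall>x\<in>carrier M. f x = h x"
      if h: "h \<in> carrier M \<rightarrow> J"
        "\<And>x y. x \<in> carrier M \<Longrightarrow> y \<in> carrier M \<Longrightarrow> h (x \<oplus>\<^bsub>M\<^esub> y) = h x \<oplus>\<^bsub>A\<^esub> h y"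
        "\<And>r x. r \<in> carrier A \<Longrightarrow> x \<in> carrier M \<Longrightarrow> h (r \<odot>\<^bsub>M\<^esub> x) = r \<otimes>\<^bsub>A\<^esub> h x" for h
    proof (intro bexI)
      show "restrict h (carrier M) \<in> carrier ?N"
        using h M.V.M.a_closed by (auto simp: module_hom_def)
    qed simp
    show "\<exists>x\<in>carrier M. \<forall>f\<in>carrier ?N. f x = h f"
      if h: "h \<in> carrier ?N \<rightarrow> J"
        "\<And>f g. f \<in> carrier ?N \<Longrightarrow> g \<in> carrier ?N \<Longrightarrow> h (f \<oplus>\<^bsub>?N\<^esub> g) = h f \<oplus>\<^bsub>A\<^esub> h g"
        "\<And>r f. r \<in> carrier A \<Longrightarrow> f \<in> carrier ?N \<Longrightarrow> h (r \<odot>\<^bsub>?N\<^esub> f) = h f \<otimes>\<^bsub>A\<^esub> r" for h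
    proof -
      have cl: "f \<oplus>\<^bsub>?N\<^esub> g \<in> carrier ?N" "r \<odot>\<^bsub>?N\<^esub> f \<in> carrier ?N"
        if "f \<in> carrier ?N" "g \<in> carrier ?N" "r \<in> carrier A" for f g r
        using that N.V.M.a_closed[of f g] N.act_closed[of r f] by (simp_all del: dual_module_simps)
      have "restrict h (carrier ?N) \<in> carrier (dual_module (opposite A) ?N)"
        unfolding dual_module_simps(1)[of "opposite A"] module_hom_def
        using h cl by (auto simp del: dual_module_simps)
      then have "restrict h (carrier ?N) \<in> bidual_map A M ` carrier M"
        using bij by (simp add: bij_betw_def bidual_module_def)
      then obtain x where x: "x \<in> carrier M" "restrict h (carrier ?N) = bidual_map A M x" by auto
      have "f x = h f" if "f \<in> carrier ?N" for f
        using fun_cong[OF x(2), of f] that by (simp add: bidual_map_def)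
      then show ?thesis using x(1) by blast
    qed
  qed
qed

end

text \<open>
  A homomorphism \<open>\<phi>\<close> from \<open>M\<close> to \<open>A\<close> with \<open>\<phi>(u) = 1\<close> splits: \<open>M\<close> is the direct sum of \<open>A u\<close>, which is free, and the
  kernel \<open>S\<close> of \<open>\<phi>\<close>. The projection to \<open>S\<close> is \<open>\<tau>\<close>.
\<close>

locale free_summand = left_module A M for A :: "('k, 'a) module" and M :: "('a, 'm) module" +
  fixes \<phi> :: "'m \<Rightarrow> 'a" and u :: 'm
  assumes \<phi>: "\<phi> \<in> module_hom A M (left_regular A)" and u: "u \<in> carrier M" "\<phi> u = \<one>\<^bsub>A\<^esub>"
begin

definition S where "S = {x \<in> carrier M. \<phi> x = \<zero>\<^bsub>A\<^esub>}"

abbreviation complement where "complement \<equiv> M\<lparr>carrier := S\<rparr>"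

definition \<tau> where "\<tau> x = x \<oplus>\<^bsub>M\<^esub> (\<ominus>\<^bsub>A\<^esub> \<phi> x) \<odot>\<^bsub>M\<^esub> u"

lemma \<phi>_simps [simp]:
  "x \<in> carrier M \<Longrightarrow> \<phi> x \<in> carrier A"
  "x \<in> carrier M \<Longrightarrow> y \<in> carrier M \<Longrightarrow> \<phi> (x \<oplus>\<^bsub>M\<^esub> y) = \<phi> x \<oplus>\<^bsub>A\<^esub> \<phi> y"
  "r \<in> carrier A \<Longrightarrow> x \<in> carrier M \<Longrightarrow> \<phi> (r \<odot>\<^bsub>M\<^esub> x) = r \<otimes>\<^bsub>A\<^esub> \<phi> x"
  using \<phi> by (auto simp: module_hom_def)

lemma zero_smult: "x \<in> carrier M \<Longrightarrow> \<zero>\<^bsub>A\<^esub> \<odot>\<^bsub>M\<^esub> x = \<zero>\<^bsub>M\<^esub>"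
  using smult_l_distr[of "\<zero>\<^bsub>A\<^esub>" "\<zero>\<^bsub>A\<^esub>" x] smult_closed[of "\<zero>\<^bsub>A\<^esub>" x] by simp

lemma \<phi>_zero: "\<phi> \<zero>\<^bsub>M\<^esub> = \<zero>\<^bsub>A\<^esub>"
  using \<phi>_simps(3)[of "\<zero>\<^bsub>A\<^esub>" "\<zero>\<^bsub>M\<^esub>"] zero_smult[of "\<zero>\<^bsub>M\<^esub>"] by simp

lemma submodule_S: "Module.submodule S A M"
  unfolding submodule_iff[OF left_module_axioms]
  by (auto simp: S_def \<phi>_zero smult_closed)

lemma left_module_complement: "left_module A complement"
  by (rule left_module_submodule[OF left_module_axioms submodule_S])

lemma \<tau>_closed: "x \<in> carrier M \<Longrightarrow> \<tau> x \<in> S"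
  using u by (auto simp: \<tau>_def S_def smult_closed R.r_neg)

lemma \<tau>_S: "x \<in> S \<Longrightarrow> \<tau> x = x"
  using u by (simp add: \<tau>_def S_def zero_smult)

lemma \<tau>_hom:
  "x \<in> carrier M \<Longrightarrow> y \<in> carrier M \<Longrightarrow> \<tau> (x \<oplus>\<^bsub>M\<^esub> y) = \<tau> x \<oplus>\<^bsub>M\<^esub> \<tau> y"
  "r \<in> carrier A \<Longrightarrow> x \<in> carrier M \<Longrightarrow> \<tau> (r \<odot>\<^bsub>M\<^esub> x) = r \<odot>\<^bsub>M\<^esub> \<tau> x"
  using u by (simp_all add: \<tau>_def smult_closed smult_l_distr smult_r_distr smult_assoc[symmetric]
      R.minus_add R.r_minus M.a_ac)

lemma \<tau>_decomp: "x \<in> carrier M \<Longrightarrow> \<tau> x \<oplus>\<^bsub>M\<^esub> \<phi> x \<odot>\<^bsub>M\<^esub> u = x"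
  using u by (simp add: \<tau>_def M.a_assoc smult_closed smult_l_distr[symmetric] R.l_neg zero_smult)

lemma S_carrier: "x \<in> S \<Longrightarrow> x \<in> carrier M" by (simp add: S_def)

lemma restrict_dual: "g \<in> carrier (dual_module A M) \<Longrightarrow> restrict g S \<in> carrier (dual_module A complement)"
  using submodule_S[unfolded submodule_iff[OF left_module_axioms]]
  by (auto simp: module_hom_def S_carrier)

lemma extend_dual:
  assumes "f \<in> carrier (dual_module A complement)"
  shows "(\<lambda>x\<in>carrier M. f (\<tau> x)) \<in> carrier (dual_module A M)"
    "restrict (\<lambda>x\<in>carrier M. f (\<tau> x)) S = f"
proof -
  show "(\<lambda>x\<in>carrier M. f (\<tau> x)) \<in> carrier (dual_module A M)"
    using assms \<tau>_closed by (auto simp: module_hom_def \<tau>_hom smult_closed)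
  show "restrict (\<lambda>x\<in>carrier M. f (\<tau> x)) S = f"
    using assms by (intro extensionalityI[of _ S]) (auto simp: \<tau>_S S_carrier)
qed

text \<open>
  Restriction to \<open>S\<close> maps \<open>M\<^sup>*\<close> onto \<open>S\<^sup>*\<close>, a section being \<open>f \<mapsto> f \<circ> \<tau>\<close>. So a homomorphism \<open>\<alpha>\<close> from \<open>S\<^sup>*\<close> to \<open>A\<close> gives one on \<open>M\<^sup>*\<close>,
  which is the evaluation at some \<open>x\<close>; then \<open>\<alpha>\<close> is the evaluation at \<open>\<tau> x\<close>.
\<close>

lemma reflexive_complement:
  assumes sl: "short_local_algebra k A J" and refl: "reflexive_module A M"
  shows "reflexive_module A complement"
proof -
  interpret A: short_local_algebra k A J by fact
  have bij: "bij_betw (bidual_map A M) (carrier M) (carrier (bidual_module A M))"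
    using refl by (simp add: reflexive_module_def)
  let ?N = "dual_module A M" and ?N' = "dual_module A complement"
  have lN: "left_module (opposite A) ?N" by (rule A.left_module_dual[OF left_module_axioms])
  interpret N: left_module "opposite A" ?N by fact
  have "bij_betw (bidual_map A complement) S (carrier (bidual_module A complement))"
    unfolding bij_betw_def
  proof
    show "inj_on (bidual_map A complement) S"
    proof (rule inj_onI)
      fix x y assume x: "x \<in> S" and y: "y \<in> S" and e: "bidual_map A complement x = bidual_map A complement y"
      have "bidual_map A M x = bidual_map A M y"
        unfolding bidual_map_def
      proof (rule restrict_ext)
        fix g assume "g \<in> carrier ?N"
        then have "restrict g S \<in> carrier ?N'" by (rule restrict_dual)
        then show "g x = g y" using fun_cong[OF e, of "restrict g S"] x y
          by (simp add: bidual_map_def del: dual_module_simps)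
      qed
      then show "x = y" using bij x y S_carrier by (auto simp: bij_betw_def dest: inj_onD)
    qed
    show "bidual_map A complement ` S = carrier (bidual_module A complement)"
    proof
      show "bidual_map A complement ` S \<subseteq> carrier (bidual_module A complement)"
        using A.bidual_map_closed[OF left_module_complement] by auto
      show "carrier (bidual_module A complement) \<subseteq> bidual_map A complement ` S"
      proof
        fix \<alpha> assume \<alpha>: "\<alpha> \<in> carrier (bidual_module A complement)"
        then have \<alpha>h: "\<alpha> \<in> module_hom (opposite A) ?N' (left_regular (opposite A))" "\<alpha> \<in> extensional (carrier ?N')"
          by (simp_all add: bidual_module_def)
        define \<alpha>' where "\<alpha>' = (\<lambda>g\<in>carrier ?N. \<alpha> (restrict g S))"
        have r_add: "restrict (f \<oplus>\<^bsub>?N\<^esub> g) S = restrict f S \<oplus>\<^bsub>?N'\<^esub> restrict g S" for f g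
          by (auto simp: S_carrier)
        have r_smult: "restrict (r \<odot>\<^bsub>?N\<^esub> f) S = r \<odot>\<^bsub>?N'\<^esub> restrict f S" for r f
          by (auto simp: S_carrier)
        note ah = module_hom_closed[OF \<alpha>h(1), THEN funcset_mem] module_hom_add[OF \<alpha>h(1)] module_hom_smult[OF \<alpha>h(1)]
        have "\<alpha>' \<in> carrier (dual_module (opposite A) ?N)"
          unfolding dual_module_simps(1)[of "opposite A"] module_hom_def
          using ah restrict_dual N.a_closed N.smult_closed
          by (auto simp: \<alpha>'_def r_add r_smult simp del: dual_module_simps)
        then have "\<alpha>' \<in> bidual_map A M ` carrier M"
          using bij by (simp add: bij_betw_def bidual_module_def)
        then obtain x where x: "x \<in> carrier M" "\<alpha>' = bidual_map A M x" by auto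
        have ev: "g x = \<alpha> (restrict g S)" if "g \<in> carrier ?N" for g
          using fun_cong[OF x(2), of g] that by (simp add: \<alpha>'_def bidual_map_def del: dual_module_simps)
        have ext: "f (\<tau> x) = \<alpha> f" if "f \<in> carrier ?N'" for f
          using ev[OF extend_dual(1)[OF that]] extend_dual(2)[OF that] x(1) by simp
        have "\<alpha> = bidual_map A complement (\<tau> x)"
          using \<alpha>h(2) ext by (intro extensionalityI[of _ "carrier ?N'"]) (auto simp: bidual_map_def simp del: dual_module_simps)
        then show "\<alpha> \<in> bidual_map A complement ` S" using \<tau>_closed[OF x(1)] by auto
      qed
    qed
  qed
  then show ?thesis by (simp add: reflexive_module_def)
qed

text \<open>
  A lift on \<open>S\<close> and a preimage of the image of \<open>u\<close> determine a lift on \<open>S \<oplus> A u\<close>.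
\<close>

lemma projective_if_complement:
  assumes "projective_module A complement"
  shows "projective_module A M"
  unfolding projective_module_def
proof (intro conjI allI impI left_module_axioms)
  fix X Y :: "('a, nat \<Rightarrow> 'k) module" and f g
  assume *: "finite_length_module A X \<and> finite_length_module A Y \<and> f \<in> module_hom A X Y \<and>
    f ` carrier X = carrier Y \<and> g \<in> module_hom A M Y"
  interpret X: left_module A X using * by (simp add: finite_length_module_def)
  interpret Y: left_module A Y using * by (simp add: finite_length_module_def)
  have fh: "f \<in> module_hom A X Y" and gM: "g \<in> module_hom A M Y" and surj: "f ` carrier X = carrier Y"
    using * by blast+
  note fh = module_hom_closed[OF fh, THEN funcset_mem] module_hom_add[OF fh] module_hom_smult[OF fh]
  note gh = module_hom_closed[OF gM, THEN funcset_mem] module_hom_add[OF gM] module_hom_smult[OF gM]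
  have gC: "g \<in> module_hom A complement Y" using gM S_carrier by (simp add: module_hom_def Pi_iff)
  have lift: "\<exists>h\<in>module_hom A complement X. \<forall>x\<in>carrier complement. f (h x) = g x"
    by (rule conjunct2[OF assms[unfolded projective_module_def], rule_format, of X Y f g])
      (use * gC in simp)
  then obtain h where h: "h \<in> module_hom A complement X" "\<And>x. x \<in> S \<Longrightarrow> f (h x) = g x" by auto
  note hh = module_hom_closed[OF h(1), THEN funcset_mem, simplified] module_hom_add[OF h(1), simplified]
    module_hom_smult[OF h(1), simplified]
  have "g u \<in> f ` carrier X" using gh(1)[OF u(1)] surj by simp
  then obtain x1 where x1: "x1 \<in> carrier X" "f x1 = g u" by auto
  define H where "H x = h (\<tau> x) \<oplus>\<^bsub>X\<^esub> \<phi> x \<odot>\<^bsub>X\<^esub> x1" for x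
  have "H \<in> module_hom A M X"
    unfolding module_hom_def
    using x1(1) \<tau>_closed by (auto simp: H_def \<tau>_hom hh X.smult_closed X.smult_l_distr X.smult_r_distr
        X.smult_assoc X.M.a_ac)
  moreover have "f (H x) = g x" if x: "x \<in> carrier M" for x
  proof -
    have "f (H x) = g (\<tau> x) \<oplus>\<^bsub>Y\<^esub> \<phi> x \<odot>\<^bsub>Y\<^esub> g u"
      unfolding H_def using x x1 \<tau>_closed[OF x] hh(1) by (simp add: fh X.smult_closed h(2))
    also have "\<dots> = g (\<tau> x \<oplus>\<^bsub>M\<^esub> \<phi> x \<odot>\<^bsub>M\<^esub> u)"
      using x u S_carrier[OF \<tau>_closed[OF x]] by (simp add: gh smult_closed)
    finally show ?thesis using \<tau>_decomp[OF x] by simp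
  qed
  ultimately show "\<exists>h\<in>module_hom A M X. \<forall>x\<in>carrier M. f (h x) = g x" by blast
qed

end

context short_local_algebra
begin

lemma projective_zero_module:
  assumes M: "left_module A M" and z: "carrier M = {\<zero>\<^bsub>M\<^esub>}"
  shows "projective_module A M"
  unfolding projective_module_def
proof (intro conjI allI impI M)
  fix X Y :: "('a, nat \<Rightarrow> 'k) module" and f g
  assume *: "finite_length_module A X \<and> finite_length_module A Y \<and> f \<in> module_hom A X Y \<and>
    f ` carrier X = carrier Y \<and> g \<in> module_hom A M Y"
  interpret M: left_module A M by fact
  interpret X: short_module k A J X
    using * by (intro short_module.intro short_local_algebra_axioms) (simp add: finite_length_module_def)
  interpret Y: short_module k A J Y
    using * by (intro short_module.intro short_local_algebra_axioms) (simp add: finite_length_module_def)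
  have zX: "\<zero>\<^bsub>X\<^esub> \<in> carrier X" using X.V.subspaceD(2)[OF X.V.subspace_carrier] by simp
  have "f (\<zero>\<^bsub>A\<^esub> \<odot>\<^bsub>X\<^esub> \<zero>\<^bsub>X\<^esub>) = \<zero>\<^bsub>A\<^esub> \<odot>\<^bsub>Y\<^esub> f \<zero>\<^bsub>X\<^esub>" "f \<zero>\<^bsub>X\<^esub> \<in> carrier Y"
    using * module_hom_smult[of f A X Y "\<zero>\<^bsub>A\<^esub>" "\<zero>\<^bsub>X\<^esub>"] module_hom_closed[of f A X Y] zX by auto
  then have f0: "f \<zero>\<^bsub>X\<^esub> = \<zero>\<^bsub>Y\<^esub>" using zX by simp
  have zM: "\<zero>\<^bsub>A\<^esub> \<odot>\<^bsub>M\<^esub> \<zero>\<^bsub>M\<^esub> = \<zero>\<^bsub>M\<^esub>" "r \<odot>\<^bsub>M\<^esub> \<zero>\<^bsub>M\<^esub> = \<zero>\<^bsub>M\<^esub>" if "r \<in> carrier A" for r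
    using M.smult_closed[of _ "\<zero>\<^bsub>M\<^esub>"] z that by auto
  have "g (\<zero>\<^bsub>A\<^esub> \<odot>\<^bsub>M\<^esub> \<zero>\<^bsub>M\<^esub>) = \<zero>\<^bsub>A\<^esub> \<odot>\<^bsub>Y\<^esub> g \<zero>\<^bsub>M\<^esub>" "g \<zero>\<^bsub>M\<^esub> \<in> carrier Y"
    using * module_hom_smult[of g A M Y "\<zero>\<^bsub>A\<^esub>" "\<zero>\<^bsub>M\<^esub>"] module_hom_closed[of g A M Y] z by auto
  then have g0: "g \<zero>\<^bsub>M\<^esub> = \<zero>\<^bsub>Y\<^esub>" using zM(1)[of "\<zero>\<^bsub>A\<^esub>"] by simp
  have "(\<lambda>_. \<zero>\<^bsub>X\<^esub>) \<in> module_hom A M X" using zX X.V.M.l_zero[of "\<zero>\<^bsub>X\<^esub>"] by (simp add: module_hom_def)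
  then show "\<exists>h\<in>module_hom A M X. \<forall>x\<in>carrier M. f (h x) = g x"
    using f0 g0 z by (intro bexI[of _ "\<lambda>_. \<zero>\<^bsub>X\<^esub>"]) auto
qed

text \<open>
  Induction on the dimension. If some homomorphism \<open>M \<rightarrow> A\<close> has a value outside \<open>J\<close>, that value is a unit, and a
  free summand splits off. A complement of smaller dimension remains, again reflexive and not projective. The
  process stops at a nonzero module because the zero module is projective.
\<close>

lemma nonprojective_reflexive_dual_pair:
  fixes M :: "('a, 'm) module"
  assumes "fd_module k A J M" "reflexive_module A M" "\<not> projective_module A M"
  shows "\<exists>(M' :: ('a, 'm) module) N (B :: ('m \<Rightarrow> 'a) \<Rightarrow> 'm \<Rightarrow> 'a). dual_pair k A J M' N B"
  using assms
proof (induction "sdim k (restrict_scalars A M) (carrier M)" arbitrary: M rule: less_induct)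
  case less
  interpret M: fd_module k A J M by fact
  show ?case
  proof (cases "\<forall>f\<in>module_hom A M (left_regular A). \<forall>m\<in>carrier M. f m \<in> J")
    case True
    moreover have "carrier M \<noteq> {\<zero>\<^bsub>M\<^esub>}"
      using projective_zero_module[OF M.left_module_axioms] less.prems(3) by auto
    ultimately show ?thesis using dual_pair_of_reflexive[OF less.prems(1,2)] by blast
  next
    case False
    then obtain \<phi> m where f: "\<phi> \<in> module_hom A M (left_regular A)" "m \<in> carrier M" "\<phi> m \<notin> J" by auto
    have "\<phi> m \<in> carrier A" using module_hom_closed[OF f(1)] f(2) by auto
    then obtain s where s: "s \<in> carrier A" "s \<otimes>\<^bsub>A\<^esub> \<phi> m = \<one>\<^bsub>A\<^esub>" using inverse_outside_J f(3) by blast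
    interpret F: free_summand A M \<phi> "s \<odot>\<^bsub>M\<^esub> m"
      using f s module_hom_smult[OF f(1) s(1) f(2)] by unfold_locales auto
    have sub: "subspace k F.S M.V" using F.submodule_S by (simp add: M.submodule_iff_subspace)
    have sl: "short_module k A J F.complement"
      by (intro short_module.intro short_local_algebra_axioms F.left_module_complement)
    have fd: "fd_module k A J F.complement"
      using fd_space.fd[OF M.V.fd_space_subspace[OF sub]]
      by (intro fd_module.intro sl fd_module_axioms.intro) simp
    have "s \<odot>\<^bsub>M\<^esub> m \<notin> F.S" using F.u(2) one_notin_J J_zero by (auto simp: F.S_def)
    then have "F.S \<subset> carrier M" using F.u(1) F.S_carrier by auto
    then have "sdim k M.V F.S < sdim k M.V (carrier M)"
      using M.V.sdim_strict_mono[OF sub M.V.subspace_carrier] by simp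
    then show ?thesis
      using less.hyps[OF _ fd F.reflexive_complement[OF short_local_algebra_axioms less.prems(2)]]
        F.projective_if_complement less.prems(3) by (auto simp: sdim_def)
  qed
qed

end

section \<open>The Hilbert type and the module \<open>J\<close>\<close>

context short_local_algebra
begin

text \<open>
  Lengths are turned into dimensions of subspaces of \<open>A\<close> by rank and nullity, for ideals with the identity
  map and for \<open>J/J\<^sup>2\<close> with the quotient map.
\<close>

lemma module_image_length:
  assumes U: "subspace k U A" and Q: "left_module A Q" and im: "h ` U = carrier Q"
    and add: "\<And>x y. x \<in> U \<Longrightarrow> y \<in> U \<Longrightarrow> h (x \<oplus>\<^bsub>A\<^esub> y) = h x \<oplus>\<^bsub>Q\<^esub> h y"
    and smult: "\<And>c x. c \<in> carrier k \<Longrightarrow> x \<in> U \<Longrightarrow> h (c \<odot>\<^bsub>A\<^esub> x) = sc c \<odot>\<^bsub>Q\<^esub> h x"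
  shows "fd_module k A J Q"
    "sdim k A U = sdim k A {x \<in> U. h x = \<zero>\<^bsub>Q\<^esub>} + mlength A Q"
proof -
  interpret Q: short_module k A J Q
    by (intro short_module.intro short_local_algebra_axioms Q)
  interpret U: fd_space k "A\<lparr>carrier := U\<rparr>" by (rule A.fd_space_subspace[OF U])
  have hc: "h \<in> U \<rightarrow> carrier Q.V" using im by auto
  interpret T: linear_map k "A\<lparr>carrier := U\<rparr>" Q.V h
    by unfold_locales (use hc add smult in \<open>auto simp: module_hom_def\<close>)
  have "Q.V.fin_dim" by (rule T.rank_nullity_main(2)[OF U.fd]) (use im in simp)
  then show fdQ: "fd_module k A J Q"
    by (intro fd_module.intro Q.short_module_axioms fd_module_axioms.intro)
  show "sdim k A U = sdim k A {x \<in> U. h x = \<zero>\<^bsub>Q\<^esub>} + mlength A Q"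
    using A.rank_nullity_subspace(3)[OF U Q.vectorspace_V hc] add smult im fd_module.mlength_eq[OF fdQ] by simp
qed

lemma left_module_ideal:
  assumes "subspace k U A" "U \<subseteq> J" "\<And>r x. r \<in> J \<Longrightarrow> x \<in> U \<Longrightarrow> r \<otimes>\<^bsub>A\<^esub> x \<in> U"
  shows "left_module A ((left_regular A)\<lparr>carrier := U\<rparr>)"
proof -
  interpret L: short_module k A J "left_regular A"
    by (intro short_module.intro short_local_algebra_axioms A.left_module_left_regular)
  have "subspace k U L.V"
    by (rule L.V.subspaceI) (use subspaceD[OF assms(1)] in \<open>auto simp: sc_mult subset_iff\<close>)
  then have "Module.submodule U A (left_regular A)" using assms(3) by (simp add: L.submodule_iff_subspace)
  then show ?thesis by (rule left_module_submodule[OF A.left_module_left_regular])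
qed

lemma ideal_length:
  assumes U: "subspace k U A" "U \<subseteq> J" "\<And>r x. r \<in> J \<Longrightarrow> x \<in> U \<Longrightarrow> r \<otimes>\<^bsub>A\<^esub> x \<in> U"
  shows "fd_module k A J ((left_regular A)\<lparr>carrier := U\<rparr>)"
    "mlength A ((left_regular A)\<lparr>carrier := U\<rparr>) = sdim k A U"
proof -
  note im = module_image_length[OF U(1) left_module_ideal[OF U], of "\<lambda>x. x"]
  show "fd_module k A J ((left_regular A)\<lparr>carrier := U\<rparr>)"
    by (rule im(1)) (use U in \<open>auto simp: sc_mult\<close>)
  have "sdim k A U = sdim k A {x \<in> U. x = \<zero>\<^bsub>(left_regular A)\<lparr>carrier := U\<rparr>\<^esub>}
      + mlength A ((left_regular A)\<lparr>carrier := U\<rparr>)"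
    by (rule im(2)) (use U in \<open>auto simp: sc_mult\<close>)
  moreover have "{x \<in> U. x = \<zero>\<^bsub>(left_regular A)\<lparr>carrier := U\<rparr>\<^esub>} = {\<zero>\<^bsub>A\<^esub>}"
    using subspaceD(2)[OF U(1)] by auto
  ultimately show "mlength A ((left_regular A)\<lparr>carrier := U\<rparr>) = sdim k A U" using A.sdim_zero by simp
qed

lemma rad_module_fd: "fd_module k A J (rad_module A)"
  unfolding rad_module_def radical_eq
  by (rule ideal_length(1)[OF subspace_J order_refl J_left]) auto

lemma rad_module_simps [simp]:
  "carrier (rad_module A) = J" "\<zero>\<^bsub>rad_module A\<^esub> = \<zero>\<^bsub>A\<^esub>" "add (rad_module A) = add A"
  "smult (rad_module A) = mult A"
  by (simp_all add: rad_module_def radical_eq)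

lemma mem_coset: "y \<in> J2 +>\<^bsub>rad_module A\<^esub> x \<longleftrightarrow> (\<exists>z\<in>J2. y = z \<oplus>\<^bsub>A\<^esub> x)"
  by (auto simp: a_r_coset_def')

lemma coset_eq:
  assumes "x \<in> J" "y \<in> J"
  shows "J2 +>\<^bsub>rad_module A\<^esub> x = J2 +>\<^bsub>rad_module A\<^esub> y \<longleftrightarrow> x \<in> J2 +>\<^bsub>rad_module A\<^esub> y"
proof
  assume "J2 +>\<^bsub>rad_module A\<^esub> x = J2 +>\<^bsub>rad_module A\<^esub> y"
  moreover have "x \<in> J2 +>\<^bsub>rad_module A\<^esub> x"
    using assms J2_zero by (auto simp: mem_coset intro!: bexI[of _ "\<zero>\<^bsub>A\<^esub>"])
  ultimately show "x \<in> J2 +>\<^bsub>rad_module A\<^esub> y" by simp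
next
  assume "x \<in> J2 +>\<^bsub>rad_module A\<^esub> y"
  then obtain z where z: "z \<in> J2" "x = z \<oplus>\<^bsub>A\<^esub> y" by (auto simp: mem_coset)
  have c: "w \<in> carrier A" if "w \<in> J2" for w using J2_J[OF that] by auto
  have "w \<oplus>\<^bsub>A\<^esub> x = (w \<oplus>\<^bsub>A\<^esub> z) \<oplus>\<^bsub>A\<^esub> y" if "w \<in> J2" for w
    unfolding z(2) using c that z(1) assms by (simp add: M.a_assoc)
  moreover have "w \<oplus>\<^bsub>A\<^esub> y = (w \<oplus>\<^bsub>A\<^esub> \<ominus>\<^bsub>A\<^esub> z) \<oplus>\<^bsub>A\<^esub> x" if "w \<in> J2" for w
    unfolding z(2) using c[OF that] c[OF z(1)] J_carrier[OF assms(2)] by (simp add: M.a_assoc M.r_neg1)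
  moreover have "\<ominus>\<^bsub>A\<^esub> z \<in> J2" by (rule subspace_neg[OF subspace_J2 z(1)])
  ultimately show "J2 +>\<^bsub>rad_module A\<^esub> x = J2 +>\<^bsub>rad_module A\<^esub> y"
    using z(1) J2_add by (auto simp: mem_coset) metis+
qed

lemma rad_quotient_length:
  "mlength A (quotient_module (rad_module A) J2) = sdim k A J - sdim k A J2"
proof -
  let ?Q = "quotient_module (rad_module A) J2"
  let ?h = "\<lambda>x. J2 +>\<^bsub>rad_module A\<^esub> x"
  interpret R: fd_module k A J "rad_module A" by (rule rad_module_fd)
  have c: "w \<in> carrier A" if "w \<in> J2" for w using J2_J[OF that] by auto
  have im: "?h ` J = carrier ?Q"
    by (auto simp: quotient_module_def A_RCOSETS_def')
  have zero: "?h \<zero>\<^bsub>A\<^esub> = \<zero>\<^bsub>?Q\<^esub>"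
    using c by (auto simp: quotient_module_def mem_coset)
  have add: "?h (x \<oplus>\<^bsub>A\<^esub> y) = ?h x \<oplus>\<^bsub>?Q\<^esub> ?h y" if xy: "x \<in> J" "y \<in> J" for x y
  proof -
    have s: "u \<in> ?h x <+>\<^bsub>rad_module A\<^esub> ?h y \<longleftrightarrow> (\<exists>z\<in>J2. \<exists>w\<in>J2. u = (z \<oplus>\<^bsub>A\<^esub> x) \<oplus>\<^bsub>A\<^esub> (w \<oplus>\<^bsub>A\<^esub> y))" for u
    proof -
      have "u \<in> ?h x <+>\<^bsub>rad_module A\<^esub> ?h y \<longleftrightarrow> (\<exists>p\<in>?h x. \<exists>q\<in>?h y. u = p \<oplus>\<^bsub>A\<^esub> q)"
        by (simp add: set_add_def set_mult_def)
      then show ?thesis unfolding Bex_def mem_coset by blast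
    qed
    have e: "(z \<oplus>\<^bsub>A\<^esub> x) \<oplus>\<^bsub>A\<^esub> (w \<oplus>\<^bsub>A\<^esub> y) = (z \<oplus>\<^bsub>A\<^esub> w) \<oplus>\<^bsub>A\<^esub> (x \<oplus>\<^bsub>A\<^esub> y)" if "z \<in> J2" "w \<in> J2" for z w
      using c that xy by (simp add: M.a_ac)
    have e0: "z \<oplus>\<^bsub>A\<^esub> \<zero>\<^bsub>A\<^esub> = z" if "z \<in> J2" for z using c that by simp
    have "u \<in> ?h (x \<oplus>\<^bsub>A\<^esub> y) \<longleftrightarrow> u \<in> ?h x <+>\<^bsub>rad_module A\<^esub> ?h y" for u
      unfolding s mem_coset using e e0 J2_zero J2_add by metis
    then show ?thesis by (auto simp: quotient_module_def)
  qed
  have smult: "?h (r \<otimes>\<^bsub>A\<^esub> x) = r \<odot>\<^bsub>?Q\<^esub> ?h x" if r: "r \<in> carrier A" and x: "x \<in> J" for r x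
  proof -
    have rJ2: "r \<otimes>\<^bsub>A\<^esub> z \<in> J2" if "z \<in> J2" for z
    proof -
      obtain d y where d: "d \<in> carrier k" "y \<in> J" "r = sc d \<oplus>\<^bsub>A\<^esub> y" using scalar_plus_J[OF r] by blast
      have "r \<otimes>\<^bsub>A\<^esub> z = d \<odot>\<^bsub>A\<^esub> z" unfolding d(3) using d c[OF that] J_J2[OF d(2) that] by (simp add: A.l_distr sc_mult)
      then show ?thesis using J2_smult[OF d(1) that] by simp
    qed
    have "?h (r \<otimes>\<^bsub>A\<^esub> x') = ?h (r \<otimes>\<^bsub>A\<^esub> x)" if x': "x' \<in> ?h x" for x'
    proof -
      obtain z where z: "z \<in> J2" "x' = z \<oplus>\<^bsub>A\<^esub> x" using x' by (auto simp: mem_coset)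
      have "r \<otimes>\<^bsub>A\<^esub> x' = r \<otimes>\<^bsub>A\<^esub> z \<oplus>\<^bsub>A\<^esub> r \<otimes>\<^bsub>A\<^esub> x" unfolding z(2) using r c[OF z(1)] x by (simp add: A.r_distr)
      then have "r \<otimes>\<^bsub>A\<^esub> x' \<in> ?h (r \<otimes>\<^bsub>A\<^esub> x)" using rJ2[OF z(1)] by (auto simp: mem_coset)
      moreover have "x' \<in> J" unfolding z(2) by (rule J_add[OF J2_J[OF z(1)] x])
      ultimately show ?thesis using coset_eq J_left r x by blast
    qed
    moreover have "x \<in> ?h x" using coset_eq[OF x x] by simp
    ultimately have "(\<Union>x'\<in>?h x. ?h (r \<otimes>\<^bsub>A\<^esub> x')) = ?h (r \<otimes>\<^bsub>A\<^esub> x)" by blast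
    then show ?thesis by (simp add: quotient_module_def)
  qed
  have Q: "left_module A ?Q"
    by (rule left_module_image[OF R.left_module_axioms, of ?h]) (use im zero add smult in simp_all)
  have "{x \<in> J. ?h x = \<zero>\<^bsub>?Q\<^esub>} = J2"
  proof -
    have "?h x = ?h \<zero>\<^bsub>A\<^esub> \<longleftrightarrow> x \<in> J2" if "x \<in> J" for x
      unfolding coset_eq[OF that J_zero] mem_coset using c by auto
    then show ?thesis using zero J2_J by auto
  qed
  moreover have "?h (c \<odot>\<^bsub>A\<^esub> x) = sc c \<odot>\<^bsub>?Q\<^esub> ?h x" if "c \<in> carrier k" "x \<in> J" for c x
    using smult[of "sc c" x] sc_mult(1)[of c x] that by simp
  ultimately show ?thesis
    using module_image_length(2)[OF subspace_J Q im add] by simp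
qed

end

context dual_pair_soc
begin

lemma solid_rad_module:
  assumes wide: "\<And>z. z \<in> carrier A \<Longrightarrow> \<not> J2 \<subseteq> line z"
  shows "solid_module k A (rad_module A)"
proof -
  interpret R: fd_module k A J "rad_module A" by (rule rad_module_fd)
  have "loewy_length A (rad_module A) \<le> 2"
    unfolding loewy_length_def
    by (rule Least_le) (use J2_J_zero in \<open>simp add: rad_power_2 del: rad_power.simps\<close>)
  moreover have "J \<noteq> {\<zero>\<^bsub>A\<^esub>}"
    using wide[of "\<zero>\<^bsub>A\<^esub>"] J2_subset subspaceD(2)[OF subspace_line[of "\<zero>\<^bsub>A\<^esub>"]] by auto
  moreover have "\<exists>c\<in>carrier k. \<forall>x\<in>socle A (rad_module A). f x = sc c \<otimes>\<^bsub>A\<^esub> x"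
    if f: "f \<in> module_hom A (rad_module A) (rad_module A)" for f
  proof -
    have "left_endo f" using f by (auto simp: module_hom_def left_endo_def)
    then obtain c where c: "c \<in> carrier k" "\<And>z. z \<in> J2 \<Longrightarrow> f z = c \<odot>\<^bsub>A\<^esub> z"
      using left_endo_scalar[OF wide] by blast
    have "socle A (rad_module A) \<subseteq> left_soc" using R.socle_subset by (auto simp: left_soc_def)
    then show ?thesis using c J2_J left_soc_eq by (auto simp: sc_mult intro!: bexI[of _ c])
  qed
  ultimately show ?thesis using R.finite_length by (simp add: solid_module_def)
qed

end

theorem theorem1p1:
  fixes k :: "'k ring" and A :: "('k, 'a) module" and e a :: nat
  assumes "fd_local_algebra k A"
    and "short_algebra A"
    and "hilbert_type A e a"
    and "\<not> self_injective A"
    and "\<exists>M :: ('a, 'm) module.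
           finite_length_module A M \<and> reflexive_module A M \<and> \<not> projective_module A M"
  shows "(2 \<le> a \<and> a \<le> e - 1) \<and>
    solid_module k A (rad_module A) \<and>
    solid_module k (opposite A) (right_rad_module A)"
proof -
  let ?J = "radical A"
  interpret short_local_algebra k A ?J
    by (rule fd_local_imp_short_local_algebra[OF assms(1,2)])
  obtain M :: "('a, 'm) module" where M: "finite_length_module A M" "reflexive_module A M" "\<not> projective_module A M"
    using assms(5) by auto
  have "short_module k A ?J M"
    using M(1) by (auto simp: finite_length_module_def intro!: short_module.intro short_local_algebra_axioms)
  then have "fd_module k A ?J M" using short_module.fd_module_if_finite_length M(1) by blast
  then obtain M' :: "('a, 'm) module" and N and B :: "('m \<Rightarrow> 'a) \<Rightarrow> 'm \<Rightarrow> 'a" where "dual_pair k A ?J M' N B"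
    using nonprojective_reflexive_dual_pair M(2,3) by blast
  then interpret P: dual_pair k A ?J M' N B .
  have J0: "?J \<noteq> {\<zero>\<^bsub>A\<^esub>}"
  proof
    assume "?J = {\<zero>\<^bsub>A\<^esub>}"
    have "m = \<zero>\<^bsub>M'\<^esub>" if "m \<in> carrier M'" for m
    proof (rule P.nondegenerate_right[OF that])
      show "B f m = \<zero>\<^bsub>A\<^esub>" if "f \<in> carrier N" for f
        using P.B_J[OF that \<open>m \<in> carrier M'\<close>] \<open>radical A = {\<zero>\<^bsub>A\<^esub>}\<close> by simp
    qed
    then show False using P.nonzero P.M.V.subspaceD(2)[OF P.M.V.subspace_carrier] by (simp, blast)
  qed
  have wide: "\<not> left_soc \<subseteq> line z" if "z \<in> carrier A" for z
    using self_injective_if_left_soc_line[OF J0 that] assms(4) by blast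
  note soc = P.socles_eq_J2[OF wide]
  interpret P: dual_pair_soc k A ?J M' N B 
    by (intro dual_pair_soc.intro P.dual_pair_axioms dual_pair_soc_axioms.intro soc)
  interpret op: dual_pair_soc k "opposite A" ?J N M' "\<lambda>m f. B f m" by (rule P.dual_pair_soc_opposite)
  have wideJ2: "\<not> J2 \<subseteq> line z" if "z \<in> carrier A" for z using wide[OF that] soc(1) by simp
  have "2 \<le> sdim k A J2"
  proof -
    obtain w where w: "w \<in> J2" "w \<noteq> \<zero>\<^bsub>A\<^esub>" using left_soc_nonzero[OF J0] soc(1) by auto
    have wA: "w \<in> carrier A" using J2_J[OF w(1)] by auto
    have "line w \<subseteq> J2" using subspaceD(4)[OF subspace_J2 _ w(1)] by (auto simp: line_def)
    then have "line w \<subset> J2" using wideJ2[OF wA] by auto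
    from A.sdim_strict_mono[OF subspace_line[OF wA] subspace_J2 this]
    show ?thesis using A.sdim_line[OF wA w(2)] by simp
  qed
  moreover from P.J2_smaller[OF this] have "sdim k A J2 < sdim k A ?J - sdim k A J2" .
  moreover have "a = sdim k A J2"
    using assms(3) ideal_length(2)[OF subspace_J2 J2_subset] J_J2 J2_zero
    by (simp add: hilbert_type_def rad_power_2 del: rad_power.simps)
  moreover have "e = sdim k A ?J - sdim k A J2"
    using assms(3) rad_quotient_length by (simp add: hilbert_type_def rad_power_2 del: rad_power.simps)
  ultimately have "2 \<le> a \<and> a \<le> e - 1" by linarith
  moreover have "solid_module k A (rad_module A)" by (rule P.solid_rad_module[OF wideJ2])
  moreover have "solid_module k (opposite A) (rad_module (opposite A))"
    by (rule op.solid_rad_module) (use wideJ2 in \<open>simp add: J2_opposite P.N.line_def line_def\<close>)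
  moreover have "rad_module (opposite A) = right_rad_module A"
    using short_local_algebra.radical_eq[OF short_local_algebra_opposite]
    by (simp add: rad_module_def right_rad_module_def)
  ultimately show ?thesis by simp
qed

end
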